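(* Let $(E,\tau,M,\rho)$ be a Lie algebroid and $(E^*,\pi,M)$ its dual bundle. To each smooth section $X\in A^1(M,E)$, associate the smooth function $\Phi_X$ on $E^*$ defined by $$\Phi_X(\xi)=\bigl\langle\xi,X\circ\pi(\xi)\bigr\rangle\qquad(\xi\in E^* ).$$ There exists on $E^*$ a unique Poisson structure such that, for each pair $(X,Y)$ of smooth sections of $\tau$, $$\{\Phi_X,\Phi_Y\}=\Phi_{\{X,Y\}},$$ the bracket in the left hand side being the Poisson bracket of functions on $E^*$, and the bracket in the right hand side the bracket of sections of the Lie algebroid $(E,\tau,M,\rho)$.
   Context: A Lie algebroid $(E,\tau,M,\rho)$ is a smooth real vector bundle $(E,\tau,M)$ of finite rank over a smooth manifold $M$ (with projection $\tau:E\to M$), equipped with a Lie algebra bracket $(s_1,s_2)\mapsto\{s_1,s_2\}$ on the space $A^1(M,E)$ of smooth sections of $\tau$ and a smooth vector bundle map $\rho:E\to TM$ (the anchor), such that $s\mapsto\rho\circ s$ is a Lie algebra homomorphism into the Lie algebra of smooth vector fields on $M$, and $\{s_1,fs_2\}=f\{s_1,s_2\}+\langle df,\rho\circ s_1\rangle s_2$ for all smooth sections $s_1,s_2$ and all $f\in C^\infty(M,\mathbb{R})$. A Poisson structure on a smooth manifold $N$ is a Lie algebra bracket $(f,g)\mapsto\{f,g\}$ on $C^\infty(N,\mathbb{R})$ satisfying the Leibniz formula $\{f,gh\}=\{f,g\}h+g\{f,h\}$.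
   Formalization: The vector bundle E is assumed to have rank at least 1; in rank 0, E* is M and every Φ_X vanishes, so any Poisson structure on M satisfies the condition and uniqueness fails (for example over the plane). *)

theory Defs
  imports "HOL-Analysis.Analysis"
begin

section \<open>Smooth functions between finite-dimensional spaces\<close>

text \<open>On an open subset of a finite-dimensional space, \<open>Ck_on k f S\<close> says that \<open>f\<close> is of class
  \<open>C\<^sup>k\<close>: all iterated directional derivatives up to order \<open>k\<close> exist and are continuous.\<close>

primrec Ck_on ::
  "nat \<Rightarrow> ('a::real_normed_vector \<Rightarrow> 'b::real_normed_vector) \<Rightarrow> 'a set \<Rightarrow> bool" where
  "Ck_on 0 f S \<longleftrightarrow> continuous_on S f"
| "Ck_on (Suc k) f S \<longleftrightarrow>
     (\<forall>x\<in>S. f differentiable (at x)) \<and>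
     (\<forall>v. Ck_on k (\<lambda>x. frechet_derivative f (at x) v) S)"

definition smooth_on ::
  "'a::real_normed_vector set \<Rightarrow> ('a \<Rightarrow> 'b::real_normed_vector) \<Rightarrow> bool" where
  "smooth_on S f \<longleftrightarrow> (\<forall>k. Ck_on k f S)"

text \<open>The class \<open>euclidean_space\<close> excludes dimension zero, so manifolds are modelled on an inner
  product space with a finite spanning set instead. The following instance provides the
  zero-dimensional model space.\<close>

instantiation unit :: real_inner
begin

definition "zero_unit = ()"
definition "plus_unit (x::unit) (y::unit) = ()"
definition "scaleR_unit (r::real) (x::unit) = ()"
definition "norm_unit (x::unit) = (0::real)"
definition "dist_unit (x::unit) (y::unit) = (0::real)"
definition "sgn_unit (x::unit) = ()"
definition "inner_unit (x::unit) (y::unit) = (0::real)"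
definition [code del]:
  "(uniformity :: (unit \<times> unit) filter) = (INF e\<in>{0 <..}. principal {(x, y). dist x y < e})"
definition [code del]:
  "open (U :: unit set) \<longleftrightarrow> (\<forall>x\<in>U. eventually (\<lambda>(x', y). x' = x \<longrightarrow> y \<in> U) uniformity)"

instance
  by standard
    (auto simp: norm_unit_def dist_unit_def inner_unit_def uniformity_unit_def open_unit_def)

end

section \<open>Smooth manifolds\<close>

text \<open>A manifold is given by its atlas; its points are the union of the chart domains and its
  topology is the one induced by the charts. Only the values of \<open>\<phi>\<close> on \<open>U\<close> matter in a chart
  \<open>(U, \<phi>)\<close>.\<close>

type_synonym ('a, 'v) atlas = "('a set \<times> ('a \<Rightarrow> 'v)) set"

definition points :: "('a, 'v) atlas \<Rightarrow> 'a set" where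
  "points A = (\<Union>(U, \<phi>)\<in>A. U)"

definition atlas_topology :: "('a, 'v::topological_space) atlas \<Rightarrow> 'a topology" where
  "atlas_topology A =
     topology (\<lambda>W. W \<subseteq> points A \<and> (\<forall>(U, \<phi>)\<in>A. open (\<phi> ` (U \<inter> W))))"

definition smooth_manifold :: "('a, 'v::real_inner) atlas \<Rightarrow> bool" where
  "smooth_manifold A \<longleftrightarrow>
     (\<exists>B::'v set. finite B \<and> span B = UNIV) \<and>
     (\<forall>(U, \<phi>)\<in>A. inj_on \<phi> U) \<and>
     (\<forall>(U, \<phi>)\<in>A. \<forall>(V, \<theta>)\<in>A.
        open (\<phi> ` (U \<inter> V)) \<and> smooth_on (\<phi> ` (U \<inter> V)) (\<theta> \<circ> inv_into U \<phi>)) \<and>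
     Hausdorff_space (atlas_topology A) \<and>
     second_countable (atlas_topology A)"

definition smooth_map ::
  "('a, 'v::real_inner) atlas \<Rightarrow> ('b, 'u::real_inner) atlas \<Rightarrow> ('a \<Rightarrow> 'b) \<Rightarrow> bool" where
  "smooth_map A B f \<longleftrightarrow>
     continuous_map (atlas_topology A) (atlas_topology B) f \<and>
     (\<forall>(U, \<phi>)\<in>A. \<forall>(V, \<theta>)\<in>B. smooth_on (\<phi> ` (U \<inter> f -` V)) (\<theta> \<circ> f \<circ> inv_into U \<phi>))"

definition diffeomorphism ::
  "('a, 'v::real_inner) atlas \<Rightarrow> ('b, 'u::real_inner) atlas \<Rightarrow> ('a \<Rightarrow> 'b) \<Rightarrow> bool" where
  "diffeomorphism A B f \<longleftrightarrow>
     bij_betw f (points A) (points B) \<and> smooth_map A B f \<and>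
     smooth_map B A (inv_into (points A) f)"

definition restrict_atlas :: "('a, 'v) atlas \<Rightarrow> 'a set \<Rightarrow> ('a, 'v) atlas" where
  "restrict_atlas A W = (\<lambda>(U, \<phi>). (U \<inter> W, \<phi>)) ` A"

text \<open>The product of a manifold with the vector space \<open>'w\<close>.\<close>

definition times_space :: "('a, 'v) atlas \<Rightarrow> ('a \<times> 'w, 'v \<times> 'w) atlas" where
  "times_space A = (\<lambda>(U, \<phi>). (U \<times> UNIV, \<lambda>(x, w). (\<phi> x, w))) ` A"

text \<open>The elements of \<open>C\<^sup>\<infinity>\<close> are extended by zero outside the manifold, so that equality of
  smooth functions is equality in the logic and the operations are pointwise.\<close>

definition Cinf :: "('a, 'v::real_inner) atlas \<Rightarrow> ('a \<Rightarrow> real) set" where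
  "Cinf A = {f. (\<forall>x. x \<notin> points A \<longrightarrow> f x = 0) \<and>
                (\<forall>(U, \<phi>)\<in>A. smooth_on (\<phi> ` U) (f \<circ> inv_into U \<phi>))}"

section \<open>Vector bundles\<close>

record ('e, 'm, 'u) bundle_data =
  total_atlas :: "('e, 'u) atlas"
  projection :: "'e \<Rightarrow> 'm"
  fadd :: "'e \<Rightarrow> 'e \<Rightarrow> 'e"
  fscale :: "real \<Rightarrow> 'e \<Rightarrow> 'e"
  fzero :: "'m \<Rightarrow> 'e"

definition over :: "('e, 'm, 'u) bundle_data \<Rightarrow> 'm set \<Rightarrow> 'e set" where
  "over E U = {e \<in> points (total_atlas E). projection E e \<in> U}"

abbreviation fibre :: "('e, 'm, 'u) bundle_data \<Rightarrow> 'm \<Rightarrow> 'e set" where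
  "fibre E x \<equiv> over E {x}"

definition local_trivialization ::
  "('m, 'v::real_inner) atlas \<Rightarrow> ('e, 'm, 'v \<times> 'w::real_inner) bundle_data \<Rightarrow> 'm set \<Rightarrow>
   ('e \<Rightarrow> 'm \<times> 'w) \<Rightarrow> bool" where
  "local_trivialization M E U \<psi> \<longleftrightarrow>
     openin (atlas_topology M) U \<and>
     diffeomorphism (restrict_atlas (total_atlas E) (over E U)) (times_space (restrict_atlas M U)) \<psi> \<and>
     (\<forall>e\<in>over E U. fst (\<psi> e) = projection E e) \<and>
     (\<forall>x\<in>U.
        (\<forall>a\<in>fibre E x. \<forall>b\<in>fibre E x. snd (\<psi> (fadd E a b)) = snd (\<psi> a) + snd (\<psi> b)) \<and>
        (\<forall>c. \<forall>a\<in>fibre E x. snd (\<psi> (fscale E c a)) = c *\<^sub>R snd (\<psi> a)) \<and>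
        snd (\<psi> (fzero E x)) = 0)"

text \<open>Since trivializations are bijective and linear on fibres, the vector space axioms for the
  fibres follow from closure under the operations.\<close>

definition vector_bundle ::
  "('m, 'v::real_inner) atlas \<Rightarrow> ('e, 'm, 'v \<times> 'w::real_inner) bundle_data \<Rightarrow> bool" where
  "vector_bundle M E \<longleftrightarrow>
     smooth_manifold M \<and> smooth_manifold (total_atlas E) \<and> smooth_map (total_atlas E) M (projection E) \<and>
     (\<forall>x\<in>points M.
        (\<forall>a\<in>fibre E x. \<forall>b\<in>fibre E x. fadd E a b \<in> fibre E x) \<and>
        (\<forall>c. \<forall>a\<in>fibre E x. fscale E c a \<in> fibre E x) \<and>
        fzero E x \<in> fibre E x) \<and>
     (\<forall>x\<in>points M. \<exists>U \<psi>. x \<in> U \<and> local_trivialization M E U \<psi>)"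

definition vector_bundle_map ::
  "('m, 'v::real_inner) atlas \<Rightarrow> ('e, 'm, 'u::real_inner) bundle_data \<Rightarrow>
   ('f, 'm, 't::real_inner) bundle_data \<Rightarrow> ('e \<Rightarrow> 'f) \<Rightarrow> bool" where
  "vector_bundle_map M E F \<rho> \<longleftrightarrow>
     smooth_map (total_atlas E) (total_atlas F) \<rho> \<and>
     (\<forall>e\<in>points (total_atlas E). projection F (\<rho> e) = projection E e) \<and>
     (\<forall>x\<in>points M.
        (\<forall>a\<in>fibre E x. \<forall>b\<in>fibre E x. \<rho> (fadd E a b) = fadd F (\<rho> a) (\<rho> b)) \<and>
        (\<forall>c. \<forall>a\<in>fibre E x. \<rho> (fscale E c a) = fscale F c (\<rho> a)))"

definition sections ::
  "('m, 'v::real_inner) atlas \<Rightarrow> ('e, 'm, 'u::real_inner) bundle_data \<Rightarrow> ('m \<Rightarrow> 'e) set" where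
  "sections M E = {s \<in> extensional (points M).
     smooth_map M (total_atlas E) s \<and> (\<forall>x\<in>points M. projection E (s x) = x)}"

definition section_mult ::
  "('m, 'v) atlas \<Rightarrow> ('e, 'm, 'u) bundle_data \<Rightarrow> ('m \<Rightarrow> real) \<Rightarrow> ('m \<Rightarrow> 'e) \<Rightarrow> ('m \<Rightarrow> 'e)" where
  "section_mult M E f s = (\<lambda>x\<in>points M. fscale E (f x) (s x))"

definition section_add ::
  "('m, 'v) atlas \<Rightarrow> ('e, 'm, 'u) bundle_data \<Rightarrow> ('m \<Rightarrow> 'e) \<Rightarrow> ('m \<Rightarrow> 'e) \<Rightarrow> ('m \<Rightarrow> 'e)" where
  "section_add M E s t = (\<lambda>x\<in>points M. fadd E (s x) (t x))"

subsection \<open>The dual bundle\<close>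

definition dual_space :: "('e, 'm, 'u) bundle_data \<Rightarrow> 'm \<Rightarrow> ('e \<Rightarrow> real) set" where
  "dual_space E x = {\<xi>.
     (\<forall>e. e \<notin> fibre E x \<longrightarrow> \<xi> e = 0) \<and>
     (\<forall>a\<in>fibre E x. \<forall>b\<in>fibre E x. \<xi> (fadd E a b) = \<xi> a + \<xi> b) \<and>
     (\<forall>c. \<forall>a\<in>fibre E x. \<xi> (fscale E c a) = c * \<xi> a)}"

text \<open>The charts of the dual bundle use the coordinates of a covector with respect to the dual of
  the local frame \<open>x \<mapsto> \<psi>\<^sup>-\<^sup>1 (x, axis i 1)\<close> of a local trivialization \<open>\<psi>\<close>.\<close>

definition dual_bundle ::
  "('m, 'v::real_inner) atlas \<Rightarrow> ('e, 'm, 'v \<times> (real^'k::finite)) bundle_data \<Rightarrow>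
   ('m \<times> ('e \<Rightarrow> real), 'm, 'v \<times> (real^'k)) bundle_data" where
  "dual_bundle M E =
     \<lparr> total_atlas = {((SIGMA x:U \<inter> V. dual_space E x),
                 (\<lambda>(x, \<xi>). (\<phi> x, \<chi> i. \<xi> (inv_into (over E U) \<psi> (x, axis i 1)))))
                | U \<psi> V \<phi>. local_trivialization M E U \<psi> \<and> (V, \<phi>) \<in> M},
       projection = fst,
       fadd = (\<lambda>(x, \<xi>) (_, \<eta>). (x, \<lambda>e. \<xi> e + \<eta> e)),
       fscale = (\<lambda>c (x, \<xi>). (x, \<lambda>e. c * \<xi> e)),
       fzero = (\<lambda>x. (x, \<lambda>_. 0)) \<rparr>"

subsection \<open>The tangent bundle\<close>

text \<open>Tangent vectors at \<open>x\<close> are the derivations of \<open>C\<^sup>\<infinity>\<close> at \<open>x\<close>.\<close>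

definition tangent_space ::
  "('m, 'v::real_inner) atlas \<Rightarrow> 'm \<Rightarrow> (('m \<Rightarrow> real) \<Rightarrow> real) set" where
  "tangent_space M x = {D.
     (\<forall>f. f \<notin> Cinf M \<longrightarrow> D f = 0) \<and>
     (\<forall>f\<in>Cinf M. \<forall>g\<in>Cinf M. D (\<lambda>y. f y + g y) = D f + D g) \<and>
     (\<forall>c. \<forall>f\<in>Cinf M. D (\<lambda>y. c * f y) = c * D f) \<and>
     (\<forall>f\<in>Cinf M. \<forall>g\<in>Cinf M. D (\<lambda>y. f y * g y) = D f * g x + f x * D g)}"

text \<open>In the chart \<open>(U, \<phi>)\<close>, the coordinates of a tangent vector \<open>D\<close> at \<open>x\<close> are the vector
  \<open>a\<close> such that \<open>D\<close> is the directional derivative along \<open>a\<close>.\<close>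

definition tangent_bundle ::
  "('m, 'v::real_inner) atlas \<Rightarrow> ('m \<times> (('m \<Rightarrow> real) \<Rightarrow> real), 'm, 'v \<times> 'v) bundle_data" where
  "tangent_bundle M =
     \<lparr> total_atlas = {((SIGMA x:U. tangent_space M x),
                 (\<lambda>(x, D). (\<phi> x, THE a. \<forall>f\<in>Cinf M.
                    D f = frechet_derivative (f \<circ> inv_into U \<phi>) (at (\<phi> x)) a)))
                | U \<phi>. (U, \<phi>) \<in> M},
       projection = fst,
       fadd = (\<lambda>(x, D) (_, D'). (x, \<lambda>f. D f + D' f)),
       fscale = (\<lambda>c (x, D). (x, \<lambda>f. c * D f)),
       fzero = (\<lambda>x. (x, \<lambda>_. 0)) \<rparr>"

text \<open>\<open>differential_pairing M f V\<close> is the function \<open>\<langle>df, V\<rangle>\<close>, for a vector field \<open>V\<close>.\<close>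

definition differential_pairing ::
  "('m, 'v) atlas \<Rightarrow> ('m \<Rightarrow> real) \<Rightarrow> ('m \<Rightarrow> 'm \<times> (('m \<Rightarrow> real) \<Rightarrow> real)) \<Rightarrow> ('m \<Rightarrow> real)" where
  "differential_pairing M f V = (\<lambda>x. if x \<in> points M then snd (V x) f else 0)"

definition vector_field_bracket ::
  "('m, 'v) atlas \<Rightarrow> ('m \<Rightarrow> 'm \<times> (('m \<Rightarrow> real) \<Rightarrow> real)) \<Rightarrow>
   ('m \<Rightarrow> 'm \<times> (('m \<Rightarrow> real) \<Rightarrow> real)) \<Rightarrow> ('m \<Rightarrow> 'm \<times> (('m \<Rightarrow> real) \<Rightarrow> real))" where
  "vector_field_bracket M V W = (\<lambda>x\<in>points M. (x, \<lambda>f.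
     snd (V x) (differential_pairing M f W) - snd (W x) (differential_pairing M f V)))"

section \<open>Lie algebras\<close>

text \<open>The carriers used below are vector spaces by construction, so only the axioms
  concerning the bracket are listed.\<close>

record 'g lie_data =
  lcarrier :: "'g set"
  ladd :: "'g \<Rightarrow> 'g \<Rightarrow> 'g"
  lscale :: "real \<Rightarrow> 'g \<Rightarrow> 'g"
  lzero :: 'g
  lbracket :: "'g \<Rightarrow> 'g \<Rightarrow> 'g"

definition lie_algebra_bracket :: "'g lie_data \<Rightarrow> bool" where
  "lie_algebra_bracket L \<longleftrightarrow>
     (\<forall>x\<in>lcarrier L. \<forall>y\<in>lcarrier L. lbracket L x y \<in> lcarrier L) \<and>
     (\<forall>x\<in>lcarrier L. \<forall>y\<in>lcarrier L. \<forall>z\<in>lcarrier L.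
        lbracket L (ladd L x y) z = ladd L (lbracket L x z) (lbracket L y z) \<and>
        lbracket L z (ladd L x y) = ladd L (lbracket L z x) (lbracket L z y)) \<and>
     (\<forall>c. \<forall>x\<in>lcarrier L. \<forall>y\<in>lcarrier L.
        lbracket L (lscale L c x) y = lscale L c (lbracket L x y) \<and>
        lbracket L x (lscale L c y) = lscale L c (lbracket L x y)) \<and>
     (\<forall>x\<in>lcarrier L. lbracket L x x = lzero L) \<and>
     (\<forall>x\<in>lcarrier L. \<forall>y\<in>lcarrier L. \<forall>z\<in>lcarrier L.
        ladd L (lbracket L x (lbracket L y z))
          (ladd L (lbracket L y (lbracket L z x)) (lbracket L z (lbracket L x y))) = lzero L)"

definition lie_algebra_hom :: "'g lie_data \<Rightarrow> 'h lie_data \<Rightarrow> ('g \<Rightarrow> 'h) \<Rightarrow> bool" where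
  "lie_algebra_hom L L' h \<longleftrightarrow>
     (\<forall>x\<in>lcarrier L. h x \<in> lcarrier L') \<and>
     (\<forall>x\<in>lcarrier L. \<forall>y\<in>lcarrier L. h (ladd L x y) = ladd L' (h x) (h y)) \<and>
     (\<forall>c. \<forall>x\<in>lcarrier L. h (lscale L c x) = lscale L' c (h x)) \<and>
     (\<forall>x\<in>lcarrier L. \<forall>y\<in>lcarrier L. h (lbracket L x y) = lbracket L' (h x) (h y))"

definition section_lie_data ::
  "('m, 'v::real_inner) atlas \<Rightarrow> ('e, 'm, 'u::real_inner) bundle_data \<Rightarrow>
   (('m \<Rightarrow> 'e) \<Rightarrow> ('m \<Rightarrow> 'e) \<Rightarrow> ('m \<Rightarrow> 'e)) \<Rightarrow> ('m \<Rightarrow> 'e) lie_data" where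
  "section_lie_data M E br =
     \<lparr> lcarrier = sections M E,
       ladd = section_add M E,
       lscale = (\<lambda>c. section_mult M E (\<lambda>_. c)),
       lzero = (\<lambda>x\<in>points M. fzero E x),
       lbracket = br \<rparr>"

definition function_lie_data ::
  "('a, 'v::real_inner) atlas \<Rightarrow>
   (('a \<Rightarrow> real) \<Rightarrow> ('a \<Rightarrow> real) \<Rightarrow> ('a \<Rightarrow> real)) \<Rightarrow> ('a \<Rightarrow> real) lie_data" where
  "function_lie_data N P =
     \<lparr> lcarrier = Cinf N,
       ladd = (\<lambda>f g x. f x + g x),
       lscale = (\<lambda>c f x. c * f x),
       lzero = (\<lambda>_. 0),
       lbracket = P \<rparr>"

section \<open>Lie algebroids and Poisson structures\<close>

definition lie_algebroid ::
  "('m, 'v::real_inner) atlas \<Rightarrow> ('e, 'm, 'v \<times> 'w::real_inner) bundle_data \<Rightarrow>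
   ('e \<Rightarrow> 'm \<times> (('m \<Rightarrow> real) \<Rightarrow> real)) \<Rightarrow>
   (('m \<Rightarrow> 'e) \<Rightarrow> ('m \<Rightarrow> 'e) \<Rightarrow> ('m \<Rightarrow> 'e)) \<Rightarrow> bool" where
  "lie_algebroid M E \<rho> br \<longleftrightarrow>
     vector_bundle M E \<and>
     lie_algebra_bracket (section_lie_data M E br) \<and>
     vector_bundle_map M E (tangent_bundle M) \<rho> \<and>
     lie_algebra_hom (section_lie_data M E br)
       (section_lie_data M (tangent_bundle M) (vector_field_bracket M))
       (compose (points M) \<rho>) \<and>
     (\<forall>s\<in>sections M E. \<forall>t\<in>sections M E. \<forall>f\<in>Cinf M.
        br s (section_mult M E f t) =
        section_add M E (section_mult M E f (br s t))
          (section_mult M E (differential_pairing M f (compose (points M) \<rho> s)) t))"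

definition poisson_structure ::
  "('a, 'v::real_inner) atlas \<Rightarrow> (('a \<Rightarrow> real) \<Rightarrow> ('a \<Rightarrow> real) \<Rightarrow> ('a \<Rightarrow> real)) \<Rightarrow> bool" where
  "poisson_structure N P \<longleftrightarrow>
     P \<in> Cinf N \<rightarrow>\<^sub>E (Cinf N \<rightarrow>\<^sub>E Cinf N) \<and>
     lie_algebra_bracket (function_lie_data N P) \<and>
     (\<forall>f\<in>Cinf N. \<forall>g\<in>Cinf N. \<forall>h\<in>Cinf N.
        P f (\<lambda>x. g x * h x) = (\<lambda>x. P f g x * h x + g x * P f h x))"

text \<open>The fibre model \<open>real^'k\<close> makes the rank positive. In rank zero \<open>E\<^sup>*\<close> is \<open>M\<close> and every
  \<open>\<Phi>\<^sub>X\<close> vanishes, so the bracket would not be determined by its values on these functions.\<close>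

definition Phi ::
  "('m, 'v::real_inner) atlas \<Rightarrow> ('e, 'm, 'v \<times> (real^'k::finite)) bundle_data \<Rightarrow>
   ('m \<Rightarrow> 'e) \<Rightarrow> ('m \<times> ('e \<Rightarrow> real)) \<Rightarrow> real" where
  "Phi M E X = (\<lambda>\<xi>. if \<xi> \<in> points (total_atlas (dual_bundle M E))
     then snd \<xi> (X (projection (dual_bundle M E) \<xi>)) else 0)"

end

theory Submission
  imports Defs
begin

text \<open>Let \<open>A\<close> be the space of fibrewise affine functions \<open>\<Phi>\<^sub>X + f \<circ> \<pi>\<close> on \<open>E\<^sup>*\<close>. The algebroid dictates
  \<open>{\<Phi>\<^sub>X + f \<circ> \<pi>, \<Phi>\<^sub>Y + g \<circ> \<pi>} = \<Phi>\<^bsub>{X,Y}\<^esub> + (\<rho>(X)g - \<rho>(Y)f) \<circ> \<pi>\<close>, a Lie bracket on \<open>A\<close>. It is tensorial: its value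
  at a point depends only on the differentials there. By Hadamard's lemma the differential of any
  smooth function is near each point a combination, with smooth coefficients, of differentials of
  elements of \<open>A\<close>. So the bracket extends uniquely to a biderivation, and the Jacobi identity carries
  over since the Jacobiator is a derivation in each argument.

  For uniqueness, the brackets with \<open>f \<circ> \<pi>\<close> are forced by \<open>\<Phi>\<^bsub>fY\<^esub> = (f \<circ> \<pi>) \<Phi>\<^sub>Y\<close> and the Leibniz formula,
  because a smooth function whose product with every \<open>\<Phi>\<^sub>Y\<close> vanishes is zero.\<close>

section \<open>Finite-dimensional inner product spaces\<close>

text \<open>The bracket of the algebroid takes global sections and the anchor acts on global
  functions, while frames and coordinates exist only locally. Hence every local object is cut off to
  a global one: a frame \<open>e\<close>, coordinates \<open>y\<close> and a function
  \<open>h\<close> that is 1 near the point. Multiplying by \<open>h\<close> and applying the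
  Leibniz rule takes the place of a locality argument. Cutoffs depend on the base point only,
  because multiplication by a function of the base turns sections into sections.

  Differentials on the dual bundle are tested by derivations at a point. Two families carry the
  tensoriality argument: vertical derivations read off the value of a section, and lifts of the
  derivations given by the anchor read off its first derivatives.

  The extended bracket is defined pointwise, by choosing at each point an affine function with the
  same differential, so nothing has to be glued; smoothness is a separate local computation.\<close>

definition orthobasis :: "'a::real_inner set \<Rightarrow> bool" where
  "orthobasis B \<longleftrightarrow> finite B \<and> (\<forall>b\<in>B. \<forall>c\<in>B. b \<bullet> c = (if b = c then 1 else 0)) \<and>
     (\<forall>x. (\<Sum>b\<in>B. (x \<bullet> b) *\<^sub>R b) = x)"

lemma orthobasis_finite: "orthobasis B \<Longrightarrow> finite B"
  and orthobasis_expand: "orthobasis B \<Longrightarrow> (\<Sum>b\<in>B. (x \<bullet> b) *\<^sub>R b) = x"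
  by (auto simp: orthobasis_def)

text \<open>Stands in for \<open>Basis\<close>, since model spaces may have dimension zero. An
  orthogonal spanning set is stripped of 0 and normalised; the vectors equal to their expansion form
  a subspace, so checking the spanning set is enough.\<close>

lemma ex_orthobasis:
  fixes B :: "'a::real_inner set"
  assumes "finite B" "span B = UNIV"
  shows "\<exists>C::'a set. orthobasis C"
proof -
  obtain C :: "'a set" where C: "finite C" "span C = UNIV" "pairwise orthogonal C"
    using basis_orthogonal[OF assms(1)] assms(2) by auto
  define D where "D = (\<lambda>x. x /\<^sub>R norm x) ` (C - {0})"
  have fin: "finite D" using C by (simp add: D_def)
  have orth: "b \<bullet> c = (if b = c then 1 else 0)" if bc: "b \<in> D" "c \<in> D" for b c
  proof -
    obtain u v where u: "u \<in> C" "u \<noteq> 0" "b = u /\<^sub>R norm u" and v: "v \<in> C" "v \<noteq> 0" "c = v /\<^sub>R norm v"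
      using bc unfolding D_def by blast
    show ?thesis
    proof (cases "u = v")
      case True
      then show ?thesis using u v by (simp add: dot_square_norm power2_eq_square)
    next
      case False
      then have "u \<bullet> v = 0" using C(3) u v by (auto simp: pairwise_def orthogonal_def)
      then have 0: "b \<bullet> c = 0" using u v by simp
      moreover have "b \<bullet> b \<noteq> 0" using u by simp
      ultimately show ?thesis by auto
    qed
  qed
  have "(\<Sum>b\<in>D. (x \<bullet> b) *\<^sub>R b) = x" for x
  proof (rule span_induct[of x C "\<lambda>x. (\<Sum>b\<in>D. (x \<bullet> b) *\<^sub>R b) = x"])
    show "x \<in> span C" using C by simp
    show "subspace {x. (\<Sum>b\<in>D. (x \<bullet> b) *\<^sub>R b) = x}"
      by (auto simp: subspace_def inner_add_left scaleR_add_left sum.distrib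
          simp flip: scaleR_scaleR scaleR_sum_right)
  next
    fix u assume u: "u \<in> C"
    show "(\<Sum>b\<in>D. (u \<bullet> b) *\<^sub>R b) = u"
    proof (cases "u = 0")
      case False
      define b where "b = u /\<^sub>R norm u"
      have bD: "b \<in> D" using u False by (auto simp: b_def D_def)
      have ub: "u = norm u *\<^sub>R b" using False by (simp add: b_def)
      have "(\<Sum>c\<in>D. (u \<bullet> c) *\<^sub>R c) = (\<Sum>c\<in>D. if c = b then u else 0)"
      proof (rule sum.cong[OF refl])
        fix c assume c: "c \<in> D"
        have "u \<bullet> c = norm u * (b \<bullet> c)" by (subst ub) (simp add: inner_scaleR_left)
        then show "(u \<bullet> c) *\<^sub>R c = (if c = b then u else 0)"
          using orth[OF bD c] ub by (auto split: if_splits)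
      qed
      then show ?thesis using fin bD by simp
    qed simp
  qed
  then show ?thesis using fin orth by (intro exI[of _ D]) (auto simp: orthobasis_def)
qed

lemma orthobasis_Basis: "orthobasis (Basis :: 'a::euclidean_space set)"
  by (auto simp: orthobasis_def inner_Basis euclidean_representation)

lemma orthobasis_Times:
  fixes B :: "'a::real_inner set" and C :: "'b::real_inner set"
  assumes B: "orthobasis B" and C: "orthobasis C"
  shows "orthobasis ((\<lambda>b. (b, 0)) ` B \<union> (\<lambda>c. (0, c)) ` C)"
proof -
  have nz: "0 \<notin> B" "0 \<notin> C"
    using B C by (auto simp: orthobasis_def) (metis inner_zero_left zero_neq_one)+
  have "(\<Sum>b\<in>(\<lambda>b. (b, 0)) ` B \<union> (\<lambda>c. (0, c)) ` C. (x \<bullet> b) *\<^sub>R b) = x" for x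
  proof -
    have "(\<Sum>b\<in>(\<lambda>b. (b, 0)) ` B \<union> (\<lambda>c. (0, c)) ` C. (x \<bullet> b) *\<^sub>R b) =
      (\<Sum>b\<in>(\<lambda>b. (b, 0)) ` B. (x \<bullet> b) *\<^sub>R b) + (\<Sum>b\<in>(\<lambda>c. (0, c)) ` C. (x \<bullet> b) *\<^sub>R b)"
      using B C nz by (intro sum.union_disjoint) (auto simp: orthobasis_def)
    also have "\<dots> = (\<Sum>b\<in>B. (x \<bullet> (b,0)) *\<^sub>R (b,0)) + (\<Sum>c\<in>C. (x \<bullet> (0,c)) *\<^sub>R (0,c))"
      by (subst (1 2) sum.reindex) (auto simp: inj_on_def)
    also have "\<dots> = x"
      using orthobasis_expand[OF B, of "fst x"] orthobasis_expand[OF C, of "snd x"]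
      by (simp add: prod_eq_iff inner_prod_def fst_sum snd_sum)
    finally show ?thesis .
  qed
  moreover have "x \<bullet> y = (if x = y then 1 else 0)"
    if "x \<in> (\<lambda>b. (b, 0)) ` B \<union> (\<lambda>c. (0, c)) ` C" "y \<in> (\<lambda>b. (b, 0)) ` B \<union> (\<lambda>c. (0, c)) ` C" for x y
  proof -
    have "b \<bullet> c = (if b = c then 1 else 0)" if "b \<in> B" "c \<in> B" for b c
      using B that by (auto simp: orthobasis_def)
    moreover have "b \<bullet> c = (if b = c then 1 else 0)" if "b \<in> C" "c \<in> C" for b c
      using C that by (auto simp: orthobasis_def)
    ultimately show ?thesis using that nz by (elim UnE imageE) auto
  qed
  ultimately show ?thesis
    using B C by (simp add: orthobasis_def)
qed

lemma linear_orthobasis: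
  assumes "orthobasis B" "linear f"
  shows "f x = (\<Sum>b\<in>B. (x \<bullet> b) *\<^sub>R f b)"
proof -
  have "f x = f (\<Sum>b\<in>B. (x \<bullet> b) *\<^sub>R b)"
    using assms orthobasis_expand by metis
  also have "\<dots> = (\<Sum>b\<in>B. (x \<bullet> b) *\<^sub>R f b)"
    using assms by (simp add: linear_sum linear_scale)
  finally show ?thesis .
qed

section \<open>Calculus of smooth functions\<close>

lemma Ck_on_has_derivative:
  "Ck_on (Suc k) f S \<Longrightarrow> x \<in> S \<Longrightarrow> (f has_derivative frechet_derivative f (at x)) (at x)"
  using frechet_derivative_works by auto

text \<open>Openness of \<open>S\<close> matters because \<open>Ck_on\<close> uses derivatives in
  the whole space, which the values on \<open>S\<close> determine only for open
  \<open>S\<close>.\<close>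

lemma Ck_on_cong:
  assumes "open S" "\<And>x. x \<in> S \<Longrightarrow> f x = g x" "Ck_on k f S"
  shows "Ck_on k g S"
  using assms
proof (induction k arbitrary: f g)
  case 0
  then show ?case by (metis Ck_on.simps(1) continuous_on_cong)
next
  case (Suc k)
  have d: "(g has_derivative frechet_derivative f (at x)) (at x)" if "x \<in> S" for x
    using Ck_on_has_derivative[OF Suc.prems(3) that] Suc.prems(1,2) that
    by (metis has_derivative_transform_within_open)
  then have e: "frechet_derivative f (at x) = frechet_derivative g (at x)" if "x \<in> S" for x
    using that by (metis frechet_derivative_at)
  have "Ck_on k (\<lambda>x. frechet_derivative g (at x) v) S" for v
    by (rule Suc.IH[OF Suc.prems(1), of "\<lambda>x. frechet_derivative f (at x) v"])
      (use e Suc.prems(3) in auto)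
  then show ?case using d by (auto simp: differentiable_def)
qed

text \<open>Lets a proof work with an explicit derivative \<open>f'\<close>; uniqueness of
  derivatives identifies it with \<open>frechet_derivative\<close>.\<close>

lemma Ck_on_SucI:
  assumes "open S" "\<And>x. x \<in> S \<Longrightarrow> (f has_derivative f' x) (at x)" "\<And>v. Ck_on k (\<lambda>x. f' x v) S"
  shows "Ck_on (Suc k) f S"
proof -
  have "f' x = frechet_derivative f (at x)" if "x \<in> S" for x
    using frechet_derivative_at[OF assms(2)[OF that]] .
  then have "Ck_on k (\<lambda>x. frechet_derivative f (at x) v) S" for v
    by (intro Ck_on_cong[OF assms(1) _ assms(3)[of v]]) simp
  then show ?thesis using assms(2) by (auto simp: differentiable_def)
qed

lemma Ck_on_Suc_imp: "Ck_on (Suc k) f S \<Longrightarrow> Ck_on k f S"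
proof (induction k arbitrary: f)
  case 0
  then show ?case
    by (auto intro!: continuous_at_imp_continuous_on differentiable_imp_continuous_within)
qed auto

lemma Ck_on_subset: "Ck_on k f S \<Longrightarrow> T \<subseteq> S \<Longrightarrow> Ck_on k f T"
proof (induction k arbitrary: f)
  case 0
  then show ?case by (auto intro: continuous_on_subset)
qed auto

lemma Ck_on_local:
  assumes "\<And>x. x \<in> S \<Longrightarrow> \<exists>T. open T \<and> x \<in> T \<and> Ck_on k f T"
  shows "Ck_on k f S"
  using assms
proof (induction k arbitrary: f)
  case 0
  then have "continuous (at x) f" if "x \<in> S" for x
    using that by (metis Ck_on.simps(1) continuous_on_eq_continuous_at)
  then show ?case by (auto intro: continuous_at_imp_continuous_on)
next
  case (Suc k)
  have "Ck_on k (\<lambda>x. frechet_derivative f (at x) v) S" for v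
    by (rule Suc.IH) (use Suc.prems in force)
  moreover have "f differentiable (at x)" if "x \<in> S" for x
    using Suc.prems[OF that] by auto
  ultimately show ?case by simp
qed

lemma Ck_on_const: "Ck_on k (\<lambda>_. c) S"
proof (induction k arbitrary: c)
  case (Suc k)
  have "frechet_derivative (\<lambda>_::'a. c) (at x) = (\<lambda>_. 0)" for x
    by (rule frechet_derivative_const)
  then show ?case using Suc by simp
qed simp

lemma Ck_on_bounded_linear:
  assumes "bounded_linear L" "open S"
  shows "Ck_on k L S"
proof (cases k)
  case 0
  then show ?thesis by (simp add: assms(1) linear_continuous_on)
next
  case (Suc n)
  show ?thesis unfolding Suc
    by (rule Ck_on_SucI[OF assms(2), where f' = "\<lambda>_. L"])
      (auto intro: bounded_linear_imp_has_derivative[OF assms(1)] Ck_on_const)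
qed

lemma Ck_on_add:
  assumes "open S" "Ck_on k f S" "Ck_on k g S"
  shows "Ck_on k (\<lambda>x. f x + g x) S"
  using assms
proof (induction k arbitrary: f g)
  case 0
  then show ?case by (auto intro: continuous_intros)
next
  case (Suc k)
  show ?case
  proof (rule Ck_on_SucI[OF assms(1)])
    show "((\<lambda>x. f x + g x) has_derivative
        (\<lambda>v. frechet_derivative f (at x) v + frechet_derivative g (at x) v)) (at x)" if "x \<in> S" for x
      using Ck_on_has_derivative[OF Suc.prems(2) that] Ck_on_has_derivative[OF Suc.prems(3) that]
      by (rule has_derivative_add)
  qed (use Suc in auto)
qed

lemma Ck_on_sum:
  assumes "open S" "\<And>i. i \<in> I \<Longrightarrow> Ck_on k (f i) S"
  shows "Ck_on k (\<lambda>x. \<Sum>i\<in>I. f i x) S"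
  using assms(2)
  by (induction I rule: infinite_finite_induct) (auto intro: Ck_on_const Ck_on_add assms(1))

lemma Ck_on_bilinear:
  assumes p: "bounded_bilinear p" and "open S" "Ck_on k f S" "Ck_on k g S"
  shows "Ck_on k (\<lambda>x. p (f x) (g x)) S"
  using assms(2-)
proof (induction k arbitrary: f g)
  case 0
  then show ?case using bounded_bilinear.continuous_on[OF p] by auto
next
  case (Suc k)
  show ?case
  proof (rule Ck_on_SucI[OF Suc.prems(1)])
    show "((\<lambda>x. p (f x) (g x)) has_derivative
        (\<lambda>v. p (f x) (frechet_derivative g (at x) v) + p (frechet_derivative f (at x) v) (g x))) (at x)"
      if "x \<in> S" for x
      using bounded_bilinear.FDERIV[OF p Ck_on_has_derivative[OF Suc.prems(2) that]
          Ck_on_has_derivative[OF Suc.prems(3) that]] .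
    show "Ck_on k (\<lambda>x. p (f x) (frechet_derivative g (at x) v) + p (frechet_derivative f (at x) v) (g x)) S" for v
      using Suc.prems(2,3)
      by (intro Ck_on_add Suc.IH Suc.prems(1) Ck_on_Suc_imp[OF Suc.prems(2)] Ck_on_Suc_imp[OF Suc.prems(3)]) auto
  qed
qed

lemma Ck_on_linear_compose:
  assumes L: "bounded_linear L" and "open S" "Ck_on k f S"
  shows "Ck_on k (\<lambda>x. L (f x)) S"
  using assms(2-)
proof (induction k arbitrary: f)
  case 0
  then show ?case using bounded_linear.continuous_on[OF L] by auto
next
  case (Suc k)
  show ?case
  proof (rule Ck_on_SucI[OF Suc.prems(1)])
    show "((\<lambda>x. L (f x)) has_derivative (\<lambda>v. L (frechet_derivative f (at x) v))) (at x)"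
      if "x \<in> S" for x
      using bounded_linear.has_derivative[OF L Ck_on_has_derivative[OF Suc.prems(2) that]] .
  qed (use Suc in auto)
qed

text \<open>In the chain rule the direction \<open>?f' x v\<close> varies with \<open>x\<close>, so
  the induction hypothesis does not apply to \<open>?g' (f x) (?f' x v)\<close> directly. Expanding
  the direction in the finite basis leaves terms \<open>?g' (f x) b\<close> with fixed
  \<open>b\<close>, to which it does.\<close>

lemma Ck_on_compose:
  fixes f :: "'a::real_normed_vector \<Rightarrow> 'b::real_inner"
  assumes B: "orthobasis (B :: 'b set)" and S: "open S" and f: "Ck_on k f S" and fS: "f ` S \<subseteq> T"
    and g: "Ck_on k g T"
  shows "Ck_on k (\<lambda>x. g (f x)) S"
  using f g
proof (induction k arbitrary: g)
  case 0
  then show ?case using fS continuous_on_compose2[of T g S f] by auto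
next
  case (Suc k)
  let ?f' = "\<lambda>x. frechet_derivative f (at x)" and ?g' = "\<lambda>y. frechet_derivative g (at y)"
  show ?case
  proof (rule Ck_on_SucI[OF S, where f' = "\<lambda>x v. \<Sum>b\<in>B. (?f' x v \<bullet> b) *\<^sub>R ?g' (f x) b"])
    fix x assume x: "x \<in> S"
    then have fx: "f x \<in> T" using fS by auto
    have g': "(g has_derivative ?g' (f x)) (at (f x))"
      using Ck_on_has_derivative[OF Suc.prems(2) fx] .
    have lin: "linear (?g' (f x))"
      using has_derivative_linear[OF g'] .
    have "((\<lambda>x. g (f x)) has_derivative (\<lambda>v. ?g' (f x) (?f' x v))) (at x)"
      using has_derivative_compose[OF Ck_on_has_derivative[OF Suc.prems(1) x] g'] .
    then show "((\<lambda>x. g (f x)) has_derivative (\<lambda>v. \<Sum>b\<in>B. (?f' x v \<bullet> b) *\<^sub>R ?g' (f x) b)) (at x)"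
      by (subst linear_orthobasis[OF B lin, symmetric])
  next
    fix v
    have "Ck_on k (\<lambda>x. ?f' x v \<bullet> b) S" for b
      using Suc.prems(1) by (intro Ck_on_linear_compose[OF bounded_linear_inner_left S]) auto
    moreover have "Ck_on k (\<lambda>x. ?g' (f x) b) S" for b
      using Suc.prems by (intro Suc.IH Ck_on_Suc_imp[OF Suc.prems(1)]) auto
    ultimately show "Ck_on k (\<lambda>x. \<Sum>b\<in>B. (?f' x v \<bullet> b) *\<^sub>R ?g' (f x) b) S"
      by (intro Ck_on_sum Ck_on_bilinear[OF bounded_bilinear_scaleR] S)
  qed
qed

section \<open>Closure rules for smooth functions\<close>

lemma smooth_on_cong:
  "open S \<Longrightarrow> (\<And>x. x \<in> S \<Longrightarrow> f x = g x) \<Longrightarrow> smooth_on S f \<Longrightarrow> smooth_on S g"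
  unfolding smooth_on_def using Ck_on_cong by blast

lemma smooth_on_subset: "smooth_on S f \<Longrightarrow> T \<subseteq> S \<Longrightarrow> smooth_on T f"
  unfolding smooth_on_def using Ck_on_subset by blast

lemma smooth_on_local:
  "(\<And>x. x \<in> S \<Longrightarrow> \<exists>T. open T \<and> x \<in> T \<and> smooth_on T f) \<Longrightarrow> smooth_on S f"
  unfolding smooth_on_def by (intro allI Ck_on_local) blast

lemma smooth_on_const: "smooth_on S (\<lambda>_. c)"
  by (simp add: smooth_on_def Ck_on_const)

lemma smooth_on_bounded_linear: "bounded_linear L \<Longrightarrow> open S \<Longrightarrow> smooth_on S L"
  by (simp add: smooth_on_def Ck_on_bounded_linear)

lemma smooth_on_add:
  "open S \<Longrightarrow> smooth_on S f \<Longrightarrow> smooth_on S g \<Longrightarrow> smooth_on S (\<lambda>x. f x + g x)"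
  by (simp add: smooth_on_def Ck_on_add)

lemma smooth_on_sum:
  "open S \<Longrightarrow> (\<And>i. i \<in> I \<Longrightarrow> smooth_on S (f i)) \<Longrightarrow> smooth_on S (\<lambda>x. \<Sum>i\<in>I. f i x)"
  by (simp add: smooth_on_def Ck_on_sum)

lemma smooth_on_bilinear:
  "bounded_bilinear p \<Longrightarrow> open S \<Longrightarrow> smooth_on S f \<Longrightarrow> smooth_on S g \<Longrightarrow> smooth_on S (\<lambda>x. p (f x) (g x))"
  by (simp add: smooth_on_def Ck_on_bilinear)

lemmas smooth_on_scaleR = smooth_on_bilinear[OF bounded_bilinear_scaleR]
  and smooth_on_mult = smooth_on_bilinear[OF bounded_bilinear_mult]

lemma smooth_on_linear_compose:
  "bounded_linear L \<Longrightarrow> open S \<Longrightarrow> smooth_on S f \<Longrightarrow> smooth_on S (\<lambda>x. L (f x))"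
  by (simp add: smooth_on_def Ck_on_linear_compose)

lemma smooth_on_compose:
  fixes f :: "'a::real_normed_vector \<Rightarrow> 'b::real_inner"
  assumes "orthobasis (B :: 'b set)" "open S" "smooth_on S f" "f ` S \<subseteq> T" "smooth_on T g"
  shows "smooth_on S (\<lambda>x. g (f x))"
  using assms unfolding smooth_on_def by (blast intro: Ck_on_compose)

lemma smooth_on_Pair:
  assumes "open S" "smooth_on S f" "smooth_on S g"
  shows "smooth_on S (\<lambda>x. (f x, g x))"
proof -
  have "bounded_linear (\<lambda>a. (a, 0))" "bounded_linear (\<lambda>a. (0, a))"
    by (auto intro!: bounded_linear_Pair bounded_linear_ident bounded_linear_zero)
  then have "smooth_on S (\<lambda>x. (f x, 0) + (0, g x))"
    using assms by (intro smooth_on_add smooth_on_linear_compose[of "\<lambda>a. (a, 0)"]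
        smooth_on_linear_compose[of "\<lambda>a. (0, a)"])
  then show ?thesis by simp
qed

lemma smooth_on_orthobasis:
  assumes "orthobasis B" "open S" "\<And>b. b \<in> B \<Longrightarrow> smooth_on S (\<lambda>x. f x \<bullet> b)"
  shows "smooth_on S f"
proof -
  have "smooth_on S (\<lambda>x. \<Sum>b\<in>B. (f x \<bullet> b) *\<^sub>R b)"
    using assms by (intro smooth_on_sum smooth_on_scaleR smooth_on_const)
  then show ?thesis using orthobasis_expand[OF assms(1)] by simp
qed

lemma smooth_on_vec:
  fixes f :: "'a::real_normed_vector \<Rightarrow> real^'k::finite"
  assumes "open S" "\<And>i. smooth_on S (\<lambda>x. f x $ i)"
  shows "smooth_on S f"
  by (rule smooth_on_orthobasis[OF orthobasis_Basis assms(1)])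
    (auto simp: Basis_vec_def inner_axis assms(2))

lemma smooth_on_imp_continuous_on: "smooth_on S f \<Longrightarrow> continuous_on S f"
  by (metis Ck_on.simps(1) smooth_on_def)

lemma smooth_on_has_derivative:
  "smooth_on S f \<Longrightarrow> x \<in> S \<Longrightarrow> (f has_derivative frechet_derivative f (at x)) (at x)"
  by (meson Ck_on_has_derivative smooth_on_def)

lemma smooth_on_frechet: "smooth_on S f \<Longrightarrow> smooth_on S (\<lambda>x. frechet_derivative f (at x) v)"
  by (metis Ck_on.simps(2) smooth_on_def)

section \<open>Plateau functions\<close>

text \<open>The power of \<open>inverse x\<close> makes the family closed under differentiation up
  to linear combinations, so smoothness follows by induction for all \<open>n\<close> at once.
  \<open>flat 0\<close> is the classical flat function.\<close>

definition flat :: "nat \<Rightarrow> real \<Rightarrow> real" where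
  "flat n x = (if 0 < x then inverse x ^ n * exp (- inverse x) else 0)"

lemma flat_tendsto_0: "(flat n \<longlongrightarrow> 0) (at 0)"
proof -
  have "((\<lambda>x::real. inverse x ^ n / exp (inverse x)) \<longlongrightarrow> 0) (at_right 0)"
    using filterlim_compose[OF tendsto_power_div_exp_0 filterlim_inverse_at_top_right] .
  then have "(flat n \<longlongrightarrow> 0) (at_right 0)"
    by (rule filterlim_cong[THEN iffD1, rotated -1])
      (auto simp: flat_def eventually_at_filter exp_minus field_simps)
  moreover have "(flat n \<longlongrightarrow> 0) (at_left 0)"
    by (rule tendsto_eventually) (auto simp: flat_def eventually_at_filter)
  ultimately show ?thesis by (simp add: filterlim_split_at)
qed

lemma flat_derivative:
  "(flat n has_derivative (\<lambda>v. v * (flat (n + 2) x - n * flat (n + 1) x))) (at x)"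
proof -
  have "(flat n has_field_derivative flat (n + 2) x - n * flat (n + 1) x) (at x)"
  proof (cases "x = 0")
    case True
    \<comment> \<open>The difference quotient of \<open>flat n\<close> at 0 is
      \<open>flat (Suc n)\<close>.\<close>
    have "((\<lambda>h. flat n h / h) \<longlongrightarrow> 0) (at 0)"
    proof (rule filterlim_cong[THEN iffD1, OF refl refl _ flat_tendsto_0[of "Suc n"]])
      show "\<forall>\<^sub>F x in at 0. flat (Suc n) x = flat n x / x"
        by (auto simp: flat_def eventually_at_filter field_simps)
    qed
    then show ?thesis using True by (simp add: has_field_derivative_iff flat_def)
  next
    case False
    show ?thesis
    proof (cases "x > 0")
      case True
      have "((\<lambda>x. inverse x ^ n * exp (- inverse x)) has_field_derivative
          flat (n + 2) x - n * flat (n + 1) x) (at x)"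
        using True
        apply (cases n)
         apply (auto intro!: derivative_eq_intros simp: flat_def field_simps power2_eq_square)
        subgoal for m by (cases m) auto
        done
      then show ?thesis
        by (rule has_field_derivative_transform_within_open[where S = "{0<..}"])
          (use True in \<open>auto simp: flat_def\<close>)
    next
      case neg: False
      have "((\<lambda>_. 0) has_field_derivative flat (n + 2) x - n * flat (n + 1) x) (at x)"
        using neg False by (simp add: flat_def)
      then show ?thesis
        by (rule has_field_derivative_transform_within_open[where S = "{..<0}"])
          (use neg False in \<open>auto simp: flat_def\<close>)
    qed
  qed
  then show ?thesis unfolding has_field_derivative_def by (subst mult.commute)
qed

lemma smooth_on_flat: "smooth_on UNIV (flat n)"
proof -
  have "Ck_on k (flat n) UNIV" for k
  proof (induction k arbitrary: n)
    case 0
    show ?case using flat_derivative[of n]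
      by (auto intro!: continuous_at_imp_continuous_on has_derivative_continuous)
  next
    case (Suc k)
    show ?case
    proof (rule Ck_on_SucI[OF open_UNIV flat_derivative])
      fix v
      have "Ck_on k (\<lambda>x. v * (flat (n + 2) x + (- real n) * flat (n + 1) x)) UNIV"
        by (intro Ck_on_bilinear[OF bounded_bilinear_mult] Ck_on_add Ck_on_const Suc open_UNIV)
      then show "Ck_on k (\<lambda>x. v * (flat (n + 2) x - real n * flat (n + 1) x)) UNIV"
        by simp
    qed
  qed
  then show ?thesis by (simp add: smooth_on_def)
qed

text \<open>If \<open>c = flat 0 (1/2)\<close>, then \<open>x \<mapsto> flat 0 (c - flat 0 x)\<close> equals \<open>flat 0 c\<close> for \<open>x \<le> 0\<close> and
  vanishes for \<open>x \<ge> 1/2\<close>. This gives a plateau without dividing smooth functions.\<close>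

lemma ex_plateau:
  assumes "0 < s" "s < t"
  obtains \<kappa> :: "'a::real_inner \<Rightarrow> real" where "smooth_on UNIV \<kappa>"
    "\<And>z. norm (z - a) \<le> s \<Longrightarrow> \<kappa> z = 1" "\<And>z. norm (z - a) \<ge> t \<Longrightarrow> \<kappa> z = 0"
proof
  define c where "c = flat 0 (1/2)"
  have c: "c > 0" "flat 0 c > 0" by (auto simp: c_def flat_def)
  \<comment> \<open>\<open>u\<close> is 0 on the sphere of radius \<open>s\<close> and 1/2 on the
    sphere of radius \<open>t\<close>; the squared norm keeps it smooth at \<open>a\<close>.\<close>
  define u where "u = (\<lambda>z. ((z - a) \<bullet> (z - a) - s\<^sup>2) / (2 * (t\<^sup>2 - s\<^sup>2)))"
  have st: "s\<^sup>2 < t\<^sup>2" using assms by (simp add: power_strict_mono)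
  define \<kappa> where "\<kappa> = (\<lambda>z. (1 / flat 0 c) * flat 0 (c + (- 1) * flat 0 (u z)))"
  have id: "smooth_on UNIV (\<lambda>z::'a. z + (- a))"
    by (intro smooth_on_add smooth_on_const smooth_on_bounded_linear bounded_linear_ident open_UNIV)
  have "smooth_on UNIV (\<lambda>z. ((z + (- a)) \<bullet> (z + (- a)) + (- s\<^sup>2)) * (1 / (2 * (t\<^sup>2 - s\<^sup>2))))"
    by (intro smooth_on_mult smooth_on_add smooth_on_const smooth_on_bilinear[OF bounded_bilinear_inner]
        id open_UNIV)
  then have u: "smooth_on UNIV u" by (simp add: u_def)
  have fu: "smooth_on UNIV (\<lambda>z. flat 0 (u z))"
    by (rule smooth_on_compose[OF orthobasis_Basis open_UNIV u _ smooth_on_flat]) auto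
  have fl: "smooth_on UNIV (\<lambda>z. c + (- 1) * flat 0 (u z))"
    by (intro smooth_on_add smooth_on_mult smooth_on_const fu open_UNIV)
  have ffu: "smooth_on UNIV (\<lambda>z. flat 0 (c + (- 1) * flat 0 (u z)))"
    by (rule smooth_on_compose[OF orthobasis_Basis open_UNIV fl _ smooth_on_flat]) auto
  show "smooth_on UNIV \<kappa>"
    unfolding \<kappa>_def by (intro smooth_on_mult smooth_on_const ffu open_UNIV)
  show "\<kappa> z = 1" if "norm (z - a) \<le> s" for z
  proof -
    have "(z - a) \<bullet> (z - a) \<le> s\<^sup>2"
      using that assms by (simp add: dot_square_norm power_mono)
    then have "u z \<le> 0" using st by (simp add: u_def divide_nonpos_pos)
    then show ?thesis using c by (simp add: \<kappa>_def flat_def[of 0 "u z"])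
  qed
  show "\<kappa> z = 0" if "norm (z - a) \<ge> t" for z
  proof -
    have "(z - a) \<bullet> (z - a) \<ge> t\<^sup>2"
      using that assms by (simp add: dot_square_norm power_mono)
    then have u: "u z \<ge> 1/2" using st by (simp add: u_def field_simps)
    then have "inverse (u z) \<le> inverse (1/2)" by (intro le_imp_inverse_le) auto
    then have "c \<le> flat 0 (u z)" using u by (simp add: c_def flat_def)
    then show ?thesis by (simp add: \<kappa>_def flat_def[of 0 "c - flat 0 (u z)"])
  qed
qed

section \<open>Hadamard's lemma\<close>

text \<open>The fundamental theorem of calculus along the segment from \<open>x\<close> to
  \<open>y\<close>, with the derivative in direction \<open>y - x\<close> split into components so
  that the factors \<open>(y - x) \<bullet> b\<close> can be pulled out of the integral.\<close>

lemma segment_expansion: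
  fixes f :: "'a::real_inner \<Rightarrow> real"
  assumes B: "orthobasis B" and f: "smooth_on S f" and "x \<in> S" "y \<in> S" "convex S"
  shows "((\<lambda>s. \<Sum>b\<in>B. ((y - x) \<bullet> b) * frechet_derivative f (at (x + s *\<^sub>R (y - x))) b)
    has_integral (f y - f x)) {0..1}"
proof -
  have in_S: "x + s *\<^sub>R (y - x) \<in> S" if "s \<in> {0..1}" for s
    using that convexD_alt[OF assms(5,3,4), of s] by (simp add: algebra_simps)
  have "((\<lambda>s. frechet_derivative f (at (x + s *\<^sub>R (y - x))) (y - x)) has_integral
     (f (x + 1 *\<^sub>R (y - x)) - f (x + 0 *\<^sub>R (y - x)))) {0..1}"
  proof (rule fundamental_theorem_of_calculus)
    fix s :: real assume s: "s \<in> {0..1}"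
    have f': "(f has_derivative frechet_derivative f (at (x + s *\<^sub>R (y - x)))) (at (x + s *\<^sub>R (y - x)))"
      using smooth_on_has_derivative[OF f in_S[OF s]] .
    have "((\<lambda>s. x + s *\<^sub>R (y - x)) has_derivative (\<lambda>h. h *\<^sub>R (y - x))) (at s within {0..1})"
      by (auto intro!: derivative_eq_intros)
    from has_derivative_compose[OF this f']
    show "((\<lambda>s. f (x + s *\<^sub>R (y - x))) has_vector_derivative
        frechet_derivative f (at (x + s *\<^sub>R (y - x))) (y - x)) (at s within {0..1})"
      using linear_scale[OF has_derivative_linear[OF f']] by (simp add: has_vector_derivative_def)
  qed simp
  moreover have "frechet_derivative f (at (x + s *\<^sub>R (y - x))) (y - x) =
     (\<Sum>b\<in>B. ((y - x) \<bullet> b) * frechet_derivative f (at (x + s *\<^sub>R (y - x))) b)" if "s \<in> {0..1}" for s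
    using linear_orthobasis[OF B has_derivative_linear[OF smooth_on_has_derivative[OF f in_S[OF that]]], of "y - x"]
    by simp
  ultimately show ?thesis
    by (subst has_integral_cong[of "{0..1}" _ "\<lambda>s. frechet_derivative f (at (x + s *\<^sub>R (y - x))) (y - x)"]) auto
qed

text \<open>Differentiability of the parametric integral is obtained from continuity alone: the increment
  is \<open>\<Sum>b\<in>B. (h \<bullet> b) * Q b h\<close> with \<open>Q b\<close> a double integral that is continuous in \<open>h\<close>.\<close>

lemma has_derivative_caratheodory:
  fixes G :: "'a::real_inner \<Rightarrow> real"
  assumes B: "finite B" and S: "open S" "z \<in> S"
    and eq: "\<And>y. y \<in> S \<Longrightarrow> G y - G z = (\<Sum>b\<in>B. ((y - z) \<bullet> b) * Q b y)"
    and cont: "\<And>b. b \<in> B \<Longrightarrow> isCont (Q b) z"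
  shows "(G has_derivative (\<lambda>v. \<Sum>b\<in>B. (v \<bullet> b) * Q b z)) (at z)"
proof -
  have bl: "bounded_linear (\<lambda>v. \<Sum>b\<in>B. (v \<bullet> b) * Q b z)"
    by (intro bounded_linear_sum bounded_linear_mult_const bounded_linear_inner_left)
  have lim: "((\<lambda>y. \<Sum>b\<in>B. norm b * \<bar>Q b y - Q b z\<bar>) \<longlongrightarrow> 0) (at z)"
  proof -
    have "((\<lambda>y. \<Sum>b\<in>B. norm b * \<bar>Q b y - Q b z\<bar>) \<longlongrightarrow> (\<Sum>b\<in>B. norm b * \<bar>Q b z - Q b z\<bar>)) (at z)"
      using cont by (intro tendsto_intros) (auto simp: isCont_def)
    then show ?thesis by simp
  qed
  have "((\<lambda>y. (G y - G z - (\<Sum>b\<in>B. ((y - z) \<bullet> b) * Q b z)) /\<^sub>R norm (y - z)) \<longlongrightarrow> 0) (at z)"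
  proof (rule Lim_null_comparison[OF _ lim])
    have "eventually (\<lambda>y. y \<in> S) (at z)"
      using S by (auto intro: eventually_at_in_open')
    then show "\<forall>\<^sub>F y in at z. norm ((G y - G z - (\<Sum>b\<in>B. ((y - z) \<bullet> b) * Q b z)) /\<^sub>R norm (y - z))
        \<le> (\<Sum>b\<in>B. norm b * \<bar>Q b y - Q b z\<bar>)"
      unfolding eventually_at_filter
    proof eventually_elim
      case (elim y)
      show ?case
      proof (intro impI)
        assume "y \<noteq> z"
        with elim have y: "y \<in> S" "norm (y - z) > 0" by auto
        have "\<bar>G y - G z - (\<Sum>b\<in>B. ((y - z) \<bullet> b) * Q b z)\<bar> = \<bar>\<Sum>b\<in>B. ((y - z) \<bullet> b) * (Q b y - Q b z)\<bar>"
          using eq[OF y(1)] by (simp add: right_diff_distrib sum_subtractf)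
        also have "\<dots> \<le> (\<Sum>b\<in>B. \<bar>((y - z) \<bullet> b)\<bar> * \<bar>Q b y - Q b z\<bar>)"
          by (rule order_trans[OF sum_abs]) (simp add: abs_mult)
        also have "\<dots> \<le> (\<Sum>b\<in>B. (norm (y - z) * norm b) * \<bar>Q b y - Q b z\<bar>)"
          by (intro sum_mono mult_right_mono Cauchy_Schwarz_ineq2) auto
        also have "\<dots> = norm (y - z) * (\<Sum>b\<in>B. norm b * \<bar>Q b y - Q b z\<bar>)"
          by (simp add: sum_distrib_left mult.assoc)
        finally show "norm ((G y - G z - (\<Sum>b\<in>B. ((y - z) \<bullet> b) * Q b z)) /\<^sub>R norm (y - z))
            \<le> (\<Sum>b\<in>B. norm b * \<bar>Q b y - Q b z\<bar>)"
          using y(2) by (simp add: field_simps)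
      qed
    qed
  qed
  then show ?thesis using bl by (simp add: has_derivative_at_within inverse_eq_divide)
qed

text \<open>The power \<open>t ^ m\<close> is there for the induction: differentiating under the
  integral in direction \<open>b\<close> replaces \<open>g\<close> by a partial derivative and
  \<open>m\<close> by \<open>Suc m\<close>.\<close>

lemma Ck_on_radial_integral:
  fixes g :: "'a::real_inner \<Rightarrow> real"
  assumes B: "orthobasis (B::'a set)" and S: "open S" "convex S" "p \<in> S" and g: "smooth_on S g"
  shows "Ck_on k (\<lambda>z. integral {0..1} (\<lambda>t. t ^ m * g (p + t *\<^sub>R (z - p)))) S"
  using g
proof (induction k arbitrary: g m)
  have in_S: "p + t *\<^sub>R (z - p) \<in> S" if "t \<in> {0..1}" "z \<in> S" for t z
    using that convexD_alt[OF S(2,3) that(2), of t] by (simp add: algebra_simps)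
  {
    case 0
    have "continuous_on (S \<times> cbox 0 1) (\<lambda>(z, t::real). t ^ m * g (p + t *\<^sub>R (z - p)))"
      unfolding split_beta
      by (intro continuous_intros continuous_on_compose2[OF smooth_on_imp_continuous_on[OF 0]])
        (auto intro!: in_S)
    from integral_continuous_on_param[OF this] show ?case by simp
  next
    case (Suc k)
    let ?d = "\<lambda>b y. frechet_derivative g (at y) b"
    have dg: "smooth_on S (?d b)" for b using smooth_on_frechet[OF Suc.prems] .
    let ?K = "\<lambda>m g z. integral {0..1} (\<lambda>t. t ^ m * g (p + t *\<^sub>R (z - p)))"
    have "((?K m g) has_derivative (\<lambda>v. \<Sum>b\<in>B. (v \<bullet> b) * ?K (Suc m) (?d b) z)) (at z)"
      if z: "z \<in> S" for z
    proof -
      \<comment> \<open>\<open>w y t\<close> runs along the segment between the points with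
        parameter \<open>t\<close> on the rays from \<open>p\<close> to \<open>z\<close> and to
        \<open>y\<close>. The factor \<open>t\<close> in its direction is the origin of the extra
        power in \<open>q\<close>; for \<open>y = z\<close> the inner integrand is constant.\<close>
      define w where "w = (\<lambda>y t s. p + t *\<^sub>R (z - p) + s *\<^sub>R (t *\<^sub>R (y - z)))"
      define q where "q = (\<lambda>b y t. integral (cbox 0 1) (\<lambda>s. t ^ Suc m * ?d b (w y t s)))"
      define Q where "Q = (\<lambda>b y. integral (cbox 0 1) (q b y))"
      have wS: "w y t s \<in> S" if "y \<in> S" "t \<in> {0..1}" "s \<in> {0..1}" for y t s
      proof -
        have "w y t s = (p + t *\<^sub>R (z - p)) + s *\<^sub>R ((p + t *\<^sub>R (y - p)) - (p + t *\<^sub>R (z - p)))"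
          by (simp add: w_def algebra_simps)
        also have "\<dots> = (1 - s) *\<^sub>R (p + t *\<^sub>R (z - p)) + s *\<^sub>R (p + t *\<^sub>R (y - p))"
          by (simp add: algebra_simps)
        finally show ?thesis
          using convexD_alt[OF S(2) in_S[OF that(2) z] in_S[OF that(2,1)], of s] that by simp
      qed
      have cq: "continuous_on (S \<times> cbox 0 1) (\<lambda>(y, t). q b y t)" for b
      proof -
        have cw: "continuous_on A (\<lambda>x. w (fst (fst x)) (snd (fst x)) (snd x))" for A
          unfolding w_def by (intro continuous_intros)
        have "continuous_on ((S \<times> cbox 0 1) \<times> cbox 0 1) (\<lambda>(yt, s::real). snd yt ^ Suc m * ?d b (w (fst yt) (snd yt) s))"
          unfolding split_beta
          by (intro continuous_intros continuous_on_compose2[OF smooth_on_imp_continuous_on[OF dg[of b]]] cw)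
            (auto intro!: wS)
        from integral_continuous_on_param[OF this] show ?thesis
          by (simp add: q_def split_beta)
      qed
      have cQ: "continuous_on S (Q b)" for b
        using integral_continuous_on_param[OF cq[of b]] by (simp add: Q_def)
      have Qz: "Q b z = ?K (Suc m) (?d b) z" for b
        by (simp add: Q_def q_def w_def)
      have "((?K m g) has_derivative (\<lambda>v. \<Sum>b\<in>B. (v \<bullet> b) * Q b z)) (at z)"
      proof (rule has_derivative_caratheodory[OF orthobasis_finite[OF B] S(1) z])
        show "isCont (Q b) z" for b
          using cQ S(1) z by (simp add: continuous_on_eq_continuous_at)
        fix y assume y: "y \<in> S"
        have int: "(\<lambda>t. t ^ m * g (p + t *\<^sub>R (x - p))) integrable_on {0..1}" if "x \<in> S" for x
          by (rule integrable_continuous_real)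
            (intro continuous_intros continuous_on_compose2[OF smooth_on_imp_continuous_on[OF Suc.prems]],
              auto intro!: in_S that)
        have intq: "q b y integrable_on {0..1}" for b
        proof -
          have "continuous_on {0..1} (\<lambda>t. (\<lambda>(y, t). q b y t) (y, t))"
            by (rule continuous_on_compose2[OF cq[of b]]) (auto intro!: continuous_intros y)
          then show ?thesis by (intro integrable_continuous_real) simp
        qed
        have point: "t ^ m * g (p + t *\<^sub>R (y - p)) - t ^ m * g (p + t *\<^sub>R (z - p)) =
            (\<Sum>b\<in>B. ((y - z) \<bullet> b) * q b y t)" if t: "t \<in> {0..1}" for t
        proof -
          let ?x = "p + t *\<^sub>R (z - p)" and ?y = "p + t *\<^sub>R (y - p)"
          have diff: "?y - ?x = t *\<^sub>R (y - z)" by (simp add: algebra_simps)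
          have "((\<lambda>s. \<Sum>b\<in>B. ((t *\<^sub>R (y - z)) \<bullet> b) * ?d b (w y t s)) has_integral (g ?y - g ?x)) {0..1}"
            using segment_expansion[OF B Suc.prems in_S[OF t z] in_S[OF t y] S(2)]
            by (simp only: diff w_def)
          moreover have "((\<lambda>s. \<Sum>b\<in>B. ((t *\<^sub>R (y - z)) \<bullet> b) * ?d b (w y t s)) has_integral
              (\<Sum>b\<in>B. ((t *\<^sub>R (y - z)) \<bullet> b) * integral {0..1} (\<lambda>s. ?d b (w y t s)))) {0..1}"
          proof (intro has_integral_sum orthobasis_finite[OF B] has_integral_mult_right integrable_integral)
            fix b
            have "continuous_on {0..1} (w y t)"
              unfolding w_def by (intro continuous_intros)
            then show "(\<lambda>s. ?d b (w y t s)) integrable_on {0..1}"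
              by (intro integrable_continuous_real
                  continuous_on_compose2[OF smooth_on_imp_continuous_on[OF dg[of b]]])
                (use t in \<open>auto intro!: wS y\<close>)
          qed
          ultimately have "g ?y - g ?x = (\<Sum>b\<in>B. ((t *\<^sub>R (y - z)) \<bullet> b) * integral {0..1} (\<lambda>s. ?d b (w y t s)))"
            by (rule has_integral_unique)
          then have "t ^ m * g ?y - t ^ m * g ?x =
             (\<Sum>b\<in>B. ((y - z) \<bullet> b) * (t ^ Suc m * integral {0..1} (\<lambda>s. ?d b (w y t s))))"
            by (simp add: right_diff_distrib[symmetric] sum_distrib_left mult_ac)
          then show ?thesis by (simp add: q_def)
        qed
        have "?K m g y - ?K m g z =
            integral {0..1} (\<lambda>t. t ^ m * g (p + t *\<^sub>R (y - p)) - t ^ m * g (p + t *\<^sub>R (z - p)))"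
          by (intro integral_diff[symmetric] int y z)
        also have "\<dots> = integral {0..1} (\<lambda>t. \<Sum>b\<in>B. ((y - z) \<bullet> b) * q b y t)"
          by (rule integral_cong) (rule point)
        also have "\<dots> = (\<Sum>b\<in>B. ((y - z) \<bullet> b) * Q b y)"
          using intq by (subst integral_sum) (auto simp: orthobasis_finite[OF B] Q_def intro!: integrable_on_mult_right)
        finally show "?K m g y - ?K m g z = (\<Sum>b\<in>B. ((y - z) \<bullet> b) * Q b y)" .
      qed
      then show ?thesis by (simp only: Qz)
    qed
    moreover have "Ck_on k (\<lambda>z. \<Sum>b\<in>B. (v \<bullet> b) * ?K (Suc m) (?d b) z) S" for v
      by (intro Ck_on_sum Ck_on_bilinear[OF bounded_bilinear_mult] Ck_on_const S(1) Suc.IH dg)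
    ultimately show ?case by (rule Ck_on_SucI[OF S(1)])
  }
qed

text \<open>The coefficient \<open>G b z\<close> is the mean of the partial derivative over the
  segment from \<open>p\<close> to \<open>z\<close>, the case \<open>m = 0\<close> of the radial
  integral. Its value at \<open>p\<close> is recorded because only that value survives under a
  derivation at \<open>p\<close>.\<close>

lemma hadamard:
  fixes f :: "'a::real_inner \<Rightarrow> real"
  assumes B: "orthobasis B" and S: "open S" "convex S" "p \<in> S" and f: "smooth_on S f"
  obtains G where "\<And>b. smooth_on S (G b)"
    "\<And>z. z \<in> S \<Longrightarrow> f z = f p + (\<Sum>b\<in>B. ((z - p) \<bullet> b) * G b z)"
    "\<And>b. G b p = frechet_derivative f (at p) b"
proof
  define G where "G = (\<lambda>b z. integral {0..1} (\<lambda>t. frechet_derivative f (at (p + t *\<^sub>R (z - p))) b))"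
  show "smooth_on S (G b)" for b
    using Ck_on_radial_integral[OF B S smooth_on_frechet[OF f], where m = 0]
    by (simp add: smooth_on_def G_def)
  show "G b p = frechet_derivative f (at p) b" for b by (simp add: G_def)
  fix z assume z: "z \<in> S"
  have in_S: "p + t *\<^sub>R (z - p) \<in> S" if "t \<in> {0..1}" for t
    using that convexD_alt[OF S(2,3) z, of t] by (simp add: algebra_simps)
  have "((\<lambda>s. \<Sum>b\<in>B. ((z - p) \<bullet> b) * frechet_derivative f (at (p + s *\<^sub>R (z - p))) b) has_integral
      (\<Sum>b\<in>B. ((z - p) \<bullet> b) * G b z)) {0..1}"
    unfolding G_def
  proof (intro has_integral_sum orthobasis_finite[OF B] has_integral_mult_right integrable_integral)
    fix b
    show "(\<lambda>s. frechet_derivative f (at (p + s *\<^sub>R (z - p))) b) integrable_on {0..1}"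
      by (rule integrable_continuous_real,
          rule continuous_on_compose2[OF smooth_on_imp_continuous_on[OF smooth_on_frechet[OF f, of b]]])
        (auto intro!: continuous_intros in_S)
  qed
  from has_integral_unique[OF segment_expansion[OF B f S(3) z S(2)] this]
  show "f z = f p + (\<Sum>b\<in>B. ((z - p) \<bullet> b) * G b z)" by simp
qed

section \<open>Functions on atlases\<close>

text \<open>What the topology and the algebra \<open>Cinf\<close> require of an atlas; this is the
  property established for the dual bundle. Cutoffs and changes of chart are carried out on a
  \<open>smooth_manifold\<close>.\<close>

definition atlas_ok :: "('a, 'v::topological_space) atlas \<Rightarrow> bool" where
  "atlas_ok A \<longleftrightarrow> (\<forall>(U, \<phi>)\<in>A. inj_on \<phi> U) \<and> (\<forall>(U, \<phi>)\<in>A. \<forall>(V, \<theta>)\<in>A. open (\<phi> ` (U \<inter> V)))"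

definition aopen :: "('a, 'v::topological_space) atlas \<Rightarrow> 'a set \<Rightarrow> bool" where
  "aopen A W \<longleftrightarrow> W \<subseteq> points A \<and> (\<forall>(U, \<phi>)\<in>A. open (\<phi> ` (U \<inter> W)))"

text \<open>All charts are tested, not one around each point, so the closure rules below involve no
  transition maps. These enter in \<open>smooth_mapI\<close>.\<close>

definition csmooth ::
  "('a, 'v::real_inner) atlas \<Rightarrow> 'a set \<Rightarrow> ('a \<Rightarrow> 'b::real_normed_vector) \<Rightarrow> bool" where
  "csmooth A W f \<longleftrightarrow> (\<forall>(U, \<phi>)\<in>A. smooth_on (\<phi> ` (U \<inter> W)) (\<lambda>z. f (inv_into U \<phi> z)))"

lemma chart_subset_points: "(U, \<phi>) \<in> A \<Longrightarrow> U \<subseteq> points A"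
  by (auto simp: points_def)

lemma pointsE:
  assumes "x \<in> points A"
  obtains U \<phi> where "(U, \<phi>) \<in> A" "x \<in> U"
  using assms by (auto simp: points_def)

lemma aopen_subset: "aopen A W \<Longrightarrow> W \<subseteq> points A"
  by (simp add: aopen_def)

lemma aopen_image: "aopen A W \<Longrightarrow> (U, \<phi>) \<in> A \<Longrightarrow> open (\<phi> ` (U \<inter> W))"
  by (auto simp: aopen_def)

lemma atlas_ok_inj: "atlas_ok A \<Longrightarrow> (U, \<phi>) \<in> A \<Longrightarrow> inj_on \<phi> U"
  by (auto simp: atlas_ok_def)

lemma aopen_chart: "atlas_ok A \<Longrightarrow> (U, \<phi>) \<in> A \<Longrightarrow> aopen A U"
  by (fastforce simp: atlas_ok_def aopen_def points_def)

lemma aopen_points: "atlas_ok A \<Longrightarrow> aopen A (points A)"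
  unfolding aopen_def
proof safe
  fix U \<phi> assume ok: "atlas_ok A" and U: "(U, \<phi>) \<in> A"
  then have "U \<inter> points A = U \<inter> U" by (auto simp: points_def)
  then show "open (\<phi> ` (U \<inter> points A))" using aopen_image[OF aopen_chart[OF ok U] U] by simp
qed

lemma aopen_Int:
  assumes "atlas_ok A" "aopen A W" "aopen A T"
  shows "aopen A (W \<inter> T)"
  unfolding aopen_def
proof safe
  fix U \<phi> assume U: "(U, \<phi>) \<in> A"
  have "\<phi> ` (U \<inter> (W \<inter> T)) = \<phi> ` (U \<inter> W) \<inter> \<phi> ` (U \<inter> T)"
    using atlas_ok_inj[OF assms(1) U] by (auto simp: inj_on_def)
  then show "open (\<phi> ` (U \<inter> (W \<inter> T)))"
    using aopen_image[OF assms(2) U] aopen_image[OF assms(3) U] by auto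
qed (use assms(2) in \<open>auto simp: aopen_def\<close>)

lemma istopology_aopen:
  assumes "atlas_ok A"
  shows "istopology (aopen A)"
  unfolding istopology_def
proof (intro conjI allI impI)
  fix K assume K: "\<forall>W\<in>K. aopen A W"
  show "aopen A (\<Union>K)" unfolding aopen_def
  proof safe
    fix U \<phi> assume U: "(U, \<phi>) \<in> A"
    have "\<phi> ` (U \<inter> \<Union>K) = (\<Union>W\<in>K. \<phi> ` (U \<inter> W))" by auto
    then show "open (\<phi> ` (U \<inter> \<Union>K))"
      using K aopen_image[OF _ U] by (auto intro!: open_UN)
  qed (use K in \<open>auto simp: aopen_def\<close>)
qed (use assms aopen_Int in auto)

lemma openin_atlas_topology:
  assumes "atlas_ok A"
  shows "openin (atlas_topology A) W \<longleftrightarrow> aopen A W"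
proof -
  have "atlas_topology A = topology (aopen A)"
    by (simp add: atlas_topology_def aopen_def[abs_def])
  then show ?thesis using istopology_aopen[OF assms] by (simp add: topology_inverse')
qed

lemma topspace_atlas_topology:
  assumes "atlas_ok A"
  shows "topspace (atlas_topology A) = points A"
  using openin_atlas_topology[OF assms] aopen_points[OF assms]
  by (metis (mono_tags, lifting) aopen_subset openin_subset openin_topspace subset_antisym)

lemma inv_into_chart:
  assumes "atlas_ok A" "(U, \<phi>) \<in> A" "z \<in> \<phi> ` (U \<inter> W)"
  shows "inv_into U \<phi> z \<in> U \<inter> W" "\<phi> (inv_into U \<phi> z) = z"
  using assms atlas_ok_inj[OF assms(1,2)] by (auto simp: inv_into_f_f)

lemma csmooth_subset: "csmooth A W f \<Longrightarrow> T \<subseteq> W \<Longrightarrow> csmooth A T f"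
  unfolding csmooth_def by (fastforce intro: smooth_on_subset)

lemma csmoothI:
  "(\<And>U \<phi>. (U, \<phi>) \<in> A \<Longrightarrow> smooth_on (\<phi> ` (U \<inter> W)) (\<lambda>z. f (inv_into U \<phi> z))) \<Longrightarrow> csmooth A W f"
  by (auto simp: csmooth_def)

lemma csmoothD:
  "csmooth A W f \<Longrightarrow> (U, \<phi>) \<in> A \<Longrightarrow> smooth_on (\<phi> ` (U \<inter> W)) (\<lambda>z. f (inv_into U \<phi> z))"
  by (auto simp: csmooth_def)

context
  fixes A :: "('a, 'v::real_inner) atlas"
  assumes ok: "atlas_ok A"
begin

lemma csmooth_cong:
  assumes W: "aopen A W" and eq: "\<And>x. x \<in> W \<Longrightarrow> f x = g x" and f: "csmooth A W f"
  shows "csmooth A W g"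
proof (rule csmoothI)
  fix U \<phi> assume U: "(U, \<phi>) \<in> A"
  show "smooth_on (\<phi> ` (U \<inter> W)) (\<lambda>z. g (inv_into U \<phi> z))"
    by (rule smooth_on_cong[OF aopen_image[OF W U] _ csmoothD[OF f U]])
      (metis IntD2 eq inv_into_chart(1)[OF ok U])
qed

lemma csmooth_local:
  assumes "\<And>x. x \<in> W \<Longrightarrow> \<exists>T. aopen A T \<and> x \<in> T \<and> csmooth A T f"
  shows "csmooth A W f"
proof (rule csmoothI)
  fix U \<phi> assume U: "(U, \<phi>) \<in> A"
  show "smooth_on (\<phi> ` (U \<inter> W)) (\<lambda>z. f (inv_into U \<phi> z))"
  proof (rule smooth_on_local)
    fix z assume "z \<in> \<phi> ` (U \<inter> W)"
    then obtain x where x: "x \<in> U" "x \<in> W" "z = \<phi> x" by auto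
    with assms obtain T where T: "aopen A T" "x \<in> T" "csmooth A T f" by blast
    show "\<exists>T. open T \<and> z \<in> T \<and> smooth_on T (\<lambda>z. f (inv_into U \<phi> z))"
      using aopen_image[OF T(1) U] csmoothD[OF T(3) U] T(2) x by (intro exI[of _ "\<phi> ` (U \<inter> T)"]) auto
  qed
qed

lemma csmooth_const: "csmooth A W (\<lambda>_. c)"
  by (simp add: csmooth_def smooth_on_const split_beta)

lemma csmooth_add:
  assumes W: "aopen A W" and "csmooth A W f" "csmooth A W g"
  shows "csmooth A W (\<lambda>x. f x + g x)"
  by (intro csmoothI smooth_on_add) (use assms aopen_image csmoothD in auto)

lemma csmooth_bilinear:
  assumes p: "bounded_bilinear p" and W: "aopen A W" and "csmooth A W f" "csmooth A W g"
  shows "csmooth A W (\<lambda>x. p (f x) (g x))"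
  by (intro csmoothI smooth_on_bilinear[OF p]) (use assms aopen_image csmoothD in auto)

lemmas csmooth_mult = csmooth_bilinear[OF bounded_bilinear_mult]
  and csmooth_scaleR = csmooth_bilinear[OF bounded_bilinear_scaleR]

lemma csmooth_sum:
  assumes W: "aopen A W" and "\<And>i. i \<in> I \<Longrightarrow> csmooth A W (f i)"
  shows "csmooth A W (\<lambda>x. \<Sum>i\<in>I. f i x)"
  by (intro csmoothI smooth_on_sum aopen_image[OF W] csmoothD[OF assms(2)])

lemma csmooth_linear:
  assumes L: "bounded_linear L" and W: "aopen A W" and f: "csmooth A W f"
  shows "csmooth A W (\<lambda>x. L (f x))"
  by (intro csmoothI smooth_on_linear_compose[OF L]) (use assms aopen_image csmoothD in auto)

lemma csmooth_compose:
  fixes f :: "'a \<Rightarrow> 'b::real_inner"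
  assumes B: "orthobasis (B :: 'b set)" and W: "aopen A W" and f: "csmooth A W f"
    and fW: "f ` W \<subseteq> T" and g: "smooth_on T g"
  shows "csmooth A W (\<lambda>x. g (f x))"
proof (rule csmoothI)
  fix U \<phi> assume U: "(U, \<phi>) \<in> A"
  show "smooth_on (\<phi> ` (U \<inter> W)) (\<lambda>z. g (f (inv_into U \<phi> z)))"
  proof (rule smooth_on_compose[OF B aopen_image[OF W U] csmoothD[OF f U] _ g])
    show "(\<lambda>z. f (inv_into U \<phi> z)) ` \<phi> ` (U \<inter> W) \<subseteq> T"
      using inv_into_chart(1)[OF ok U] fW by blast
  qed
qed

lemma csmooth_Pair:
  assumes W: "aopen A W" and "csmooth A W f" "csmooth A W g"
  shows "csmooth A W (\<lambda>x. (f x, g x))"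
  by (intro csmoothI smooth_on_Pair) (use assms aopen_image csmoothD in auto)

lemma csmooth_vec:
  fixes f :: "'a \<Rightarrow> real^'k::finite"
  assumes W: "aopen A W" and "\<And>i. csmooth A W (\<lambda>x. f x $ i)"
  shows "csmooth A W f"
  by (intro csmoothI smooth_on_vec aopen_image[OF W] csmoothD[OF assms(2)])

lemma Cinf_iff: "f \<in> Cinf A \<longleftrightarrow> (\<forall>x. x \<notin> points A \<longrightarrow> f x = 0) \<and> csmooth A (points A) f"
proof -
  have "U \<inter> points A = U" if "(U, \<phi>) \<in> A" for U \<phi>
    using chart_subset_points[OF that] by auto
  then show ?thesis unfolding Cinf_def csmooth_def comp_def by fastforce
qed

lemma Cinf_imp_csmooth: "f \<in> Cinf A \<Longrightarrow> W \<subseteq> points A \<Longrightarrow> csmooth A W f"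
  using Cinf_iff csmooth_subset by blast

lemma Cinf_outside: "f \<in> Cinf A \<Longrightarrow> x \<notin> points A \<Longrightarrow> f x = 0"
  by (simp add: Cinf_iff)

lemma Cinf_add: "f \<in> Cinf A \<Longrightarrow> g \<in> Cinf A \<Longrightarrow> (\<lambda>x. f x + g x) \<in> Cinf A"
  by (simp add: Cinf_iff csmooth_add aopen_points ok)

lemma Cinf_mult: "f \<in> Cinf A \<Longrightarrow> g \<in> Cinf A \<Longrightarrow> (\<lambda>x. f x * g x) \<in> Cinf A"
  by (simp add: Cinf_iff csmooth_mult aopen_points ok)

lemma Cinf_scale: "f \<in> Cinf A \<Longrightarrow> (\<lambda>x. c * f x) \<in> Cinf A"
  by (simp add: Cinf_iff csmooth_mult csmooth_const aopen_points ok)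

lemma Cinf_diff: "f \<in> Cinf A \<Longrightarrow> g \<in> Cinf A \<Longrightarrow> (\<lambda>x. f x - g x) \<in> Cinf A"
  using Cinf_add[OF _ Cinf_scale[of g "-1"], of f] by simp

lemma Cinf_zero: "(\<lambda>_. 0) \<in> Cinf A"
  by (simp add: Cinf_iff csmooth_const)

lemma Cinf_const: "(\<lambda>x. if x \<in> points A then c else 0) \<in> Cinf A"
proof -
  have "csmooth A (points A) (\<lambda>x. if x \<in> points A then c else 0)"
    by (rule csmooth_cong[OF aopen_points[OF ok] _ csmooth_const[of _ c]]) auto
  then show ?thesis by (simp add: Cinf_iff)
qed

lemma Cinf_sum: "(\<And>i. i \<in> I \<Longrightarrow> f i \<in> Cinf A) \<Longrightarrow> (\<lambda>x. \<Sum>i\<in>I. f i x) \<in> Cinf A"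
  by (simp add: Cinf_iff csmooth_sum aopen_points ok)

lemma Cinf_localI:
  assumes "\<And>x. x \<notin> points A \<Longrightarrow> f x = 0"
    and "\<And>x. x \<in> points A \<Longrightarrow> \<exists>W g. aopen A W \<and> x \<in> W \<and> csmooth A W g \<and> (\<forall>y\<in>W. f y = g y)"
  shows "f \<in> Cinf A"
proof -
  have "csmooth A (points A) f"
  proof (rule csmooth_local)
    fix x assume "x \<in> points A"
    then obtain W g where "aopen A W" "x \<in> W" "csmooth A W g" "\<forall>y\<in>W. f y = g y"
      using assms(2) by blast
    then show "\<exists>T. aopen A T \<and> x \<in> T \<and> csmooth A T f"
      using csmooth_cong[of W g f] by auto
  qed
  then show ?thesis using assms(1) by (simp add: Cinf_iff)
qed

end

section \<open>Cutoff functions on manifolds\<close>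

text \<open>Vectors with coefficients bounded by \<open>R\<close> form a finite Minkowski sum of
  compact segments, hence a compact set. By Cauchy-Schwarz the ball is a closed subset of such a
  set.\<close>

lemma orthobasis_compact_cball:
  assumes B: "orthobasis (B :: 'v::real_inner set)"
  shows "compact (cball (a::'v) r)"
proof -
  have "compact {\<Sum>b\<in>C. c b *\<^sub>R b | c. \<forall>b\<in>C. \<bar>c b\<bar> \<le> R}" if "finite C" for C :: "'v set" and R
    using that
  proof (induction C rule: finite_induct)
    case (insert d C)
    have "compact ((\<lambda>t. t *\<^sub>R d) ` {-R..R})"
      by (intro compact_continuous_image continuous_intros) auto
    then have "compact {x + y | x y. x \<in> (\<lambda>t. t *\<^sub>R d) ` {-R..R} \<and>
        y \<in> {\<Sum>b\<in>C. c b *\<^sub>R b | c. \<forall>b\<in>C. \<bar>c b\<bar> \<le> R}}"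
      using insert.IH by (rule compact_sums)
    also have "\<dots> = {\<Sum>b\<in>insert d C. c b *\<^sub>R b | c. \<forall>b\<in>insert d C. \<bar>c b\<bar> \<le> R}" (is "?L = ?R")
    proof
      show "?R \<subseteq> ?L"
      proof
        fix x assume "x \<in> ?R"
        then obtain c where c: "x = (\<Sum>b\<in>insert d C. c b *\<^sub>R b)" "\<forall>b\<in>insert d C. \<bar>c b\<bar> \<le> R" by auto
        then have "x = c d *\<^sub>R d + (\<Sum>b\<in>C. c b *\<^sub>R b)" "c d \<in> {-R..R}"
          using insert.hyps by auto
        then show "x \<in> ?L" using c(2) by blast
      qed
      show "?L \<subseteq> ?R"
      proof
        fix x assume "x \<in> ?L"
        then obtain t c where t: "x = t *\<^sub>R d + (\<Sum>b\<in>C. c b *\<^sub>R b)" "t \<in> {-R..R}" "\<forall>b\<in>C. \<bar>c b\<bar> \<le> R"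
          by auto
        have "(\<Sum>b\<in>C. (c(d := t)) b *\<^sub>R b) = (\<Sum>b\<in>C. c b *\<^sub>R b)"
          using insert.hyps by (intro sum.cong) auto
        then have "x = (\<Sum>b\<in>insert d C. (c(d := t)) b *\<^sub>R b)" using t insert.hyps by simp
        moreover have "\<forall>b\<in>insert d C. \<bar>(c(d := t)) b\<bar> \<le> R" using t by auto
        ultimately show "x \<in> ?R" by blast
      qed
    qed
    finally show ?case .
  qed simp
  then have K: "compact {\<Sum>b\<in>B. c b *\<^sub>R b | c. \<forall>b\<in>B. \<bar>c b\<bar> \<le> norm a + r}" (is "compact ?K")
    using B by (simp add: orthobasis_finite)
  have "cball a r \<subseteq> {\<Sum>b\<in>B. c b *\<^sub>R b | c. \<forall>b\<in>B. \<bar>c b\<bar> \<le> norm a + r}"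
  proof
    fix x assume x: "x \<in> cball a r"
    have "\<bar>x \<bullet> b\<bar> \<le> norm a + r" if "b \<in> B" for b
    proof -
      have "norm b = 1" using B that by (auto simp: orthobasis_def norm_eq_1)
      moreover have "norm x \<le> norm a + r"
        using x norm_triangle_sub[of x a] by (simp add: dist_norm norm_minus_commute)
      ultimately show ?thesis using Cauchy_Schwarz_ineq2[of x b] by simp
    qed
    then show "x \<in> {\<Sum>b\<in>B. c b *\<^sub>R b | c. \<forall>b\<in>B. \<bar>c b\<bar> \<le> norm a + r}"
      by (intro CollectI exI[of _ "\<lambda>b. x \<bullet> b"]) (simp add: orthobasis_expand[OF B])
  qed
  then have "?K \<inter> cball a r = cball a r" by (rule inf.absorb2)
  then show ?thesis
    using compact_Int_closed[OF K closed_cball, of a r] by simp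
qed

lemma smooth_manifold_ok: "smooth_manifold M \<Longrightarrow> atlas_ok M"
  by (fastforce simp: smooth_manifold_def atlas_ok_def)

lemma smooth_manifold_orthobasis:
  "smooth_manifold (M :: ('m, 'v::real_inner) atlas) \<Longrightarrow> \<exists>B::'v set. orthobasis B"
  using ex_orthobasis by (auto simp: smooth_manifold_def)

lemma smooth_manifold_transition:
  "smooth_manifold M \<Longrightarrow> (U, \<phi>) \<in> M \<Longrightarrow> (V, \<theta>) \<in> M \<Longrightarrow>
    smooth_on (\<phi> ` (U \<inter> V)) (\<lambda>z. \<theta> (inv_into U \<phi> z))"
  by (fastforce simp: smooth_manifold_def comp_def)

context
  fixes M :: "('m, 'v::real_inner) atlas" and V \<phi>
  assumes M: "smooth_manifold M" and V: "(V, \<phi>) \<in> M"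
begin

lemmas okM = smooth_manifold_ok[OF M]

lemma csmooth_chart_map: "csmooth M V \<phi>"
  using smooth_manifold_transition[OF M _ V] by (intro csmoothI)

lemma csmooth_chart_compose:
  assumes "aopen M W" "W \<subseteq> V" "\<phi> ` W \<subseteq> T" "smooth_on T g"
  shows "csmooth M W (\<lambda>x. g (\<phi> x))"
proof -
  obtain B :: "'v set" where B: "orthobasis B" using smooth_manifold_orthobasis[OF M] by blast
  show ?thesis
    by (rule csmooth_compose[OF okM B assms(1) csmooth_subset[OF csmooth_chart_map assms(2)] assms(3,4)])
qed

lemma aopen_chart_preimage:
  assumes T: "open T"
  shows "aopen M {x \<in> V. \<phi> x \<in> T}"
  unfolding aopen_def
proof safe
  fix U \<theta> assume U: "(U, \<theta>) \<in> M"
  have op: "open (\<theta> ` (U \<inter> V))" using aopen_image[OF aopen_chart[OF okM V] U] .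
  have "continuous_on (\<theta> ` (U \<inter> V)) (\<lambda>z. \<phi> (inv_into U \<theta> z))"
    by (intro smooth_on_imp_continuous_on smooth_manifold_transition[OF M U V])
  then have "open (\<theta> ` (U \<inter> V) \<inter> (\<lambda>z. \<phi> (inv_into U \<theta> z)) -` T)"
    using op T by (rule continuous_open_preimage)
  moreover have "\<theta> ` (U \<inter> {x \<in> V. \<phi> x \<in> T}) = \<theta> ` (U \<inter> V) \<inter> (\<lambda>z. \<phi> (inv_into U \<theta> z)) -` T"
    using atlas_ok_inj[OF okM U] by (auto simp: inv_into_f_f)
  ultimately show "open (\<theta> ` (U \<inter> {x \<in> V. \<phi> x \<in> T}))" by simp
qed (use chart_subset_points[OF V] in auto)

text \<open>The closed coordinate ball is a continuous image of a compact set, hence closed because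
  the manifold is Hausdorff. Extension by zero of a function supported in the ball is smooth for
  this reason.\<close>

lemma aopen_chart_cball_complement:
  assumes sub: "cball a s \<subseteq> \<phi> ` V"
  shows "aopen M (points M - {x \<in> V. \<phi> x \<in> cball a s})"
proof -
  obtain B :: "'v set" where B: "orthobasis B" using smooth_manifold_orthobasis[OF M] by blast
  let ?X = "atlas_topology M" and ?h = "inv_into V \<phi>"
  have inj: "inj_on \<phi> V" using atlas_ok_inj[OF okM V] .
  have K: "?h ` cball a s = {x \<in> V. \<phi> x \<in> cball a s}" (is "_ = ?K")
  proof
    show "?h ` cball a s \<subseteq> ?K"
      using sub by (auto simp: inv_into_into f_inv_into_f simp del: mem_cball)
    show "?K \<subseteq> ?h ` cball a s"
      using inj by (force simp: inv_into_f_f image_iff simp del: mem_cball)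
  qed
  have "continuous_map (top_of_set (cball a s)) ?X ?h"
    unfolding continuous_map_def
  proof (intro conjI allI impI)
    show "?h \<in> topspace (top_of_set (cball a s)) \<rightarrow> topspace ?X"
      using K chart_subset_points[OF V] by (auto simp: topspace_atlas_topology[OF okM] simp del: mem_cball)
    fix W assume "openin ?X W"
    then have W: "open (\<phi> ` (V \<inter> W))" by (simp add: openin_atlas_topology[OF okM] aopen_image[OF _ V])
    have "{x \<in> topspace (top_of_set (cball a s)). ?h x \<in> W} = cball a s \<inter> \<phi> ` (V \<inter> W)"
      using sub inj by (force simp: inv_into_f_f inv_into_into f_inv_into_f image_iff simp del: mem_cball)
    then show "openin (top_of_set (cball a s)) {x \<in> topspace (top_of_set (cball a s)). ?h x \<in> W}"
      using W by (simp add: openin_open_Int)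
  qed
  then have "compactin ?X (?h ` cball a s)"
    using orthobasis_compact_cball[OF B] by (intro image_compactin[of "top_of_set (cball a s)"]) (auto simp: compactin_subtopology)
  then have "closedin ?X ?K"
    using M K by (intro compactin_imp_closedin) (auto simp: smooth_manifold_def)
  then show ?thesis
    by (simp add: closedin_def topspace_atlas_topology[OF okM] openin_atlas_topology[OF okM])
qed

text \<open>The coordinate ball of radius \<open>r\<close> and the complement of the closed ball of
  radius \<open>s\<close> are open, and they cover the manifold because \<open>s < r\<close>. On the
  overlap both descriptions of the function give 0.\<close>

lemma csmooth_cutoff:
  assumes sub: "ball a r \<subseteq> \<phi> ` V" and s: "s < r"
    and g: "smooth_on (ball a r) g" "\<And>z. z \<in> ball a r \<Longrightarrow> z \<notin> cball a s \<Longrightarrow> g z = 0"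
  shows "csmooth M (points M) (\<lambda>x. if x \<in> V \<and> \<phi> x \<in> ball a r then g (\<phi> x) else 0)"
    (is "csmooth M _ ?f")
proof (rule csmooth_local[OF okM])
  fix x assume x: "x \<in> points M"
  let ?W = "{x \<in> V. \<phi> x \<in> ball a r}" and ?T = "points M - {x \<in> V. \<phi> x \<in> cball a s}"
  have W: "aopen M ?W" by (rule aopen_chart_preimage) simp
  have T: "aopen M ?T" using sub s by (intro aopen_chart_cball_complement) auto
  have "csmooth M ?W (\<lambda>x. g (\<phi> x))"
    by (rule csmooth_chart_compose[OF W _ _ g(1)]) auto
  then have 1: "csmooth M ?W ?f"
    by (rule csmooth_cong[OF okM W, rotated]) auto
  have 2: "csmooth M ?T ?f"
    by (rule csmooth_cong[OF okM T _ csmooth_const[OF okM, of _ 0]]) (use g(2) in auto)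
  have "x \<in> ?W \<or> x \<in> ?T" using x s by auto
  then show "\<exists>T. aopen M T \<and> x \<in> T \<and> csmooth M T ?f" using 1 2 W T by blast
qed

end

lemma ex_chart_ball:
  assumes ok: "atlas_ok A" and V: "(V, \<phi>) \<in> A" and W: "aopen A W" and x: "x \<in> V" "x \<in> W"
  obtains r where "r > 0" "ball (\<phi> x) r \<subseteq> \<phi> ` (V \<inter> W)"
proof -
  have "open (\<phi> ` (V \<inter> W))" "\<phi> x \<in> \<phi> ` (V \<inter> W)" using aopen_image[OF W V] x by auto
  then show ?thesis using that by (meson openE)
qed

section \<open>Smooth maps\<close>

lemma aopen_local:
  assumes ok: "atlas_ok A" and "\<And>x. x \<in> W \<Longrightarrow> \<exists>T. aopen A T \<and> x \<in> T \<and> T \<subseteq> W"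
  shows "aopen A W"
proof -
  have "\<exists>T. openin (atlas_topology A) T \<and> x \<in> T \<and> T \<subseteq> W" if "x \<in> W" for x
    using assms(2)[OF that] openin_atlas_topology[OF ok] by blast
  then have "openin (atlas_topology A) W" by (subst openin_subopen) blast
  then show ?thesis using openin_atlas_topology[OF ok] by blast
qed

lemma csmooth_preimage:
  fixes A :: "('a, 'v::real_inner) atlas"
  assumes ok: "atlas_ok A" and W: "aopen A W" and h: "csmooth A W h" and S: "open S"
  shows "aopen A {x \<in> W. h x \<in> S}"
  unfolding aopen_def
proof safe
  fix U \<phi> assume U: "(U, \<phi>) \<in> A"
  have "open (\<phi> ` (U \<inter> W) \<inter> (\<lambda>z. h (inv_into U \<phi> z)) -` S)"
    by (rule continuous_open_preimage[OF smooth_on_imp_continuous_on[OF csmoothD[OF h U]] aopen_image[OF W U] S])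
  moreover have "\<phi> ` (U \<inter> {x \<in> W. h x \<in> S}) = \<phi> ` (U \<inter> W) \<inter> (\<lambda>z. h (inv_into U \<phi> z)) -` S"
    using atlas_ok_inj[OF ok U] by (auto simp: inv_into_f_f)
  ultimately show "open (\<phi> ` (U \<inter> {x \<in> W. h x \<in> S}))" by simp
qed (use W in \<open>auto simp: aopen_def\<close>)

text \<open>Inside a single target chart the composite is the coordinate expression of
  \<open>h\<close> after that of \<open>f\<close>.\<close>

lemma csmooth_pullback:
  fixes A :: "('a, 'v::real_inner) atlas" and B :: "('b, 'u::real_inner) atlas"
  assumes A: "atlas_ok A" and B: "atlas_ok B" and C: "orthobasis (C :: 'u set)"
    and W: "aopen A W" and V: "(V, \<theta>) \<in> B" and f: "f ` W \<subseteq> V" "csmooth A W (\<lambda>x. \<theta> (f x))"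
    and R: "aopen B R"
  shows "aopen A {x \<in> W. f x \<in> R}"
    and "csmooth B R h \<Longrightarrow> csmooth A {x \<in> W. f x \<in> R} (\<lambda>x. h (f x))"
proof -
  have inj: "inj_on \<theta> V" using atlas_ok_inj[OF B V] .
  have eq: "{x \<in> W. f x \<in> R} = {x \<in> W. \<theta> (f x) \<in> \<theta> ` (V \<inter> R)}"
    using f(1) inj by (auto simp: inj_on_def)
  show op: "aopen A {x \<in> W. f x \<in> R}"
    unfolding eq by (rule csmooth_preimage[OF A W f(2) aopen_image[OF R V]])
  assume h: "csmooth B R h"
  have "csmooth A {x \<in> W. f x \<in> R} (\<lambda>x. h (inv_into V \<theta> (\<theta> (f x))))"
    by (rule csmooth_compose[OF A C op csmooth_subset[OF f(2)] _ csmoothD[OF h V]]) (use f(1) in auto)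
  then show "csmooth A {x \<in> W. f x \<in> R} (\<lambda>x. h (f x))"
    by (rule csmooth_cong[OF A op, rotated]) (use f(1) inj in \<open>auto simp: inv_into_f_f\<close>)
qed

lemma smooth_map_in_points:
  assumes "smooth_map A B f" "atlas_ok A" "atlas_ok B" "x \<in> points A"
  shows "f x \<in> points B"
  using assms unfolding smooth_map_def continuous_map_def by (auto simp: topspace_atlas_topology)

lemma smooth_map_aopen:
  assumes "smooth_map A B f" "atlas_ok A" "atlas_ok B" "aopen B W"
  shows "aopen A {x \<in> points A. f x \<in> W}"
  using assms unfolding smooth_map_def continuous_map_def
  by (auto simp: topspace_atlas_topology openin_atlas_topology)

lemma smooth_map_csmooth_chart:
  assumes "smooth_map A B f" "(V, \<theta>) \<in> B"
  shows "csmooth A {x \<in> points A. f x \<in> V} (\<lambda>x. \<theta> (f x))"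
proof (rule csmoothI)
  fix U \<phi> assume U: "(U, \<phi>) \<in> A"
  have "U \<inter> {x \<in> points A. f x \<in> V} = U \<inter> f -` V" using chart_subset_points[OF U] by auto
  then show "smooth_on (\<phi> ` (U \<inter> {x \<in> points A. f x \<in> V})) (\<lambda>z. \<theta> (f (inv_into U \<phi> z)))"
    using assms U unfolding smooth_map_def by (fastforce simp: comp_def)
qed

lemma smooth_map_csmooth:
  fixes A :: "('a, 'v::real_inner) atlas" and B :: "('b, 'u::real_inner) atlas"
  assumes f: "smooth_map A B f" and A: "atlas_ok A" and B: "atlas_ok B" and C: "orthobasis (C :: 'u set)"
    and R: "aopen B R" and h: "csmooth B R h"
  shows "csmooth A {x \<in> points A. f x \<in> R} (\<lambda>x. h (f x))"
proof (rule csmooth_local[OF A])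
  fix x assume x: "x \<in> {x \<in> points A. f x \<in> R}"
  then obtain V \<theta> where V: "(V, \<theta>) \<in> B" "f x \<in> V"
    using aopen_subset[OF R] pointsE[of "f x" B] by blast
  let ?W = "{x \<in> points A. f x \<in> V}"
  have W: "aopen A ?W" by (rule smooth_map_aopen[OF f A B aopen_chart[OF B V(1)]])
  note * = csmooth_pullback[OF A B C W V(1) _ smooth_map_csmooth_chart[OF f V(1)] R]
  show "\<exists>T. aopen A T \<and> x \<in> T \<and> csmooth A T (\<lambda>x. h (f x))"
    using *(1) *(2)[OF _ h] x V(2) by (intro exI[of _ "{x \<in> ?W. f x \<in> R}"]) auto
qed

text \<open>One chart around each image point is enough, since any other chart of \<open>B\<close>
  is reached through a smooth transition map; hence \<open>B\<close> is a
  \<open>smooth_manifold\<close> here and not just \<open>atlas_ok\<close>.\<close>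

lemma smooth_mapI:
  fixes A :: "('a, 'v::real_inner) atlas" and B :: "('b, 'u::real_inner) atlas"
  assumes A: "atlas_ok A" and B: "smooth_manifold B"
    and loc: "\<And>x. x \<in> points A \<Longrightarrow> \<exists>W V \<theta>. aopen A W \<and> x \<in> W \<and> (V, \<theta>) \<in> B \<and> f ` W \<subseteq> V \<and>
      csmooth A W (\<lambda>x. \<theta> (f x))"
  shows "smooth_map A B f"
proof -
  note okB = smooth_manifold_ok[OF B]
  obtain C :: "'u set" where C: "orthobasis C" using smooth_manifold_orthobasis[OF B] by blast
  have maps: "f x \<in> points B" if "x \<in> points A" for x
    using loc[OF that] chart_subset_points by fastforce
  have pre: "aopen A {x \<in> points A. f x \<in> R}" if R: "aopen B R" for R
  proof (rule aopen_local[OF A])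
    fix x assume x: "x \<in> {x \<in> points A. f x \<in> R}"
    then obtain W V \<theta> where W: "aopen A W" "x \<in> W" "(V, \<theta>) \<in> B" "f ` W \<subseteq> V"
      "csmooth A W (\<lambda>x. \<theta> (f x))" using loc by blast
    show "\<exists>T. aopen A T \<and> x \<in> T \<and> T \<subseteq> {x \<in> points A. f x \<in> R}"
      using csmooth_pullback(1)[OF A okB C W(1,3-5) R] W(2) x aopen_subset[OF W(1)] by blast
  qed
  have sm: "csmooth A {x \<in> points A. f x \<in> V} (\<lambda>x. \<theta> (f x))" if V: "(V, \<theta>) \<in> B" for V \<theta>
  proof (rule csmooth_local[OF A])
    fix x assume x: "x \<in> {x \<in> points A. f x \<in> V}"
    then obtain W V' \<theta>' where W: "aopen A W" "x \<in> W" "(V', \<theta>') \<in> B" "f ` W \<subseteq> V'"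
      "csmooth A W (\<lambda>x. \<theta>' (f x))" using loc by blast
    note * = csmooth_pullback[OF A okB C W(1,3-5) aopen_chart[OF okB V]]
    show "\<exists>T. aopen A T \<and> x \<in> T \<and> csmooth A T (\<lambda>x. \<theta> (f x))"
      using *(1) *(2)[OF csmooth_chart_map[OF B V]] W(2) x by (intro exI[of _ "{x \<in> W. f x \<in> V}"]) auto
  qed
  have "smooth_on (\<phi> ` (U \<inter> f -` V)) (\<theta> \<circ> f \<circ> inv_into U \<phi>)"
    if U: "(U, \<phi>) \<in> A" and V: "(V, \<theta>) \<in> B" for U \<phi> V \<theta>
  proof -
    have "U \<inter> {x \<in> points A. f x \<in> V} = U \<inter> f -` V" using chart_subset_points[OF U] by auto
    then show ?thesis using csmoothD[OF sm[OF V] U] by (simp add: comp_def)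
  qed
  then show ?thesis
    unfolding smooth_map_def continuous_map_def
    using maps pre by (auto simp: topspace_atlas_topology openin_atlas_topology A okB)
qed

section \<open>Restrictions and products of atlases\<close>

lemma points_restrict_atlas: "points (restrict_atlas A W) = points A \<inter> W"
  by (auto simp: points_def restrict_atlas_def)

lemma restrict_atlas_memD:
  "(U', \<phi>) \<in> restrict_atlas A W \<Longrightarrow> \<exists>U. (U, \<phi>) \<in> A \<and> U' = U \<inter> W"
  by (auto simp: restrict_atlas_def)

lemma restrict_atlas_memI: "(U, \<phi>) \<in> A \<Longrightarrow> (U \<inter> W, \<phi>) \<in> restrict_atlas A W"
  by (force simp: restrict_atlas_def)

lemma atlas_ok_restrict:
  assumes ok: "atlas_ok A" and W: "aopen A W"
  shows "atlas_ok (restrict_atlas A W)"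
  unfolding atlas_ok_def
proof safe
  fix U' \<phi> assume "(U', \<phi>) \<in> restrict_atlas A W"
  then obtain U where U: "(U, \<phi>) \<in> A" "U' = U \<inter> W" using restrict_atlas_memD by blast
  show "inj_on \<phi> U'" using atlas_ok_inj[OF ok U(1)] U(2) by (auto simp: inj_on_def)
  fix V' \<theta> assume "(V', \<theta>) \<in> restrict_atlas A W"
  then obtain V where V: "(V, \<theta>) \<in> A" "V' = V \<inter> W" using restrict_atlas_memD by blast
  have "U' \<inter> V' = U \<inter> (V \<inter> W)" using U V by auto
  then show "open (\<phi> ` (U' \<inter> V'))"
    using aopen_image[OF aopen_Int[OF ok aopen_chart[OF ok V(1)] W] U(1)] by simp
qed

lemma aopen_restrict_iff:
  assumes "atlas_ok A" "aopen A W" "T \<subseteq> W"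
  shows "aopen (restrict_atlas A W) T \<longleftrightarrow> aopen A T"
proof -
  have "U \<inter> W \<inter> T = U \<inter> T" for U using assms(3) by auto
  then show ?thesis
    using assms(3) unfolding aopen_def points_restrict_atlas by (auto simp: restrict_atlas_def)
qed

lemma csmooth_restrict_iff:
  assumes ok: "atlas_ok A" and W: "aopen A W" and T: "aopen A T" "T \<subseteq> W"
  shows "csmooth (restrict_atlas A W) T f \<longleftrightarrow> csmooth A T f"
proof -
  have "smooth_on (\<phi> ` (U \<inter> W \<inter> T)) (\<lambda>z. f (inv_into (U \<inter> W) \<phi> z)) \<longleftrightarrow>
        smooth_on (\<phi> ` (U \<inter> T)) (\<lambda>z. f (inv_into U \<phi> z))" if U: "(U, \<phi>) \<in> A" for U \<phi>
  proof -
    have eq: "U \<inter> W \<inter> T = U \<inter> T" using T(2) by auto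
    have inj: "inj_on \<phi> U" "inj_on \<phi> (U \<inter> W)" using atlas_ok_inj[OF ok U] by (auto simp: inj_on_def)
    have "f (inv_into (U \<inter> W) \<phi> z) = f (inv_into U \<phi> z)" if "z \<in> \<phi> ` (U \<inter> T)" for z
    proof -
      from that obtain x where "x \<in> U" "x \<in> T" "z = \<phi> x" by auto
      then show ?thesis using inj T(2) by (auto simp: inv_into_f_f subset_iff)
    qed
    then show ?thesis
      unfolding eq
      using smooth_on_cong[OF aopen_image[OF T(1) U], of "\<lambda>z. f (inv_into (U \<inter> W) \<phi> z)" "\<lambda>z. f (inv_into U \<phi> z)"]
        smooth_on_cong[OF aopen_image[OF T(1) U], of "\<lambda>z. f (inv_into U \<phi> z)" "\<lambda>z. f (inv_into (U \<inter> W) \<phi> z)"]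
      by auto
  qed
  then show ?thesis unfolding csmooth_def restrict_atlas_def by fastforce
qed

lemma points_times_space: "points (times_space A) = points A \<times> UNIV"
  by (auto simp: points_def times_space_def)

lemma times_space_memI: "(U, \<phi>) \<in> A \<Longrightarrow> (U \<times> UNIV, \<lambda>(x, w). (\<phi> x, w)) \<in> times_space A"
  by (force simp: times_space_def)

lemma atlas_ok_times:
  fixes A :: "('a, 'v::topological_space) atlas"
  assumes ok: "atlas_ok A"
  shows "atlas_ok (times_space A :: ('a \<times> 'w::topological_space, 'v \<times> 'w) atlas)"
proof -
  have "inj_on (\<lambda>(x, w). (\<phi> x, w)) (U \<times> (UNIV::'w set))" if "(U, \<phi>) \<in> A" for U \<phi>
    using atlas_ok_inj[OF ok that] by (auto simp: inj_on_def)
  moreover have "open ((\<lambda>(x, w). (\<phi> x, w)) ` (U \<times> (UNIV::'w set) \<inter> V \<times> UNIV))"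
    if "(U, \<phi>) \<in> A" "(V, \<theta>) \<in> A" for U \<phi> V \<theta>
  proof -
    have "(\<lambda>(x, w). (\<phi> x, w)) ` (U \<times> (UNIV::'w set) \<inter> V \<times> UNIV) = \<phi> ` (U \<inter> V) \<times> UNIV"
      by force
    then show ?thesis
      using aopen_image[OF aopen_chart[OF ok that(2)] that(1)] by (simp add: open_Times)
  qed
  ultimately show ?thesis
    unfolding atlas_ok_def times_space_def by fastforce
qed

section \<open>Sections of vector bundles\<close>

context
  fixes M :: "('m, 'v::real_inner) atlas" and E :: "('e, 'm, 'v \<times> 'w::real_inner) bundle_data"
  assumes vb: "vector_bundle M E"
begin

lemma base_manifold: "smooth_manifold M"
  and total_manifold: "smooth_manifold (total_atlas E)"
  and projection_smooth: "smooth_map (total_atlas E) M (projection E)"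
  using vb by (auto simp: vector_bundle_def)

lemmas base_ok = smooth_manifold_ok[OF base_manifold]
  and total_ok = smooth_manifold_ok[OF total_manifold]

lemma ex_trivialization:
  assumes "x \<in> points M"
  obtains U \<psi> where "x \<in> U" "local_trivialization M E U \<psi>"
  using vb assms unfolding vector_bundle_def by blast

lemma fibre_fadd: "x \<in> points M \<Longrightarrow> a \<in> fibre E x \<Longrightarrow> b \<in> fibre E x \<Longrightarrow> fadd E a b \<in> fibre E x"
  and fibre_fscale: "x \<in> points M \<Longrightarrow> a \<in> fibre E x \<Longrightarrow> fscale E c a \<in> fibre E x"
  and fibre_fzero: "x \<in> points M \<Longrightarrow> fzero E x \<in> fibre E x"
  using vb unfolding vector_bundle_def by blast+

lemma section_extensional: "X \<in> sections M E \<Longrightarrow> x \<notin> points M \<Longrightarrow> X x = undefined"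
  by (auto simp: sections_def extensional_def)

lemma section_smooth: "X \<in> sections M E \<Longrightarrow> smooth_map M (total_atlas E) X"
  by (auto simp: sections_def)

lemma section_in_fibre: "X \<in> sections M E \<Longrightarrow> x \<in> points M \<Longrightarrow> X x \<in> fibre E x"
  using smooth_map_in_points[OF section_smooth base_ok total_ok] by (auto simp: sections_def over_def)

section \<open>Local trivializations\<close>

context
  fixes U \<psi>
  assumes triv: "local_trivialization M E U \<psi>"
begin

lemma triv_aopen: "aopen M U"
  using triv openin_atlas_topology[OF base_ok] by (simp add: local_trivialization_def)

lemma triv_in_points: "x \<in> U \<Longrightarrow> x \<in> points M"
  using triv_aopen aopen_subset by blast

lemma over_aopen: "aopen (total_atlas E) (over E U)"
  using smooth_map_aopen[OF projection_smooth total_ok base_ok triv_aopen] by (simp add: over_def)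

lemma over_points: "points (restrict_atlas (total_atlas E) (over E U)) = over E U"
  by (auto simp: points_restrict_atlas over_def)

lemma triv_bij: "bij_betw \<psi> (over E U) (U \<times> UNIV)"
proof -
  have "points (times_space (restrict_atlas M U)) = U \<times> (UNIV :: 'w set)"
    using aopen_subset[OF triv_aopen] by (auto simp: points_times_space points_restrict_atlas)
  then show ?thesis
    using triv by (auto simp: local_trivialization_def diffeomorphism_def over_points)
qed

lemma fibre_subset_over: "x \<in> U \<Longrightarrow> fibre E x \<subseteq> over E U"
  by (auto simp: over_def)

lemma triv_fst: "e \<in> over E U \<Longrightarrow> fst (\<psi> e) = projection E e"
  using triv by (simp add: local_trivialization_def)

lemma triv_eq: "x \<in> U \<Longrightarrow> e \<in> fibre E x \<Longrightarrow> \<psi> e = (x, snd (\<psi> e))"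
  using triv_fst[of e] by (auto simp: over_def prod_eq_iff)

lemma triv_fadd: "x \<in> U \<Longrightarrow> a \<in> fibre E x \<Longrightarrow> b \<in> fibre E x \<Longrightarrow> snd (\<psi> (fadd E a b)) = snd (\<psi> a) + snd (\<psi> b)"
  and triv_fscale: "x \<in> U \<Longrightarrow> a \<in> fibre E x \<Longrightarrow> snd (\<psi> (fscale E c a)) = c *\<^sub>R snd (\<psi> a)"
  and triv_fzero: "x \<in> U \<Longrightarrow> snd (\<psi> (fzero E x)) = 0"
  using triv unfolding local_trivialization_def by blast+

lemma triv_inj: "x \<in> U \<Longrightarrow> a \<in> fibre E x \<Longrightarrow> b \<in> fibre E x \<Longrightarrow> snd (\<psi> a) = snd (\<psi> b) \<Longrightarrow> a = b"
  by (metis bij_betw_imp_inj_on fibre_subset_over inj_onD subsetD triv_bij triv_eq)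

lemma triv_inv:
  assumes "x \<in> U"
  shows "\<psi> (inv_into (over E U) \<psi> (x, w)) = (x, w)" "inv_into (over E U) \<psi> (x, w) \<in> fibre E x"
proof -
  have im: "(x, w) \<in> \<psi> ` over E U" using triv_bij assms by (auto simp: bij_betw_def)
  then show 1: "\<psi> (inv_into (over E U) \<psi> (x, w)) = (x, w)" by (rule f_inv_into_f)
  have "inv_into (over E U) \<psi> (x, w) \<in> over E U" using im by (rule inv_into_into)
  then show "inv_into (over E U) \<psi> (x, w) \<in> fibre E x"
    using 1 triv_fst by (fastforce simp: over_def)
qed

lemma triv_inv_eq: "x \<in> U \<Longrightarrow> a \<in> fibre E x \<Longrightarrow> inv_into (over E U) \<psi> (x, snd (\<psi> a)) = a"
  by (rule triv_inj) (auto simp: triv_inv)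

text \<open>Smoothness of \<open>\<psi>\<close> is given between a restricted atlas and a product
  atlas. The fibre part is its second coordinate in a product chart, and the result is carried back
  to the full atlas of \<open>E\<close>.\<close>

lemma triv_snd_csmooth: "csmooth (total_atlas E) (over E U) (\<lambda>e. snd (\<psi> e))"
proof (rule csmooth_local[OF total_ok])
  fix e assume e: "e \<in> over E U"
  let ?TE = "restrict_atlas (total_atlas E) (over E U)"
    and ?TM = "times_space (restrict_atlas M U) :: ('m \<times> 'w, 'v \<times> 'w) atlas"
  have okE: "atlas_ok ?TE" by (rule atlas_ok_restrict[OF total_ok over_aopen])
  have okM: "atlas_ok ?TM" by (intro atlas_ok_times atlas_ok_restrict[OF base_ok triv_aopen])
  have sm: "smooth_map ?TE ?TM \<psi>"
    using triv by (simp add: local_trivialization_def diffeomorphism_def)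
  have U: "projection E e \<in> U" using e by (simp add: over_def)
  then obtain V \<phi> where V: "(V, \<phi>) \<in> M" "projection E e \<in> V" using pointsE triv_in_points by metis
  let ?D = "(V \<inter> U) \<times> (UNIV :: 'w set)" and ?c = "\<lambda>(x, w::'w). (\<phi> x, w)"
  have D: "(?D, ?c) \<in> ?TM" by (intro times_space_memI restrict_atlas_memI V)
  let ?T = "{e \<in> points ?TE. \<psi> e \<in> ?D}"
  have T: "aopen ?TE ?T" by (rule smooth_map_aopen[OF sm okE okM aopen_chart[OF okM D]])
  have "csmooth ?TE ?T (\<lambda>e. ?c (\<psi> e))" by (rule smooth_map_csmooth_chart[OF sm D])
  from csmooth_linear[OF okE bounded_linear_snd T this]
  have sT: "csmooth ?TE ?T (\<lambda>e. snd (\<psi> e))" by (simp add: split_beta)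
  have sub: "?T \<subseteq> over E U" by (auto simp: over_points)
  have aT: "aopen (total_atlas E) ?T"
    using T aopen_restrict_iff[OF total_ok over_aopen sub] by (rule iffD1[rotated])
  have "e \<in> ?T" using e U V(2) triv_fst[OF e] by (simp add: over_points mem_Times_iff)
  moreover have "csmooth (total_atlas E) ?T (\<lambda>e. snd (\<psi> e))"
    using sT csmooth_restrict_iff[OF total_ok over_aopen aT sub] by (rule iffD1[rotated])
  ultimately show "\<exists>T. aopen (total_atlas E) T \<and> e \<in> T \<and> csmooth (total_atlas E) T (\<lambda>e. snd (\<psi> e))"
    using aT by (intro exI[of _ ?T] conjI)
qed

lemma section_csmooth:
  assumes X: "X \<in> sections M E"
  shows "csmooth M U (\<lambda>x. snd (\<psi> (X x)))"
proof -
  obtain C :: "('v \<times> 'w) set" where C: "orthobasis C"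
    using smooth_manifold_orthobasis[OF total_manifold] by blast
  have "csmooth M {x \<in> points M. X x \<in> over E U} (\<lambda>x. snd (\<psi> (X x)))"
    by (rule smooth_map_csmooth[OF section_smooth[OF X] base_ok total_ok C over_aopen triv_snd_csmooth])
  then show ?thesis
    by (rule csmooth_subset) (use section_in_fibre[OF X] triv_in_points in \<open>auto simp: over_def\<close>)
qed

text \<open>Writes \<open>s\<close> as the inverse trivialization after \<open>?j\<close>, whose
  coordinates are smooth. Smooth components in one trivialization thus make a smooth section, which
  \<open>sectionI\<close> packages as a criterion.\<close>

lemma section_local_smooth:
  assumes W: "aopen M W" "W \<subseteq> U" and s: "\<And>x. x \<in> W \<Longrightarrow> s x \<in> fibre E x"
    and sm: "csmooth M W (\<lambda>x. snd (\<psi> (s x)))" and x: "x \<in> W"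
  shows "\<exists>T O' \<kappa>. aopen M T \<and> x \<in> T \<and> (O', \<kappa>) \<in> total_atlas E \<and> s ` T \<subseteq> O' \<and> csmooth M T (\<lambda>x. \<kappa> (s x))"
proof -
  let ?TE = "restrict_atlas (total_atlas E) (over E U)"
    and ?TM = "times_space (restrict_atlas M U) :: ('m \<times> 'w, 'v \<times> 'w) atlas"
  obtain C :: "('v \<times> 'w) set" where C: "orthobasis C"
    using smooth_manifold_orthobasis[OF total_manifold] by blast
  have okE: "atlas_ok ?TE" by (rule atlas_ok_restrict[OF total_ok over_aopen])
  have okM: "atlas_ok ?TM" by (intro atlas_ok_times atlas_ok_restrict[OF base_ok triv_aopen])
  let ?h = "inv_into (over E U) \<psi>" and ?j = "\<lambda>x. (x, snd (\<psi> (s x)))"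
  have inv: "smooth_map ?TM ?TE ?h"
    using triv by (simp add: local_trivialization_def diffeomorphism_def over_points)
  have hj: "?h (?j y) = s y" if "y \<in> W" for y
    using that W(2) s by (auto intro: triv_inv_eq)
  have "s x \<in> points (total_atlas E)" using s[OF x] by (simp add: over_def)
  then obtain O' \<kappa> where O: "(O', \<kappa>) \<in> total_atlas E" "s x \<in> O'" by (elim pointsE)
  have "x \<in> points M" using x W triv_in_points by blast
  then obtain V \<phi> where V: "(V, \<phi>) \<in> M" "x \<in> V" by (elim pointsE)
  let ?O = "O' \<inter> over E U" and ?D = "(V \<inter> U) \<times> (UNIV :: 'w set)" and ?c = "\<lambda>(x, w::'w). (\<phi> x, w)"
  have O'': "(?O, \<kappa>) \<in> ?TE" by (rule restrict_atlas_memI[OF O(1)])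
  have D: "(?D, ?c) \<in> ?TM" by (intro times_space_memI restrict_atlas_memI V)
  let ?R = "{p \<in> points ?TM. ?h p \<in> ?O}"
  have R: "aopen ?TM ?R" by (rule smooth_map_aopen[OF inv okM okE aopen_chart[OF okE O'']])
  have kR: "csmooth ?TM ?R (\<lambda>p. \<kappa> (?h p))" by (rule smooth_map_csmooth_chart[OF inv O''])
  let ?W = "W \<inter> V"
  have W': "aopen M ?W" by (rule aopen_Int[OF base_ok W(1) aopen_chart[OF base_ok V(1)]])
  have jc: "csmooth M ?W (\<lambda>x. ?c (?j x))"
    using csmooth_Pair[OF base_ok W' csmooth_subset[OF csmooth_chart_map[OF base_manifold V(1)]] csmooth_subset[OF sm]]
    by simp
  have jW: "?j ` ?W \<subseteq> ?D" using W(2) by auto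
  note * = csmooth_pullback[OF base_ok okM C W' D jW jc R]
  let ?T = "{x \<in> ?W. ?j x \<in> ?R}"
  have "csmooth M ?T (\<lambda>x. \<kappa> (s x))"
    by (rule csmooth_cong[OF base_ok *(1) _ *(2)[OF kR]]) (simp add: hj)
  moreover have "x \<in> ?T"
    using x V(2) O(2) hj[OF x] s[OF x] W(2) triv_in_points fibre_subset_over
    by (auto simp: points_times_space points_restrict_atlas)
  moreover have "s ` ?T \<subseteq> O'" using hj by auto
  ultimately show ?thesis using *(1) O(1) by blast
qed

end

lemma sectionI:
  assumes ext: "\<And>x. x \<notin> points M \<Longrightarrow> s x = undefined"
    and fib: "\<And>x. x \<in> points M \<Longrightarrow> s x \<in> fibre E x"
    and loc: "\<And>x. x \<in> points M \<Longrightarrow> \<exists>U \<psi> W. local_trivialization M E U \<psi> \<and> aopen M W \<and> x \<in> W \<and> W \<subseteq> U \<and>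
       csmooth M W (\<lambda>x. snd (\<psi> (s x)))"
  shows "s \<in> sections M E"
proof -
  have "smooth_map M (total_atlas E) s"
  proof (rule smooth_mapI[OF base_ok total_manifold])
    fix x assume "x \<in> points M"
    then obtain U \<psi> W where "local_trivialization M E U \<psi>" "aopen M W" "x \<in> W" "W \<subseteq> U"
       "csmooth M W (\<lambda>x. snd (\<psi> (s x)))" using loc by blast
    then show "\<exists>W V \<theta>. aopen M W \<and> x \<in> W \<and> (V, \<theta>) \<in> total_atlas E \<and> s ` W \<subseteq> V \<and> csmooth M W (\<lambda>x. \<theta> (s x))"
      using section_local_smooth[of U \<psi> W s x] fib aopen_subset by blast
  qed
  then show ?thesis using ext fib by (auto simp: sections_def extensional_def over_def)
qed

lemma section_add_in_sections:
  assumes X: "X \<in> sections M E" and Y: "Y \<in> sections M E"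
  shows "section_add M E X Y \<in> sections M E"
proof (rule sectionI)
  fix x assume x: "x \<in> points M"
  show "section_add M E X Y x \<in> fibre E x"
    using x fibre_fadd section_in_fibre[OF X] section_in_fibre[OF Y] by (simp add: section_add_def)
  obtain U \<psi> where U: "x \<in> U" and t: "local_trivialization M E U \<psi>" using ex_trivialization[OF x] .
  have "csmooth M U (\<lambda>x. snd (\<psi> (X x)) + snd (\<psi> (Y x)))"
    by (intro csmooth_add base_ok triv_aopen[OF t] section_csmooth[OF t] X Y)
  then have "csmooth M U (\<lambda>x. snd (\<psi> (section_add M E X Y x)))"
    by (rule csmooth_cong[OF base_ok triv_aopen[OF t], rotated])
      (simp add: section_add_def triv_in_points[OF t] triv_fadd[OF t] section_in_fibre X Y)
  then show "\<exists>U \<psi> W. local_trivialization M E U \<psi> \<and> aopen M W \<and> x \<in> W \<and> W \<subseteq> U \<and>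
       csmooth M W (\<lambda>x. snd (\<psi> (section_add M E X Y x)))"
    using t triv_aopen[OF t] U by blast
qed (simp add: section_add_def)

lemma section_mult_in_sections:
  assumes f: "csmooth M (points M) f" and X: "X \<in> sections M E"
  shows "section_mult M E f X \<in> sections M E"
proof (rule sectionI)
  fix x assume x: "x \<in> points M"
  show "section_mult M E f X x \<in> fibre E x"
    using x fibre_fscale section_in_fibre[OF X] by (simp add: section_mult_def)
  obtain U \<psi> where U: "x \<in> U" and t: "local_trivialization M E U \<psi>" using ex_trivialization[OF x] .
  have "csmooth M U (\<lambda>x. f x *\<^sub>R snd (\<psi> (X x)))"
    by (intro csmooth_scaleR base_ok triv_aopen[OF t] section_csmooth[OF t] X csmooth_subset[OF f]
        aopen_subset)
  then have "csmooth M U (\<lambda>x. snd (\<psi> (section_mult M E f X x)))"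
    by (rule csmooth_cong[OF base_ok triv_aopen[OF t], rotated])
      (simp add: section_mult_def triv_in_points[OF t] triv_fscale[OF t] section_in_fibre X)
  then show "\<exists>U \<psi> W. local_trivialization M E U \<psi> \<and> aopen M W \<and> x \<in> W \<and> W \<subseteq> U \<and>
       csmooth M W (\<lambda>x. snd (\<psi> (section_mult M E f X x)))"
    using t triv_aopen[OF t] U by blast
qed (simp add: section_mult_def)

text \<open>The analogue of \<open>csmooth_cutoff\<close> for sections given by components
  \<open>g\<close>. Off the smaller closed ball the components are 0, so the local formula already
  yields the zero vector and the two branches fit together.\<close>

lemma cutoff_section:
  assumes t: "local_trivialization M E U \<psi>" and V: "(V, \<phi>) \<in> M"
    and sub: "ball a r \<subseteq> \<phi> ` (V \<inter> U)" and s: "s < r"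
    and g: "smooth_on (ball a r) g" "\<And>z. z \<in> ball a r \<Longrightarrow> z \<notin> cball a s \<Longrightarrow> g z = 0"
  shows "(\<lambda>x\<in>points M. if x \<in> V \<and> \<phi> x \<in> ball a r then inv_into (over E U) \<psi> (x, g (\<phi> x)) else fzero E x)
    \<in> sections M E" (is "?s \<in> _")
proof (rule sectionI)
  have in_U: "x \<in> U" if "x \<in> V" "\<phi> x \<in> ball a r" for x
  proof -
    from sub that(2) obtain y where "\<phi> x = \<phi> y" "y \<in> V" "y \<in> U" by blast
    then show ?thesis using atlas_ok_inj[OF base_ok V] that(1) by (auto dest: inj_onD)
  qed
  fix x assume x: "x \<in> points M"
  show "?s x \<in> fibre E x"
    using x in_U by (simp add: fibre_fzero triv_inv[OF t] del: mem_ball)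
  let ?W = "{x \<in> V. \<phi> x \<in> ball a r}" and ?T = "points M - {x \<in> V. \<phi> x \<in> cball a s}"
  have W: "aopen M ?W" by (rule aopen_chart_preimage[OF base_manifold V]) simp
  have "cball a s \<subseteq> ball a r" using s by auto
  also note sub also have "\<phi> ` (V \<inter> U) \<subseteq> \<phi> ` V" by auto
  finally have T: "aopen M ?T" by (rule aopen_chart_cball_complement[OF base_manifold V])
  have 0: "snd (\<psi>' (?s y)) = 0" if "y \<in> ?T" "y \<in> U'" and t': "local_trivialization M E U' \<psi>'" for y U' \<psi>'
  proof -
    have "?s y = fzero E y"
    proof (cases "y \<in> V \<and> \<phi> y \<in> ball a r")
      case True
      then have "g (\<phi> y) = 0" using that(1) g(2) by blast
      moreover have "y \<in> U" using True in_U by blast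
      then have "inv_into (over E U) \<psi> (y, 0) = fzero E y"
        using triv_inv_eq[OF t, of y "fzero E y"] fibre_fzero triv_in_points[OF t] triv_fzero[OF t] by simp
      ultimately show ?thesis using that(1) True by simp
    qed (use that in auto)
    then show ?thesis using triv_fzero[OF t'] that(2) by simp
  qed
  show "\<exists>U \<psi> W. local_trivialization M E U \<psi> \<and> aopen M W \<and> x \<in> W \<and> W \<subseteq> U \<and>
       csmooth M W (\<lambda>x. snd (\<psi> (?s x)))"
  proof (cases "x \<in> ?W")
    case True
    have "csmooth M ?W (\<lambda>x. g (\<phi> x))"
      by (rule csmooth_chart_compose[OF base_manifold V W _ _ g(1)]) auto
    then have "csmooth M ?W (\<lambda>x. snd (\<psi> (?s x)))"
      by (rule csmooth_cong[OF base_ok W, rotated])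
        (use in_U triv_in_points[OF t] in \<open>auto simp: triv_inv[OF t] simp del: mem_ball\<close>)
    then show ?thesis using t W True in_U by blast
  next
    case False
    then have xT: "x \<in> ?T" using x s by auto
    obtain U' \<psi>' where U': "x \<in> U'" and t': "local_trivialization M E U' \<psi>'" using ex_trivialization[OF x] .
    have TU: "aopen M (?T \<inter> U')" by (rule aopen_Int[OF base_ok T triv_aopen[OF t']])
    have "csmooth M (?T \<inter> U') (\<lambda>x. snd (\<psi>' (?s x)))"
      by (rule csmooth_cong[OF base_ok TU 0[OF _ _ t', symmetric] csmooth_const[OF base_ok]]) blast+
    then show ?thesis using t' TU xT U' by blast
  qed
qed simp

end

section \<open>Point derivations\<close>

text \<open>Unlike \<open>tangent_space\<close> it requires nothing off \<open>Cinf A\<close>, so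
  that maps such as \<open>\<lambda>G. P F G q\<close> qualify, whose values there are
  arbitrary.\<close>

definition point_derivation :: "('a, 'v::real_inner) atlas \<Rightarrow> 'a \<Rightarrow> (('a \<Rightarrow> real) \<Rightarrow> real) \<Rightarrow> bool" where
  "point_derivation A p D \<longleftrightarrow>
     (\<forall>f\<in>Cinf A. \<forall>g\<in>Cinf A. D (\<lambda>x. f x + g x) = D f + D g) \<and>
     (\<forall>c. \<forall>f\<in>Cinf A. D (\<lambda>x. c * f x) = c * D f) \<and>
     (\<forall>f\<in>Cinf A. \<forall>g\<in>Cinf A. D (\<lambda>x. f x * g x) = D f * g p + f p * D g)"

context
  fixes A :: "('a, 'v::real_inner) atlas" and p D
  assumes ok: "atlas_ok A" and D: "point_derivation A p D"
begin

lemma derivation_add: "f \<in> Cinf A \<Longrightarrow> g \<in> Cinf A \<Longrightarrow> D (\<lambda>x. f x + g x) = D f + D g"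
  and derivation_scale: "f \<in> Cinf A \<Longrightarrow> D (\<lambda>x. c * f x) = c * D f"
  and derivation_mult: "f \<in> Cinf A \<Longrightarrow> g \<in> Cinf A \<Longrightarrow> D (\<lambda>x. f x * g x) = D f * g p + f p * D g"
  using D by (auto simp: point_derivation_def)

lemma derivation_zero: "D (\<lambda>_. 0) = 0"
  using derivation_scale[OF Cinf_zero[OF ok], of 0] by simp

lemma derivation_diff: "f \<in> Cinf A \<Longrightarrow> g \<in> Cinf A \<Longrightarrow> D (\<lambda>x. f x - g x) = D f - D g"
  using derivation_add[OF _ Cinf_scale[OF ok, of g "-1"], of f] derivation_scale[of g "-1"] by simp

lemma derivation_sum:
  "finite I \<Longrightarrow> (\<And>i. i \<in> I \<Longrightarrow> f i \<in> Cinf A) \<Longrightarrow> D (\<lambda>x. \<Sum>i\<in>I. f i x) = (\<Sum>i\<in>I. D (f i))"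
  by (induction I rule: finite_induct) (simp_all add: derivation_zero derivation_add Cinf_sum[OF ok])

text \<open>The unit \<open>?u\<close> of \<open>Cinf A\<close> is idempotent, so the product rule
  gives \<open>D ?u = D ?u + D ?u\<close>.\<close>

lemma derivation_const:
  assumes "p \<in> points A"
  shows "D (\<lambda>x. if x \<in> points A then c else 0) = 0"
proof -
  let ?u = "\<lambda>x. if x \<in> points A then 1 else (0::real)"
  have u: "?u \<in> Cinf A" by (rule Cinf_const[OF ok])
  have "(\<lambda>x. ?u x * ?u x) = ?u" by auto
  then have "D ?u = 0" using derivation_mult[OF u u] assms by simp
  moreover have "(\<lambda>x. c * ?u x) = (\<lambda>x. if x \<in> points A then c else 0)" by auto
  ultimately show ?thesis using derivation_scale[OF u, of c] by simp
qed

end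

section \<open>The dual bundle\<close>

text \<open>The covector at \<open>x\<close> with components \<open>v\<close> in the coframe of
  \<open>\<psi>\<close>, that is, the fibre part of the inverse of \<open>dual_chart\<close>. With
  \<open>v\<close> fixed it is a local section of the dual bundle.\<close>

definition covec :: "('e, 'm, 'u) bundle_data \<Rightarrow> ('e \<Rightarrow> 'm \<times> 'w::real_inner) \<Rightarrow> 'm \<Rightarrow> 'w \<Rightarrow> 'e \<Rightarrow> real" where
  "covec E \<psi> x v = (\<lambda>e. if e \<in> fibre E x then v \<bullet> snd (\<psi> e) else 0)"

definition dual_chart ::
  "('e, 'm, 'u) bundle_data \<Rightarrow> 'm set \<Rightarrow> ('e \<Rightarrow> 'm \<times> (real^'k::finite)) \<Rightarrow> ('m \<Rightarrow> 'v) \<Rightarrow>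
    'm \<times> ('e \<Rightarrow> real) \<Rightarrow> 'v \<times> (real^'k)" where
  "dual_chart E U \<psi> \<phi> = (\<lambda>(x, \<xi>). (\<phi> x, \<chi> i. \<xi> (inv_into (over E U) \<psi> (x, axis i 1))))"

text \<open>The coordinate expression of \<open>F\<close>, with the inverse chart written out by
  \<open>covec\<close> so that it can be evaluated and differentiated directly;
  \<open>dual_chart_inv\<close> matches it with \<open>inv_into\<close>.\<close>

definition local_rep ::
  "('e, 'm, 'u) bundle_data \<Rightarrow> ('e \<Rightarrow> 'm \<times> (real^'k::finite)) \<Rightarrow> 'm set \<Rightarrow> ('m \<Rightarrow> 'v) \<Rightarrow>
    ('m \<times> ('e \<Rightarrow> real) \<Rightarrow> 'b) \<Rightarrow> 'v \<times> (real^'k) \<Rightarrow> 'b" where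
  "local_rep E \<psi> V \<phi> F = (\<lambda>(z, v). F (inv_into V \<phi> z, covec E \<psi> (inv_into V \<phi> z) v))"

abbreviation dual_total ::
  "('m, 'v::real_inner) atlas \<Rightarrow> ('e, 'm, 'v \<times> (real^'k::finite)) bundle_data \<Rightarrow>
    ('m \<times> ('e \<Rightarrow> real), 'v \<times> (real^'k)) atlas" where
  "dual_total M E \<equiv> total_atlas (dual_bundle M E)"

lemma dual_projection: "projection (dual_bundle M E) = fst"
  by (simp add: dual_bundle_def)

context
  fixes M :: "('m, 'v::real_inner) atlas" and E :: "('e, 'm, 'v \<times> (real^'k::finite)) bundle_data"
  assumes vb: "vector_bundle M E"
begin

lemma dual_atlas:
  "(dual_total M E) = {(SIGMA x:U \<inter> V. dual_space E x, dual_chart E U \<psi> \<phi>) | U \<psi> V \<phi>.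
     local_trivialization M E U \<psi> \<and> (V, \<phi>) \<in> M}"
  by (simp add: dual_bundle_def dual_chart_def)

lemma dual_points: "points (dual_total M E) = (SIGMA x:points M. dual_space E x)"
proof
  show "points (dual_total M E) \<subseteq> (SIGMA x:points M. dual_space E x)"
    by (auto simp: points_def dual_atlas)
  show "(SIGMA x:points M. dual_space E x) \<subseteq> points (dual_total M E)"
  proof safe
    fix x \<xi> assume x: "x \<in> points M" and \<xi>: "\<xi> \<in> dual_space E x"
    obtain U \<psi> where "x \<in> U" "local_trivialization M E U \<psi>" using ex_trivialization[OF vb x] .
    moreover obtain V \<phi> where "(V, \<phi>) \<in> M" "x \<in> V" using pointsE[OF x] .
    ultimately have "(SIGMA x:U \<inter> V. dual_space E x, dual_chart E U \<psi> \<phi>) \<in> (dual_total M E)"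
      "(x, \<xi>) \<in> (SIGMA x:U \<inter> V. dual_space E x)" using \<xi> by (auto simp: dual_atlas)
    then show "(x, \<xi>) \<in> points (dual_total M E)" using chart_subset_points by blast
  qed
qed

lemma dual_spaceD:
  assumes "\<xi> \<in> dual_space E x"
  shows "e \<notin> fibre E x \<Longrightarrow> \<xi> e = 0"
    and "a \<in> fibre E x \<Longrightarrow> b \<in> fibre E x \<Longrightarrow> \<xi> (fadd E a b) = \<xi> a + \<xi> b"
    and "a \<in> fibre E x \<Longrightarrow> \<xi> (fscale E c a) = c * \<xi> a"
  using assms by (auto simp: dual_space_def)

context
  fixes U \<psi>
  assumes t: "local_trivialization M E U \<psi>"
begin

lemma covec_in_dual: "x \<in> U \<Longrightarrow> covec E \<psi> x v \<in> dual_space E x"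
  using triv_fadd[OF vb t] triv_fscale[OF vb t] fibre_fadd[OF vb] fibre_fscale[OF vb] triv_in_points[OF vb t]
  by (auto simp: covec_def dual_space_def inner_add_right)

lemma covec_frame: "x \<in> U \<Longrightarrow> covec E \<psi> x v (inv_into (over E U) \<psi> (x, axis i 1)) = v $ i"
  by (simp add: covec_def triv_inv[OF vb t] inner_axis)

text \<open>In the trivialization \<open>\<xi>\<close> becomes a linear form on
  \<open>real^'k\<close>, which its values on the standard basis determine. Linearity is transported
  through \<open>\<psi>\<close>, injective on each fibre.\<close>

lemma dual_expand:
  assumes x: "x \<in> U" and \<xi>: "\<xi> \<in> dual_space E x"
  shows "covec E \<psi> x (\<chi> i. \<xi> (inv_into (over E U) \<psi> (x, axis i 1))) = \<xi>"
proof
  fix e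
  let ?h = "\<lambda>w. \<xi> (inv_into (over E U) \<psi> (x, w))"
  note inv = triv_inv[OF vb t x]
  have xM: "x \<in> points M" using triv_in_points[OF vb t x] .
  have "linear ?h"
  proof
    fix w w' :: "real^'k" and c :: real
    have "inv_into (over E U) \<psi> (x, w + w') =
      fadd E (inv_into (over E U) \<psi> (x, w)) (inv_into (over E U) \<psi> (x, w'))"
      by (rule triv_inj[OF vb t x]) (auto simp: inv fibre_fadd[OF vb xM] triv_fadd[OF vb t x])
    then show "?h (w + w') = ?h w + ?h w'" using dual_spaceD(2)[OF \<xi>] inv by simp
    have "inv_into (over E U) \<psi> (x, c *\<^sub>R w) = fscale E c (inv_into (over E U) \<psi> (x, w))"
      by (rule triv_inj[OF vb t x]) (auto simp: inv fibre_fscale[OF vb xM] triv_fscale[OF vb t x])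
    then show "?h (c *\<^sub>R w) = c *\<^sub>R ?h w" using dual_spaceD(3)[OF \<xi>] inv by simp
  qed
  then have lin: "?h w = (\<Sum>i\<in>UNIV. w $ i * ?h (axis i 1))" for w
  proof -
    have "?h w = ?h (\<Sum>i\<in>UNIV. (w $ i) *\<^sub>R axis i 1)"
      by (simp add: basis_expansion flip: scalar_mult_eq_scaleR)
    also have "\<dots> = (\<Sum>i\<in>UNIV. w $ i * ?h (axis i 1))"
      using linear_sum[OF \<open>linear ?h\<close>, of "\<lambda>i. (w $ i) *\<^sub>R axis i 1" UNIV]
        linear_scale[OF \<open>linear ?h\<close>] by simp
    finally show ?thesis .
  qed
  show "covec E \<psi> x (\<chi> i. ?h (axis i 1)) e = \<xi> e"
  proof (cases "e \<in> fibre E x")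
    case True
    then have "\<xi> e = ?h (snd (\<psi> e))" using triv_inv_eq[OF vb t x True] by simp
    then show ?thesis using True lin[of "snd (\<psi> e)"]
      by (simp add: covec_def inner_vec_def mult.commute)
  qed (simp add: covec_def dual_spaceD(1)[OF \<xi>])
qed

context
  fixes V \<phi>
  assumes V: "(V, \<phi>) \<in> M"
begin

lemma dual_chart_mem: "(SIGMA x:U \<inter> V. dual_space E x, dual_chart E U \<psi> \<phi>) \<in> (dual_total M E)"
  using t V by (auto simp: dual_atlas)

lemma dual_chart_covec: "x \<in> U \<Longrightarrow> dual_chart E U \<psi> \<phi> (x, covec E \<psi> x v) = (\<phi> x, v)"
  by (simp add: dual_chart_def covec_frame vec_eq_iff)

lemma dual_chart_image:
  "dual_chart E U \<psi> \<phi> ` ((SIGMA x:U \<inter> V. dual_space E x) \<inter> {q \<in> points (dual_total M E). fst q \<in> W}) = \<phi> ` (U \<inter> V \<inter> W) \<times> UNIV"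
proof safe
  fix x v assume x: "x \<in> U" "x \<in> V" "x \<in> W"
  then have "(x, covec E \<psi> x v) \<in> (SIGMA x:U \<inter> V. dual_space E x) \<inter> {q \<in> points (dual_total M E). fst q \<in> W}"
    using covec_in_dual triv_in_points[OF vb t] by (auto simp: dual_points)
  then show "(\<phi> x, v) \<in> dual_chart E U \<psi> \<phi> ` ((SIGMA x:U \<inter> V. dual_space E x) \<inter> {q \<in> points (dual_total M E). fst q \<in> W})"
    by (rule image_eqI[rotated]) (simp add: dual_chart_covec[OF x(1)])
qed (auto simp: dual_chart_def)

lemma dual_chart_inj: "inj_on (dual_chart E U \<psi> \<phi>) (SIGMA x:U \<inter> V. dual_space E x)"
proof (rule inj_onI, safe)
  fix x \<xi> y \<eta>
  assume x: "x \<in> U" "x \<in> V" and \<xi>: "\<xi> \<in> dual_space E x" and y: "y \<in> U" "y \<in> V" and \<eta>: "\<eta> \<in> dual_space E y"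
    and eq: "dual_chart E U \<psi> \<phi> (x, \<xi>) = dual_chart E U \<psi> \<phi> (y, \<eta>)"
  from eq have "\<phi> x = \<phi> y" by (simp add: dual_chart_def)
  then show xy: "x = y"
    using inj_onD[OF atlas_ok_inj[OF base_ok[OF vb] V]] x y by blast
  have "(\<chi> i. \<xi> (inv_into (over E U) \<psi> (x, axis i 1))) = (\<chi> i. \<eta> (inv_into (over E U) \<psi> (y, axis i 1)))"
    using eq by (simp add: dual_chart_def)
  then have "covec E \<psi> x (\<chi> i. \<xi> (inv_into (over E U) \<psi> (x, axis i 1))) =
      covec E \<psi> y (\<chi> i. \<eta> (inv_into (over E U) \<psi> (y, axis i 1)))"
    by (simp only: xy)
  then show "\<xi> = \<eta>" unfolding dual_expand[OF x(1) \<xi>] dual_expand[OF y(1) \<eta>] .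
qed

lemma dual_chart_inv:
  assumes "z \<in> \<phi> ` (U \<inter> V)"
  shows "inv_into (SIGMA x:U \<inter> V. dual_space E x) (dual_chart E U \<psi> \<phi>) (z, v) =
    (inv_into V \<phi> z, covec E \<psi> (inv_into V \<phi> z) v)"
proof -
  obtain x where x: "x \<in> U" "x \<in> V" "z = \<phi> x" using assms by auto
  have i: "inv_into V \<phi> z = x" using x atlas_ok_inj[OF base_ok[OF vb] V] by (simp add: inv_into_f_f)
  show ?thesis unfolding i
    by (rule inv_into_f_eq[OF dual_chart_inj]) (use x covec_in_dual dual_chart_covec in auto)
qed

lemma local_rep_smooth_iff:
  assumes W: "aopen M W"
  shows "smooth_on (dual_chart E U \<psi> \<phi> ` ((SIGMA x:U \<inter> V. dual_space E x) \<inter> {q \<in> points (dual_total M E). fst q \<in> W}))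
       (\<lambda>p. F (inv_into (SIGMA x:U \<inter> V. dual_space E x) (dual_chart E U \<psi> \<phi>) p)) \<longleftrightarrow>
     smooth_on (\<phi> ` (U \<inter> V \<inter> W) \<times> UNIV) (local_rep E \<psi> V \<phi> F)"
proof -
  have "open (\<phi> ` (V \<inter> (U \<inter> W)))"
    by (rule aopen_image[OF aopen_Int[OF base_ok[OF vb] triv_aopen[OF vb t] W] V])
  then have op: "open (\<phi> ` (U \<inter> V \<inter> W) \<times> (UNIV :: (real^'k) set))"
    by (simp add: open_Times Int_assoc Int_left_commute)
  have eq: "F (inv_into (SIGMA x:U \<inter> V. dual_space E x) (dual_chart E U \<psi> \<phi>) p) = local_rep E \<psi> V \<phi> F p"
    if "p \<in> \<phi> ` (U \<inter> V \<inter> W) \<times> UNIV" for p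
    using that dual_chart_inv[of "fst p" "snd p"] by (auto simp: local_rep_def)
  show ?thesis unfolding dual_chart_image
    by (rule iffI; (erule smooth_on_cong[OF op eq, rotated] smooth_on_cong[OF op eq[symmetric], rotated]; assumption))
qed

end
end

lemma dual_aopen_fst:
  assumes W: "aopen M W"
  shows "aopen (dual_total M E) {q \<in> points (dual_total M E). fst q \<in> W}"
  unfolding aopen_def
proof safe
  fix D \<kappa> assume "(D, \<kappa>) \<in> (dual_total M E)"
  then obtain U \<psi> V \<phi> where t: "local_trivialization M E U \<psi>" and V: "(V, \<phi>) \<in> M"
    and D: "D = (SIGMA x:U \<inter> V. dual_space E x)" "\<kappa> = dual_chart E U \<psi> \<phi>" unfolding dual_atlas by auto
  have "open (\<phi> ` (V \<inter> (U \<inter> W)))"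
    by (rule aopen_image[OF aopen_Int[OF base_ok[OF vb] triv_aopen[OF vb t] W] V])
  then show "open (\<kappa> ` (D \<inter> {q \<in> points (dual_total M E). fst q \<in> W}))"
    unfolding D dual_chart_image[OF t V] by (simp add: open_Times Int_assoc Int_left_commute)
qed

text \<open>Chart domains are preimages of open sets of the base, so openness of the overlaps
  reduces to \<open>dual_aopen_fst\<close>.\<close>

lemma dual_ok: "atlas_ok (dual_total M E)"
  unfolding atlas_ok_def
proof safe
  fix D \<kappa> assume D': "(D, \<kappa>) \<in> (dual_total M E)"
  then obtain U \<psi> V \<phi> where t: "local_trivialization M E U \<psi>" and V: "(V, \<phi>) \<in> M"
    and D: "D = (SIGMA x:U \<inter> V. dual_space E x)" "\<kappa> = dual_chart E U \<psi> \<phi>" unfolding dual_atlas by auto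
  show "inj_on \<kappa> D" using D dual_chart_inj[OF t V] by simp
  fix D2 \<kappa>2 assume "(D2, \<kappa>2) \<in> (dual_total M E)"
  then obtain U2 \<psi>2 V2 \<phi>2 where t2: "local_trivialization M E U2 \<psi>2" and V2: "(V2, \<phi>2) \<in> M"
    and D2: "D2 = (SIGMA x:U2 \<inter> V2. dual_space E x)" unfolding dual_atlas by auto
  have "D2 = {q \<in> points (dual_total M E). fst q \<in> U2 \<inter> V2}"
    using triv_in_points[OF vb t2] by (auto simp: D2 dual_points)
  moreover have "aopen (dual_total M E) {q \<in> points (dual_total M E). fst q \<in> U2 \<inter> V2}"
    by (intro dual_aopen_fst aopen_Int base_ok[OF vb] triv_aopen[OF vb t2] aopen_chart[OF _ V2])
  ultimately show "open (\<kappa> ` (D \<inter> D2))" using aopen_image[OF _ D'] by simp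
qed

lemma dual_csmooth_iff:
  assumes W: "aopen M W"
  shows "csmooth (dual_total M E) {q \<in> points (dual_total M E). fst q \<in> W} F \<longleftrightarrow>
    (\<forall>U \<psi> V \<phi>. local_trivialization M E U \<psi> \<longrightarrow> (V, \<phi>) \<in> M \<longrightarrow>
       smooth_on (\<phi> ` (U \<inter> V \<inter> W) \<times> UNIV) (local_rep E \<psi> V \<phi> F))" (is "?L \<longleftrightarrow> ?R")
proof
  show "?L \<Longrightarrow> ?R"
    using csmoothD[OF _ dual_chart_mem] local_rep_smooth_iff[OF _ _ W] by blast
  show "?R \<Longrightarrow> ?L"
  proof (rule csmoothI)
    assume R: ?R
    fix D \<kappa> assume "(D, \<kappa>) \<in> (dual_total M E)"
    then obtain U \<psi> V \<phi> where t: "local_trivialization M E U \<psi>" and V: "(V, \<phi>) \<in> M"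
      and D: "D = (SIGMA x:U \<inter> V. dual_space E x)" "\<kappa> = dual_chart E U \<psi> \<phi>" unfolding dual_atlas by auto
    show "smooth_on (\<kappa> ` (D \<inter> {q \<in> points (dual_total M E). fst q \<in> W})) (\<lambda>z. F (inv_into D \<kappa> z))"
      unfolding D using R local_rep_smooth_iff[OF t V W] t V by blast
  qed
qed

lemma local_rep_smooth:
  assumes "F \<in> Cinf (dual_total M E)" "local_trivialization M E U \<psi>" "(V, \<phi>) \<in> M"
  shows "smooth_on (\<phi> ` (U \<inter> V) \<times> UNIV) (local_rep E \<psi> V \<phi> F)"
proof -
  have "{q \<in> points (dual_total M E). fst q \<in> points M} = points (dual_total M E)" by (auto simp: dual_points)
  then have "csmooth (dual_total M E) {q \<in> points (dual_total M E). fst q \<in> points M} F"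
    using assms(1) Cinf_iff[OF dual_ok] by auto
  then have "smooth_on (\<phi> ` (U \<inter> V \<inter> points M) \<times> UNIV) (local_rep E \<psi> V \<phi> F)"
    using dual_csmooth_iff[OF aopen_points[OF base_ok[OF vb]]] assms by blast
  moreover have "U \<inter> V \<inter> points M = U \<inter> V" using chart_subset_points[OF assms(3)] by auto
  ultimately show ?thesis by simp
qed

lemma csmooth_dual_fst:
  fixes f :: "'m \<Rightarrow> 'b::real_normed_vector"
  assumes W: "aopen M W" and f: "csmooth M W f"
  shows "csmooth (dual_total M E) {q \<in> points (dual_total M E). fst q \<in> W} (\<lambda>q. f (fst q))"
  unfolding dual_csmooth_iff[OF W]
proof (intro allI impI)
  fix U \<psi> V \<phi> assume t: "local_trivialization M E U \<psi>" and V: "(V, \<phi>) \<in> M"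
  obtain B :: "'v set" where B: "orthobasis B"
    using smooth_manifold_orthobasis[OF base_manifold[OF vb]] by blast
  have "open (\<phi> ` (V \<inter> (U \<inter> W)))"
    by (rule aopen_image[OF aopen_Int[OF base_ok[OF vb] triv_aopen[OF vb t] W] V])
  then have op: "open (\<phi> ` (U \<inter> V \<inter> W) \<times> (UNIV :: (real^'k) set))"
    by (simp add: open_Times Int_assoc Int_left_commute)
  have "smooth_on (\<phi> ` (U \<inter> V \<inter> W) \<times> (UNIV :: (real^'k) set)) (\<lambda>p. f (inv_into V \<phi> (fst p)))"
    by (rule smooth_on_compose[OF B op smooth_on_bounded_linear[OF bounded_linear_fst op] _ csmoothD[OF f V]]) auto
  moreover have "local_rep E \<psi> V \<phi> (\<lambda>q. f (fst q)) = (\<lambda>p. f (inv_into V \<phi> (fst p)))"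
    by (auto simp: local_rep_def)
  ultimately show "smooth_on (\<phi> ` (U \<inter> V \<inter> W) \<times> UNIV) (local_rep E \<psi> V \<phi> (\<lambda>q. f (fst q)))" by simp
qed

definition pull :: "('m \<Rightarrow> real) \<Rightarrow> 'm \<times> ('e \<Rightarrow> real) \<Rightarrow> real" where
  "pull f = (\<lambda>q. if q \<in> points (dual_total M E) then f (fst q) else 0)"

lemma pull_Cinf:
  assumes "f \<in> Cinf M"
  shows "pull f \<in> Cinf (dual_total M E)"
proof (rule Cinf_localI[OF dual_ok])
  fix q assume q: "q \<in> points (dual_total M E)"
  have eq: "{q \<in> points (dual_total M E). fst q \<in> points M} = points (dual_total M E)" by (auto simp: dual_points)
  have "csmooth (dual_total M E) (points (dual_total M E)) (\<lambda>q. f (fst q))"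
    using csmooth_dual_fst[OF aopen_points[OF base_ok[OF vb]], of f] assms Cinf_iff[OF base_ok[OF vb]] eq by auto
  then show "\<exists>W g. aopen (dual_total M E) W \<and> q \<in> W \<and> csmooth (dual_total M E) W g \<and> (\<forall>y\<in>W. pull f y = g y)"
    using q aopen_points[OF dual_ok] by (intro exI[of _ "points (dual_total M E)"] exI[of _ "\<lambda>q. f (fst q)"]) (auto simp: pull_def)
qed (simp add: pull_def)

lemma Phi_eq: "q \<in> points (dual_total M E) \<Longrightarrow> Phi M E X q = snd q (X (fst q))"
  by (simp add: Phi_def dual_projection)

lemma Phi_outside: "q \<notin> points (dual_total M E) \<Longrightarrow> Phi M E X q = 0"
  by (simp add: Phi_def)

lemma Phi_local_rep:
  assumes t: "local_trivialization M E U \<psi>" and V: "(V, \<phi>) \<in> M" and X: "X \<in> sections M E"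
    and z: "z \<in> \<phi> ` (U \<inter> V)"
  shows "local_rep E \<psi> V \<phi> (Phi M E X) (z, v) = v \<bullet> snd (\<psi> (X (inv_into V \<phi> z)))"
proof -
  obtain x where x: "x \<in> U" "x \<in> V" "z = \<phi> x" using z by auto
  have i: "inv_into V \<phi> z = x" using x atlas_ok_inj[OF base_ok[OF vb] V] by (simp add: inv_into_f_f)
  have xM: "x \<in> points M" using triv_in_points[OF vb t x(1)] .
  show ?thesis
    using xM covec_in_dual[OF t x(1)] section_in_fibre[OF vb X xM]
    by (simp add: local_rep_def i Phi_eq dual_points) (simp add: covec_def)
qed

lemma Phi_Cinf:
  assumes X: "X \<in> sections M E"
  shows "Phi M E X \<in> Cinf (dual_total M E)"
proof -
  have "csmooth (dual_total M E) {q \<in> points (dual_total M E). fst q \<in> points M} (Phi M E X)"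
    unfolding dual_csmooth_iff[OF aopen_points[OF base_ok[OF vb]]]
  proof (intro allI impI)
    fix U \<psi> V \<phi> assume t: "local_trivialization M E U \<psi>" and V: "(V, \<phi>) \<in> M"
    obtain B :: "'v set" where B: "orthobasis B"
      using smooth_manifold_orthobasis[OF base_manifold[OF vb]] by blast
    have UV: "\<phi> ` (U \<inter> V \<inter> points M) = \<phi> ` (V \<inter> U)" using chart_subset_points[OF V] by auto
    then have op: "open (\<phi> ` (U \<inter> V \<inter> points M) \<times> (UNIV :: (real^'k) set))"
      using aopen_image[OF triv_aopen[OF vb t] V] by (simp add: open_Times)
    have 1: "smooth_on (\<phi> ` (U \<inter> V \<inter> points M) \<times> (UNIV :: (real^'k) set)) (\<lambda>p. snd (\<psi> (X (inv_into V \<phi> (fst p)))))"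
      by (rule smooth_on_compose[OF B op smooth_on_bounded_linear[OF bounded_linear_fst op] _
            csmoothD[OF section_csmooth[OF vb t X] V]]) (use UV in auto)
    have 2: "smooth_on (\<phi> ` (U \<inter> V \<inter> points M) \<times> (UNIV :: (real^'k) set))
       (\<lambda>p. snd p \<bullet> snd (\<psi> (X (inv_into V \<phi> (fst p)))))"
      by (intro smooth_on_bilinear[OF bounded_bilinear_inner op _ 1] smooth_on_bounded_linear bounded_linear_snd op)
    show "smooth_on (\<phi> ` (U \<inter> V \<inter> points M) \<times> UNIV) (local_rep E \<psi> V \<phi> (Phi M E X))"
      by (rule smooth_on_cong[OF op _ 2]) (use UV Phi_local_rep[OF t V X] in auto)
  qed
  moreover have "{q \<in> points (dual_total M E). fst q \<in> points M} = points (dual_total M E)" by (auto simp: dual_points)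
  ultimately show ?thesis using Cinf_iff[OF dual_ok] by (simp add: Phi_outside)
qed

text \<open>Pairing with all covectors recovers the components of a section. Identities between
  sections can thus be checked as identities between functions.\<close>

lemma Phi_inject:
  assumes X: "X \<in> sections M E" and Y: "Y \<in> sections M E" and eq: "Phi M E X = Phi M E Y"
  shows "X = Y"
proof
  fix x
  show "X x = Y x"
  proof (cases "x \<in> points M")
    case True
    obtain U \<psi> where U: "x \<in> U" and t: "local_trivialization M E U \<psi>" using ex_trivialization[OF vb True] .
    have "v \<bullet> snd (\<psi> (X x)) = v \<bullet> snd (\<psi> (Y x))" for v
    proof -
      have "(x, covec E \<psi> x v) \<in> points (dual_total M E)" using covec_in_dual[OF t U] True by (simp add: dual_points)
      from Phi_eq[OF this, of X] Phi_eq[OF this, of Y] eq show ?thesis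
        using section_in_fibre[OF vb X True] section_in_fibre[OF vb Y True] by (simp add: covec_def)
    qed
    then have "snd (\<psi> (X x)) = snd (\<psi> (Y x))" by (metis vector_eq_rdot inner_commute)
    then show ?thesis
      using triv_inj[OF vb t U] section_in_fibre[OF vb X True] section_in_fibre[OF vb Y True] by blast
  qed (simp add: section_extensional[OF vb X] section_extensional[OF vb Y])
qed

lemma Phi_section_add:
  "X \<in> sections M E \<Longrightarrow> Y \<in> sections M E \<Longrightarrow> Phi M E (section_add M E X Y) = (\<lambda>q. Phi M E X q + Phi M E Y q)"
  using section_in_fibre[OF vb] dual_spaceD(2)
  by (auto simp: fun_eq_iff Phi_def dual_points dual_projection section_add_def)

lemma Phi_section_mult:
  "X \<in> sections M E \<Longrightarrow> Phi M E (section_mult M E f X) = (\<lambda>q. f (fst q) * Phi M E X q)"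
  using section_in_fibre[OF vb] dual_spaceD(3)
  by (auto simp: fun_eq_iff Phi_def dual_points dual_projection section_mult_def)

end

section \<open>Adapted frames\<close>

text \<open>\<open>e\<close> and \<open>y\<close> are global objects which agree over the ball of radius \<open>r\<close> with the frame of the
  trivialization \<open>\<psi>\<close> and with the chart \<open>\<phi>\<close>; \<open>h\<close> is supported well inside that ball.\<close>

locale adapted_frame =
  fixes M :: "('m, 'v::real_inner) atlas" and E :: "('e, 'm, 'v \<times> (real^'k::finite)) bundle_data"
    and U :: "'m set" and \<psi> :: "'e \<Rightarrow> 'm \<times> (real^'k)" and V :: "'m set" and \<phi> :: "'m \<Rightarrow> 'v"
    and a :: 'v and r :: real and e :: "'k \<Rightarrow> 'm \<Rightarrow> 'e" and y :: "'m \<Rightarrow> 'v" and h :: "'m \<Rightarrow> real"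
  assumes vb: "vector_bundle M E" and t: "local_trivialization M E U \<psi>" and V: "(V, \<phi>) \<in> M"
    and r: "r > 0" and sub: "ball a r \<subseteq> \<phi> ` (V \<inter> U)"
    and e_sec: "\<And>i. e i \<in> sections M E"
    and e_eq: "\<And>i x. x \<in> V \<Longrightarrow> \<phi> x \<in> ball a r \<Longrightarrow> e i x = inv_into (over E U) \<psi> (x, axis i 1)"
    and y_smooth: "csmooth M (points M) y"
    and y_eq: "\<And>x. x \<in> V \<Longrightarrow> \<phi> x \<in> ball a r \<Longrightarrow> y x = \<phi> x"
    and h_Cinf: "h \<in> Cinf M"
    and h_one: "\<And>x. x \<in> V \<Longrightarrow> \<phi> x \<in> ball a (r/3) \<Longrightarrow> h x = 1"
    and h_zero: "\<And>x. \<not> (x \<in> V \<and> \<phi> x \<in> cball a (r/2)) \<Longrightarrow> h x = 0"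

text \<open>Frame and chart are multiplied by a plateau function and extended by zero, because the
  bracket accepts global sections only.\<close>

lemma ex_adapted_frame:
  fixes M :: "('m, 'v::real_inner) atlas" and E :: "('e, 'm, 'v \<times> (real^'k::finite)) bundle_data"
  assumes vb: "vector_bundle M E" and x: "x \<in> points M"
  shows "\<exists>U \<psi> V \<phi> r e y h. adapted_frame M E U \<psi> V \<phi> (\<phi> x) r e y h \<and> x \<in> V"
proof -
  note ok = base_ok[OF vb]
  obtain U \<psi> where U: "x \<in> U" and t: "local_trivialization M E U \<psi>" using ex_trivialization[OF vb x] .
  obtain V \<phi> where V: "(V, \<phi>) \<in> M" "x \<in> V" using pointsE[OF x] .
  obtain R where R: "R > 0" "ball (\<phi> x) R \<subseteq> \<phi> ` (V \<inter> U)"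
    using ex_chart_ball[OF ok V(1) triv_aopen[OF vb t] V(2) U] .
  let ?a = "\<phi> x" and ?r = "R / 2"
  have subV: "ball ?a R \<subseteq> \<phi> ` V" using R(2) by auto
  \<comment> \<open>With \<open>?r = R / 2\<close> this plateau is 1 up to radius \<open>?r\<close>
    and vanishes from \<open>3*R/4\<close> on, so \<open>e\<close> and \<open>y\<close> are exact on
    the smaller ball and extend by zero. The second plateau, for \<open>h\<close>, vanishes from
    \<open>?r/2\<close> on, which leaves room between the support of \<open>h\<close> and the edge
    of that ball.\<close>
  obtain \<kappa> :: "'v \<Rightarrow> real" where k: "smooth_on UNIV \<kappa>" "\<And>z. norm (z - ?a) \<le> R/2 \<Longrightarrow> \<kappa> z = 1"
    "\<And>z. norm (z - ?a) \<ge> 3*R/4 \<Longrightarrow> \<kappa> z = 0"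
    by (rule ex_plateau[of "R/2" "3*R/4" ?a]) (use R(1) in auto)
  obtain \<kappa>' :: "'v \<Rightarrow> real" where k': "smooth_on UNIV \<kappa>'" "\<And>z. norm (z - ?a) \<le> ?r/3 \<Longrightarrow> \<kappa>' z = 1"
    "\<And>z. norm (z - ?a) \<ge> ?r/2 \<Longrightarrow> \<kappa>' z = 0"
    by (rule ex_plateau[of "?r/3" "?r/2" ?a]) (use R(1) in auto)
  have k1: "\<kappa> z = 1" if "z \<in> ball ?a ?r" for z
    using k(2)[of z] that by (simp add: dist_norm norm_minus_commute)
  have kR: "smooth_on (ball ?a R) \<kappa>" and kR': "smooth_on (ball ?a R) \<kappa>'"
    using k(1) k'(1) smooth_on_subset by blast+
  have k0: "\<kappa> z = 0" if "z \<notin> cball ?a (3*R/4)" for z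
    using k(3)[of z] that by (simp add: dist_norm norm_minus_commute)
  have k0': "\<kappa>' z = 0" if "z \<notin> cball ?a (?r/2)" for z
    using k'(3)[of z] that by (simp add: dist_norm norm_minus_commute)
  define e where "e = (\<lambda>i. \<lambda>x\<in>points M. if x \<in> V \<and> \<phi> x \<in> ball ?a R
      then inv_into (over E U) \<psi> (x, \<kappa> (\<phi> x) *\<^sub>R axis i 1) else fzero E x)"
  define y where "y = (\<lambda>x. if x \<in> V \<and> \<phi> x \<in> ball ?a R then \<kappa> (\<phi> x) *\<^sub>R \<phi> x else 0)"
  define h where "h = (\<lambda>x. if x \<in> V \<and> \<phi> x \<in> ball ?a R then \<kappa>' (\<phi> x) else 0)"
  have "e i \<in> sections M E" for i
    unfolding e_def
    by (rule cutoff_section[OF vb t V(1) R(2), of "3*R/4"])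
      (use R(1) k0 in \<open>auto intro!: smooth_on_scaleR kR smooth_on_const\<close>)
  moreover have "csmooth M (points M) y"
    unfolding y_def
    by (rule csmooth_cutoff[OF base_manifold[OF vb] V(1) subV, of "3*R/4"])
      (use R(1) k0 in \<open>auto intro!: smooth_on_scaleR[OF _ kR smooth_on_bounded_linear[OF bounded_linear_ident]]\<close>)
  moreover have "csmooth M (points M) h"
    unfolding h_def
    by (rule csmooth_cutoff[OF base_manifold[OF vb] V(1) subV, of "?r/2"])
      (use R(1) k0' kR' in auto)
  then have "h \<in> Cinf M"
    using chart_subset_points[OF V(1)] by (auto simp: Cinf_iff[OF ok] h_def)
  moreover have "ball ?a ?r \<subseteq> ball ?a R" using R(1) by (intro subset_ball) simp
  moreover have "e i z = inv_into (over E U) \<psi> (z, axis i 1)" if "z \<in> V" "\<phi> z \<in> ball ?a ?r" for i z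
    using that k1[OF that(2)] calculation(4) chart_subset_points[OF V(1)] by (auto simp: e_def)
  moreover have "y z = \<phi> z" if "z \<in> V" "\<phi> z \<in> ball ?a ?r" for z
    using that k1[OF that(2)] calculation(4) by (auto simp: y_def)
  moreover have "h z = 1" if "z \<in> V" "\<phi> z \<in> ball ?a (?r/3)" for z
  proof -
    have "\<kappa>' (\<phi> z) = 1" using k'(2)[of "\<phi> z"] that(2) by (simp add: dist_norm norm_minus_commute)
    moreover have "\<phi> z \<in> ball ?a R" using that(2) R(1) by simp
    ultimately show ?thesis using that(1) by (simp add: h_def)
  qed
  moreover have "h z = 0" if "\<not> (z \<in> V \<and> \<phi> z \<in> cball ?a (?r/2))" for z
    using that k0'[of "\<phi> z"] by (auto simp: h_def)
  ultimately have "adapted_frame M E U \<psi> V \<phi> ?a ?r e y h"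
    using R vb t V(1) by unfold_locales auto
  then show ?thesis using V(2) by blast
qed

section \<open>Global coordinates on the dual bundle over an adapted frame\<close>

context adapted_frame
begin

abbreviation "N \<equiv> dual_total M E"
abbreviation "rep \<equiv> local_rep E \<psi> V \<phi>"

text \<open>On \<open>plateau\<close> the global \<open>e\<close> and \<open>y\<close> are the frame
  and the chart; on \<open>core\<close> moreover \<open>h\<close> is 1. \<open>tube\<close> is the
  coordinate image of the part over \<open>plateau\<close>, with full fibres, and convex so that
  Hadamard's lemma applies.\<close>

definition plateau :: "'m set" where "plateau = {x \<in> V. \<phi> x \<in> ball a r}"
definition core :: "'m set" where "core = {x \<in> V. \<phi> x \<in> ball a (r/3)}"
definition tube :: "('v \<times> (real^'k)) set" where "tube = ball a r \<times> UNIV"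

lemmas okM = base_ok[OF vb] and okN = dual_ok[OF vb]

lemma plateau_subset: "plateau \<subseteq> U \<inter> V" "plateau \<subseteq> points M"
proof -
  show "plateau \<subseteq> U \<inter> V"
  proof
    fix x assume x: "x \<in> plateau"
    then have "\<phi> x \<in> \<phi> ` (V \<inter> U)" using sub by (auto simp: plateau_def simp del: mem_ball)
    then obtain z where "\<phi> x = \<phi> z" "z \<in> V" "z \<in> U" by blast
    then show "x \<in> U \<inter> V"
      using atlas_ok_inj[OF okM V] x by (auto simp: plateau_def dest: inj_onD)
  qed
  then show "plateau \<subseteq> points M" using chart_subset_points[OF V] by blast
qed

lemma core_subset: "core \<subseteq> plateau"
  using r by (auto simp: core_def plateau_def)

lemma aopen_plateau: "aopen M plateau" and aopen_core: "aopen M core"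
  unfolding plateau_def core_def by (rule aopen_chart_preimage[OF base_manifold[OF vb] V open_ball])+

lemma h_core: "x \<in> core \<Longrightarrow> h x = 1"
  using h_one by (simp add: core_def)

lemma h_outside: "x \<notin> plateau \<Longrightarrow> h x = 0"
  using h_zero[of x] r by (auto simp: plateau_def)

lemma aopen_off: "aopen M (points M - {x \<in> V. \<phi> x \<in> cball a (r/2)})"
proof (rule aopen_chart_cball_complement[OF base_manifold[OF vb] V])
  have "cball a (r/2) \<subseteq> ball a r" using r by auto
  then show "cball a (r/2) \<subseteq> \<phi> ` V" using sub by blast
qed

lemma plateau_or_off: "x \<in> points M \<Longrightarrow> x \<in> plateau \<or> x \<in> points M - {x \<in> V. \<phi> x \<in> cball a (r/2)}"
  using r by (auto simp: plateau_def)

lemma tube: "open tube" "convex tube" "tube \<subseteq> \<phi> ` (U \<inter> V) \<times> UNIV"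
  using sub by (auto simp: tube_def open_Times convex_Times Int_commute)

lemma cut_Cinf:
  assumes u: "csmooth M plateau u"
  shows "(\<lambda>x. if x \<in> plateau then h x * u x else 0) \<in> Cinf M" (is "?f \<in> _")
proof (rule Cinf_localI[OF okM])
  show "?f x = 0" if "x \<notin> points M" for x using that plateau_subset(2) by auto
  fix x assume "x \<in> points M"
  from plateau_or_off[OF this]
  show "\<exists>W g. aopen M W \<and> x \<in> W \<and> csmooth M W g \<and> (\<forall>z\<in>W. ?f z = g z)"
  proof
    assume x: "x \<in> plateau"
    have "csmooth M plateau (\<lambda>x. h x * u x)"
      by (intro csmooth_mult okM aopen_plateau u Cinf_imp_csmooth[OF okM h_Cinf plateau_subset(2)])
    then show ?thesis
      using x aopen_plateau by (intro exI[of _ plateau] exI[of _ "\<lambda>x. h x * u x"]) auto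
  next
    assume x: "x \<in> points M - {x \<in> V. \<phi> x \<in> cball a (r/2)}"
    have "?f z = 0" if "z \<in> points M - {x \<in> V. \<phi> x \<in> cball a (r/2)}" for z
      using that h_zero[of z] by auto
    then show ?thesis
      using x aopen_off csmooth_const[OF okM, of _ 0]
      by (intro exI[of _ "points M - {x \<in> V. \<phi> x \<in> cball a (r/2)}"] exI[of _ "\<lambda>_. 0"]) blast
  qed
qed

text \<open>A globally smooth map that over \<open>plateau\<close> is the chart of the dual bundle,
  by \<open>dual_chart_coords\<close>. It is built from \<open>y\<close> and the functions of the
  sections \<open>e i\<close>, so its components are fibrewise affine.\<close>

definition coords :: "'m \<times> ('e \<Rightarrow> real) \<Rightarrow> 'v \<times> (real^'k)" where
  "coords q = (y (fst q), \<chi> i. Phi M E (e i) q)"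

lemma dual_chart_coords: "q \<in> points N \<Longrightarrow> fst q \<in> plateau \<Longrightarrow> dual_chart E U \<psi> \<phi> q = coords q"
  using y_eq e_eq by (cases q) (auto simp: coords_def dual_chart_def plateau_def Phi_eq[OF vb] vec_eq_iff)

lemma coords_covec:
  assumes "x \<in> plateau"
  shows "(x, covec E \<psi> x v) \<in> points N" "coords (x, covec E \<psi> x v) = (\<phi> x, v)"
proof -
  have x: "x \<in> U" using assms plateau_subset by auto
  show q: "(x, covec E \<psi> x v) \<in> points N"
    using covec_in_dual[OF vb t x] triv_in_points[OF vb t x] by (simp add: dual_points[OF vb])
  show "coords (x, covec E \<psi> x v) = (\<phi> x, v)"
    using dual_chart_coords[OF q] assms dual_chart_covec[OF vb t V x] by simp
qed

lemma covec_coords: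
  assumes q: "q \<in> points N" "fst q \<in> plateau"
  shows "q = (fst q, covec E \<psi> (fst q) (snd (coords q)))" "fst (coords q) = \<phi> (fst q)"
proof -
  obtain x \<xi> where x: "q = (x, \<xi>)" "\<xi> \<in> dual_space E x" using q by (auto simp: dual_points[OF vb])
  have xU: "x \<in> U" using q plateau_subset x by auto
  have c: "coords q = (\<phi> x, \<chi> i. \<xi> (inv_into (over E U) \<psi> (x, axis i 1)))"
    using dual_chart_coords[OF q] by (simp add: x dual_chart_def)
  then show "fst (coords q) = \<phi> (fst q)" by (simp add: x)
  have "covec E \<psi> (fst q) (snd (coords q)) = \<xi>"
    using dual_expand[OF vb t xU x(2)] c x(1) by simp
  then show "q = (fst q, covec E \<psi> (fst q) (snd (coords q)))" using x(1) by simp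
qed

lemma coords_in_tube: "q \<in> points N \<Longrightarrow> fst q \<in> plateau \<Longrightarrow> coords q \<in> tube"
  using covec_coords(2)[of q] by (cases "coords q") (auto simp: tube_def plateau_def)

lemma inv_chart: "x \<in> V \<Longrightarrow> inv_into V \<phi> (\<phi> x) = x"
  using atlas_ok_inj[OF okM V] by simp

lemma local_rep_coords:
  assumes q: "q \<in> points N" "fst q \<in> plateau"
  shows "rep F (coords q) = F q"
proof -
  have "rep F (coords q) = F (fst q, covec E \<psi> (fst q) (snd (coords q)))"
    using covec_coords(2)[OF q] inv_chart[of "fst q"] q(2) by (simp add: local_rep_def split_beta plateau_def)
  then show ?thesis using covec_coords(1)[OF q] by simp
qed

lemma local_rep_smooth_tube: "F \<in> Cinf N \<Longrightarrow> smooth_on tube (rep F)"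
  using smooth_on_subset[OF local_rep_smooth[OF vb _ t V] tube(3)] .

lemma coords_csmooth: "csmooth N (points N) coords"
proof -
  have eq: "{q \<in> points N. fst q \<in> points M} = points N" by (auto simp: dual_points[OF vb])
  have "csmooth N (points N) (\<lambda>q. y (fst q))"
    using csmooth_dual_fst[OF vb aopen_points[OF okM] y_smooth] eq by simp
  moreover have "csmooth N (points N) (\<lambda>q. \<chi> i. Phi M E (e i) q)"
    using Cinf_imp_csmooth[OF okN Phi_Cinf[OF vb e_sec]]
    by (intro csmooth_vec[OF okN aopen_points[OF okN]]) simp
  ultimately show ?thesis
    unfolding coords_def[abs_def] by (rule csmooth_Pair[OF okN aopen_points[OF okN]])
qed

lemma ex_orthobasis_tube: "\<exists>C :: ('v \<times> (real^'k)) set. orthobasis C"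
  using smooth_manifold_orthobasis[OF total_manifold[OF vb]] .

text \<open>Over \<open>core\<close> this is \<open>g\<close> read in coordinates; the factor
  \<open>h\<close> makes it global.\<close>

definition ext :: "('v \<times> (real^'k) \<Rightarrow> real) \<Rightarrow> 'm \<times> ('e \<Rightarrow> real) \<Rightarrow> real" where
  "ext g = (\<lambda>q. if q \<in> points N \<and> fst q \<in> plateau then h (fst q) * g (coords q) else 0)"

lemma ext_Cinf:
  assumes g: "smooth_on tube g"
  shows "ext g \<in> Cinf N"
proof (rule Cinf_localI[OF okN])
  fix q assume q: "q \<in> points N"
  then have "fst q \<in> points M" by (auto simp: dual_points[OF vb])
  from plateau_or_off[OF this]
  show "\<exists>W f. aopen N W \<and> q \<in> W \<and> csmooth N W f \<and> (\<forall>z\<in>W. ext g z = f z)"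
  proof
    assume x: "fst q \<in> plateau"
    let ?W = "{q \<in> points N. fst q \<in> plateau}"
    have W: "aopen N ?W" by (rule dual_aopen_fst[OF vb aopen_plateau])
    obtain C :: "('v \<times> (real^'k)) set" where C: "orthobasis C" using ex_orthobasis_tube by blast
    have 1: "csmooth N ?W (\<lambda>q. g (coords q))"
      by (rule csmooth_compose[OF okN C W csmooth_subset[OF coords_csmooth] _ g])
        (auto simp: coords_in_tube)
    have "csmooth N ?W (\<lambda>q. h (fst q))"
      by (rule csmooth_dual_fst[OF vb aopen_plateau Cinf_imp_csmooth[OF okM h_Cinf plateau_subset(2)]])
    then have "csmooth N ?W (\<lambda>q. h (fst q) * g (coords q))"
      using 1 by (rule csmooth_mult[OF okN W])
    then show ?thesis
      using x q W by (intro exI[of _ ?W] exI[of _ "\<lambda>q. h (fst q) * g (coords q)"]) (auto simp: ext_def)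
  next
    let ?T = "points M - {x \<in> V. \<phi> x \<in> cball a (r/2)}"
    let ?W = "{q \<in> points N. fst q \<in> ?T}"
    assume x: "fst q \<in> ?T"
    have W: "aopen N ?W" by (rule dual_aopen_fst[OF vb aopen_off])
    have "ext g z = 0" if "z \<in> ?W" for z
      using that h_zero[of "fst z"] by (auto simp: ext_def)
    then show ?thesis
      using x q W csmooth_const[OF okN, of _ 0] by (intro exI[of _ ?W] exI[of _ "\<lambda>_. 0"]) blast
  qed
qed (simp add: ext_def)

definition gen :: "'v \<times> (real^'k) \<Rightarrow> 'm \<times> ('e \<Rightarrow> real) \<Rightarrow> real" where
  "gen c = (\<lambda>q. if q \<in> points N then coords q \<bullet> c else 0)"

lemma gen_Cinf: "gen c \<in> Cinf N"
proof -
  have "csmooth N (points N) (\<lambda>q. coords q \<bullet> c)"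
    by (rule csmooth_linear[OF okN bounded_linear_inner_left aopen_points[OF okN] coords_csmooth])
  then have "csmooth N (points N) (gen c)"
    by (rule csmooth_cong[OF okN aopen_points[OF okN], rotated]) (simp add: gen_def)
  then show ?thesis by (simp add: Cinf_iff[OF okN] gen_def)
qed

lemma y_inner_Cinf: "(\<lambda>x. if x \<in> points M then y x \<bullet> b else 0) \<in> Cinf M"
proof -
  have "csmooth M (points M) (\<lambda>x. y x \<bullet> b)"
    by (rule csmooth_linear[OF okM bounded_linear_inner_left aopen_points[OF okM] y_smooth])
  then have "csmooth M (points M) (\<lambda>x. if x \<in> points M then y x \<bullet> b else 0)"
    by (rule csmooth_cong[OF okM aopen_points[OF okM], rotated]) simp
  then show ?thesis by (simp add: Cinf_iff[OF okM])
qed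

lemma gen_base: "gen (b, 0) = pull M E (\<lambda>x. if x \<in> points M then y x \<bullet> b else 0)"
  by (auto simp: gen_def pull_def[OF vb] coords_def inner_prod_def dual_points[OF vb])

lemma gen_fibre: "gen (0, axis i 1) = Phi M E (e i)"
  by (auto simp: gen_def coords_def inner_prod_def inner_axis Phi_outside[OF vb])

text \<open>Hadamard's lemma around \<open>coords q\<close>, multiplied by \<open>h\<close>, is an
  identity of global functions to which \<open>D\<close> applies. In each product one factor
  vanishes at \<open>q\<close>, so only the first-order coefficient remains. The functions
  \<open>G c\<close> depend on \<open>q\<close>, but their values at \<open>coords q\<close> are
  partial derivatives; hence each coefficient is one smooth function serving all points over
  \<open>core\<close>.\<close>

lemma derivation_expand:
  assumes C: "orthobasis C" and F: "F \<in> Cinf N" and q: "q \<in> points N" "fst q \<in> core"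
    and D: "point_derivation N q D"
  shows "D F = (\<Sum>c\<in>C. ext (\<lambda>p. frechet_derivative (rep F) (at p) c) q * D (gen c))"
proof -
  let ?f = "rep F" and ?one = "\<lambda>c q. if q \<in> points N then c else (0::real)"
  have pl: "fst q \<in> plateau" using q core_subset by auto
  obtain G where G: "\<And>c. smooth_on tube (G c)"
    "\<And>z. z \<in> tube \<Longrightarrow> ?f z = ?f (coords q) + (\<Sum>c\<in>C. ((z - coords q) \<bullet> c) * G c z)"
    "\<And>c. G c (coords q) = frechet_derivative ?f (at (coords q)) c"
    by (rule hadamard[OF C tube(1,2) coords_in_tube[OF q(1) pl] local_rep_smooth_tube[OF F]]) blast
  have const: "?one c \<in> Cinf N" for c by (rule Cinf_const[OF okN])
  have id: "(\<lambda>p. pull M E h p * (F p - ?one (F q) p)) =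
      (\<lambda>p. \<Sum>c\<in>C. (gen c p - ?one (gen c q) p) * ext (G c) p)"
  proof
    fix p
    consider "p \<notin> points N" | "p \<in> points N" "fst p \<notin> plateau" | "p \<in> points N" "fst p \<in> plateau" by blast
    then show "pull M E h p * (F p - ?one (F q) p) = (\<Sum>c\<in>C. (gen c p - ?one (gen c q) p) * ext (G c) p)"
    proof cases
      case 3
      have "F p - F q = (\<Sum>c\<in>C. ((coords p - coords q) \<bullet> c) * G c (coords p))"
        using G(2)[OF coords_in_tube[OF 3]] unfolding local_rep_coords[OF 3] local_rep_coords[OF q(1) pl] by simp
      then have "h (fst p) * (F p - F q) = (\<Sum>c\<in>C. ((coords p - coords q) \<bullet> c) * (h (fst p) * G c (coords p)))"
        by (simp add: sum_distrib_left mult_ac)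
      then show ?thesis
        using 3 q(1) by (simp add: pull_def[OF vb] gen_def ext_def inner_diff_left)
    qed (auto simp: pull_def[OF vb] ext_def h_outside)
  qed
  have "D (\<lambda>p. pull M E h p * (F p - ?one (F q) p)) = D F"
  proof -
    have "D (\<lambda>p. pull M E h p * (F p - ?one (F q) p)) =
      D (pull M E h) * (F q - ?one (F q) q) + pull M E h q * D (\<lambda>p. F p - ?one (F q) p)"
      by (rule derivation_mult[OF okN D pull_Cinf[OF vb h_Cinf] Cinf_diff[OF okN F const]])
    also have "\<dots> = D F"
      using q h_core by (simp add: derivation_diff[OF okN D F const] derivation_const[OF okN D q(1)] pull_def[OF vb])
    finally show ?thesis .
  qed
  moreover have "D (\<lambda>p. \<Sum>c\<in>C. (gen c p - ?one (gen c q) p) * ext (G c) p) =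
      (\<Sum>c\<in>C. ext (\<lambda>p. frechet_derivative ?f (at p) c) q * D (gen c))"
  proof -
    have "D (\<lambda>p. (gen c p - ?one (gen c q) p) * ext (G c) p) =
        ext (\<lambda>p. frechet_derivative ?f (at p) c) q * D (gen c)" for c
    proof -
      have "D (\<lambda>p. (gen c p - ?one (gen c q) p) * ext (G c) p) =
        D (\<lambda>p. gen c p - ?one (gen c q) p) * ext (G c) q + (gen c q - ?one (gen c q) q) * D (ext (G c))"
        by (rule derivation_mult[OF okN D Cinf_diff[OF okN gen_Cinf const] ext_Cinf[OF G(1)]])
      also have "\<dots> = D (gen c) * ext (G c) q"
        using q(1) by (simp add: derivation_diff[OF okN D gen_Cinf const] derivation_const[OF okN D q(1)])
      also have "ext (G c) q = ext (\<lambda>p. frechet_derivative ?f (at p) c) q"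
        by (simp add: ext_def G(3))
      finally show ?thesis by (simp add: mult.commute)
    qed
    then show ?thesis
      by (subst derivation_sum[OF okN D orthobasis_finite[OF C]])
        (auto intro!: Cinf_mult[OF okN] Cinf_diff[OF okN] gen_Cinf const ext_Cinf G(1))
  qed
  ultimately show ?thesis using id by simp
qed

text \<open>The partial derivative along the fibre in the coordinates of \<open>dual_chart\<close>.
  It kills functions pulled back from the base and extracts the components of a section from its
  function \<open>Phi\<close>.\<close>

definition vertical :: "'k \<Rightarrow> 'm \<times> ('e \<Rightarrow> real) \<Rightarrow> ('m \<times> ('e \<Rightarrow> real) \<Rightarrow> real) \<Rightarrow> real" where
  "vertical i q F = frechet_derivative (rep F) (at (coords q)) (0, axis i 1)"

lemma vertical_eq:
  "(rep F has_derivative F') (at (coords q)) \<Longrightarrow> vertical i q F = F' (0, axis i 1)"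
  using frechet_derivative_at[of "rep F" F' "coords q"] by (simp add: vertical_def)

lemma vertical_derivation:
  assumes q: "q \<in> points N" "fst q \<in> plateau"
  shows "point_derivation N q (vertical i q)"
proof -
  have d: "(rep F has_derivative frechet_derivative (rep F) (at (coords q))) (at (coords q))"
    if "F \<in> Cinf N" for F
    by (rule smooth_on_has_derivative[OF local_rep_smooth_tube[OF that] coords_in_tube[OF q]])
  have r: "rep (\<lambda>q. F q + G q) = (\<lambda>p. rep F p + rep G p)"
    "rep (\<lambda>q. F q * G q) = (\<lambda>p. rep F p * rep G p)"
    "rep (\<lambda>q. c * F q) = (\<lambda>p. c * rep F p)" for F G :: "_ \<Rightarrow> real" and c :: real
    by (auto simp: local_rep_def)
  have "vertical i q (\<lambda>q. F q + G q) = vertical i q F + vertical i q G" if "F \<in> Cinf N" "G \<in> Cinf N" for F G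
    by (subst vertical_eq[of "\<lambda>q. F q + G q", unfolded r(1), OF has_derivative_add[OF d d]])
      (simp_all add: that vertical_def)
  moreover have "vertical i q (\<lambda>q. c * F q) = c * vertical i q F" if "F \<in> Cinf N" for F c
  proof -
    have "(rep (\<lambda>q. c * F q) has_derivative
        (\<lambda>v. c * frechet_derivative (rep F) (at (coords q)) v)) (at (coords q))"
      unfolding r(3) by (rule has_derivative_mult_right[OF d[OF that]])
    then show ?thesis using vertical_eq by (fastforce simp: vertical_def)
  qed
  moreover have "vertical i q (\<lambda>q. F q * G q) = vertical i q F * G q + F q * vertical i q G"
    if "F \<in> Cinf N" "G \<in> Cinf N" for F G
    by (subst vertical_eq[of "\<lambda>q. F q * G q", unfolded r(2), OF has_derivative_mult[OF d d]])
      (simp_all add: that vertical_def local_rep_coords[OF q])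
  ultimately show ?thesis by (simp add: point_derivation_def)
qed

lemma section_rep_derivative:
  assumes X: "X \<in> sections M E" and z: "z \<in> ball a r"
  shows "\<exists>g'. ((\<lambda>z. snd (\<psi> (X (inv_into V \<phi> z)))) has_derivative g') (at z)"
proof -
  have "smooth_on (ball a r) (\<lambda>z. snd (\<psi> (X (inv_into V \<phi> z))))"
    by (rule smooth_on_subset[OF csmoothD[OF section_csmooth[OF vb t X] V] sub])
  from smooth_on_has_derivative[OF this z] show ?thesis by blast
qed

text \<open>In coordinates the function is the inner product of the fibre variable with the
  components of \<open>X\<close>, and these are constant along vertical directions.\<close>

lemma vertical_Phi:
  assumes q: "q \<in> points N" "fst q \<in> plateau" and X: "X \<in> sections M E"
  shows "vertical i q (Phi M E X) = snd (\<psi> (X (fst q))) $ i"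
proof -
  let ?g = "\<lambda>z. snd (\<psi> (X (inv_into V \<phi> z)))"
  have c: "fst (coords q) = \<phi> (fst q)" by (rule covec_coords(2)[OF q])
  have "fst (coords q) \<in> ball a r" using c q(2) by (simp add: plateau_def)
  then obtain g' where g': "(?g has_derivative g') (at (fst (coords q)))"
    using section_rep_derivative[OF X] by blast
  have "((\<lambda>p. ?g (fst p)) has_derivative (\<lambda>d. g' (fst d))) (at (coords q))"
    by (rule has_derivative_compose[OF bounded_linear_imp_has_derivative[OF bounded_linear_fst] g'])
  then have "((\<lambda>p. snd p \<bullet> ?g (fst p)) has_derivative
      (\<lambda>d. snd (coords q) \<bullet> g' (fst d) + snd d \<bullet> ?g (fst (coords q)))) (at (coords q))"
    by (intro has_derivative_inner) (auto intro!: derivative_eq_intros)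
  then have "(rep (Phi M E X) has_derivative
      (\<lambda>d. snd (coords q) \<bullet> g' (fst d) + snd d \<bullet> ?g (fst (coords q)))) (at (coords q))"
    by (rule has_derivative_transform_within_open[OF _ tube(1) coords_in_tube[OF q]])
      (use Phi_local_rep[OF vb t V X] tube(3) in force)
  then have "vertical i q (Phi M E X) = axis i 1 \<bullet> ?g (\<phi> (fst q))"
    using vertical_eq linear_0[OF has_derivative_linear[OF g']] c by fastforce
  then show ?thesis using q(2) inv_chart[of "fst q"] by (simp add: plateau_def inner_axis')
qed

lemma vertical_pull:
  assumes q: "q \<in> points N" "fst q \<in> plateau" and f: "f \<in> Cinf M"
  shows "vertical i q (pull M E f) = 0"
proof -
  let ?g = "\<lambda>z. f (inv_into V \<phi> z)"
  have c: "fst (coords q) = \<phi> (fst q)" by (rule covec_coords(2)[OF q])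
  have "smooth_on (ball a r) ?g"
    using smooth_on_subset[OF csmoothD[OF Cinf_imp_csmooth[OF okM f aopen_subset[OF triv_aopen[OF vb t]]] V] sub] .
  from smooth_on_has_derivative[OF this, of "fst (coords q)"]
  obtain g' where g': "(?g has_derivative g') (at (fst (coords q)))"
    using c q(2) by (auto simp: plateau_def)
  have "((\<lambda>p. ?g (fst p)) has_derivative (\<lambda>d. g' (fst d))) (at (coords q))"
    by (rule has_derivative_compose[OF bounded_linear_imp_has_derivative[OF bounded_linear_fst] g'])
  then have "(rep (pull M E f) has_derivative (\<lambda>d. g' (fst d))) (at (coords q))"
  proof (rule has_derivative_transform_within_open[OF _ tube(1) coords_in_tube[OF q]])
    fix p assume "p \<in> tube"
    then obtain x v where x: "p = (\<phi> x, v)" "x \<in> U" "x \<in> V" using tube(3) by auto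
    then have "(x, covec E \<psi> x v) \<in> points N"
      using covec_in_dual[OF vb t] triv_in_points[OF vb t] by (simp add: dual_points[OF vb])
    then show "?g (fst p) = rep (pull M E f) p"
      by (simp add: x local_rep_def inv_chart pull_def[OF vb])
  qed
  then show ?thesis using vertical_eq linear_0[OF has_derivative_linear[OF g']] by fastforce
qed

text \<open>The pullback of \<open>F\<close> along the local section
  \<open>\<lambda>x. covec E \<psi> x w\<close> of the dual bundle, made global by the factor
  \<open>h\<close>.\<close>

definition along :: "real^'k \<Rightarrow> ('m \<times> ('e \<Rightarrow> real) \<Rightarrow> real) \<Rightarrow> 'm \<Rightarrow> real" where
  "along w F = (\<lambda>x. if x \<in> plateau then h x * F (x, covec E \<psi> x w) else 0)"

lemma along_Cinf:
  assumes F: "F \<in> Cinf N"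
  shows "along w F \<in> Cinf M"
  unfolding along_def
proof (rule cut_Cinf)
  have sm: "smooth_on (ball a r) (\<lambda>z. rep F (z, w))"
  proof -
    obtain C :: "('v \<times> (real^'k)) set" where C: "orthobasis C" using ex_orthobasis_tube by blast
    have "smooth_on (ball a r) (\<lambda>z. (z, w))"
      by (intro smooth_on_Pair smooth_on_const smooth_on_bounded_linear bounded_linear_ident open_ball)
    then show ?thesis
      by (rule smooth_on_compose[OF C open_ball _ _ local_rep_smooth_tube[OF F]]) (auto simp: tube_def)
  qed
  have "csmooth M plateau (\<lambda>x. rep F (\<phi> x, w))"
    by (rule csmooth_chart_compose[OF base_manifold[OF vb] V aopen_plateau _ _ sm]) (auto simp: plateau_def)
  then show "csmooth M plateau (\<lambda>x. F (x, covec E \<psi> x w))"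
    by (rule csmooth_cong[OF okM aopen_plateau, rotated]) (simp add: local_rep_def plateau_def inv_chart)
qed

text \<open>The lift of a derivation \<open>d\<close> at \<open>x\<close> along the local section \<open>x' \<mapsto> covec E \<psi> x' w\<close> of the dual
  bundle. The second term corrects for the cutoff, which makes the locality of \<open>d\<close> unnecessary.\<close>

definition lift :: "(('m \<Rightarrow> real) \<Rightarrow> real) \<Rightarrow> 'm \<Rightarrow> real^'k \<Rightarrow> ('m \<times> ('e \<Rightarrow> real) \<Rightarrow> real) \<Rightarrow> real" where
  "lift d x w F = d (along w F) - F (x, covec E \<psi> x w) * d h"

context
  fixes x d and w :: "real^'k"
  assumes x: "x \<in> core" and d: "point_derivation M x d"
begin

lemma lift_derivation: "point_derivation N (x, covec E \<psi> x w) (lift d x w)"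
proof -
  let ?q = "(x, covec E \<psi> x w)"
  have pl: "x \<in> plateau" using x core_subset by auto
  have at: "along w F x = F ?q" for F using pl h_core[OF x] by (simp add: along_def)
  have "lift d x w (\<lambda>q. F q + G q) = lift d x w F + lift d x w G" if "F \<in> Cinf N" "G \<in> Cinf N" for F G
  proof -
    have "along w (\<lambda>q. F q + G q) = (\<lambda>x. along w F x + along w G x)"
      by (auto simp: along_def algebra_simps)
    then show ?thesis
      using derivation_add[OF okM d along_Cinf[OF that(1)] along_Cinf[OF that(2)]]
      by (simp add: lift_def algebra_simps)
  qed
  moreover have "lift d x w (\<lambda>q. c * F q) = c * lift d x w F" if "F \<in> Cinf N" for F c
  proof -
    have "along w (\<lambda>q. c * F q) = (\<lambda>x. c * along w F x)" by (auto simp: along_def)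
    then show ?thesis
      using derivation_scale[OF okM d along_Cinf[OF that]] by (simp add: lift_def algebra_simps)
  qed
  moreover have "lift d x w (\<lambda>q. F q * G q) = lift d x w F * G ?q + F ?q * lift d x w G"
    if F: "F \<in> Cinf N" and G: "G \<in> Cinf N" for F G
  proof -
    \<comment> \<open>The product of two cut-off pullbacks carries \<open>h\<close> twice, hence the
      additional factor on the left. The resulting \<open>d h\<close> term is absorbed by the
      corrections in \<open>lift\<close>.\<close>
    have "(\<lambda>x. h x * along w (\<lambda>q. F q * G q) x) = (\<lambda>x. along w F x * along w G x)"
      by (auto simp: along_def)
    then have "d h * (F ?q * G ?q) + d (along w (\<lambda>q. F q * G q)) =
        d (along w F) * G ?q + F ?q * d (along w G)"
      using derivation_mult[OF okM d h_Cinf along_Cinf[OF Cinf_mult[OF okN F G], of w]]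
        derivation_mult[OF okM d along_Cinf[OF F, of w] along_Cinf[OF G, of w]] h_core[OF x]
      by (simp add: at)
    then show ?thesis by (simp add: lift_def algebra_simps)
  qed
  ultimately show ?thesis by (simp add: point_derivation_def)
qed

lemma lift_pull:
  assumes f: "f \<in> Cinf M"
  shows "lift d x w (pull M E f) = d f"
proof -
  have pl: "x \<in> plateau" using x core_subset by auto
  have "along w (pull M E f) = (\<lambda>x. h x * f x)"
    using coords_covec(1) h_outside by (auto simp: along_def pull_def[OF vb])
  then show ?thesis
    using derivation_mult[OF okM d h_Cinf f] h_core[OF x] coords_covec(1)[OF pl]
    by (simp add: lift_def pull_def[OF vb])
qed

end

definition component :: "('m \<Rightarrow> 'e) \<Rightarrow> 'k \<Rightarrow> 'm \<Rightarrow> real" where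
  "component X i = (\<lambda>x. if x \<in> plateau then h x * snd (\<psi> (X x)) $ i else 0)"

lemma component_Cinf:
  assumes X: "X \<in> sections M E"
  shows "component X i \<in> Cinf M"
  unfolding component_def
proof (rule cut_Cinf)
  have "csmooth M plateau (\<lambda>x. snd (\<psi> (X x)))"
    using plateau_subset(1) by (intro csmooth_subset[OF section_csmooth[OF vb t X]]) auto
  from csmooth_linear[OF okM bounded_linear_vec_nth aopen_plateau this]
  show "csmooth M plateau (\<lambda>x. snd (\<psi> (X x)) $ i)" .
qed

lemma Phi_covec:
  assumes X: "X \<in> sections M E" and x: "x \<in> plateau"
  shows "Phi M E X (x, covec E \<psi> x w) = w \<bullet> snd (\<psi> (X x))"
  using coords_covec(1)[OF x, of w] section_in_fibre[OF vb X] plateau_subset(2) x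
  by (auto simp: Phi_eq[OF vb] covec_def)

lemma along_Phi:
  "X \<in> sections M E \<Longrightarrow> along w (Phi M E X) = (\<lambda>x. \<Sum>i\<in>UNIV. w $ i * component X i x)"
  by (auto simp: along_def component_def Phi_covec inner_vec_def sum_distrib_left mult_ac)

lemma Phi_frame:
  assumes q: "q \<in> points N" "fst q \<in> plateau"
  shows "Phi M E (e i) q = snd (coords q) $ i"
  by (simp add: coords_def)

text \<open>The expansion of \<open>h\<close> times \<open>X\<close> in the frame \<open>e\<close>,
  seen through \<open>Phi\<close>. It holds on the whole dual bundle because both sides vanish away
  from \<open>plateau\<close>.\<close>

lemma frame_decomposition:
  assumes X: "X \<in> sections M E"
  shows "h (fst q) * Phi M E X q = (\<Sum>i\<in>UNIV. component X i (fst q) * Phi M E (e i) q)"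
proof (cases "q \<in> points N \<and> fst q \<in> plateau")
  case True
  then have "Phi M E X q = snd (coords q) \<bullet> snd (\<psi> (X (fst q)))"
    using Phi_covec[OF X, of "fst q"] covec_coords(1)[of q] by metis
  then show ?thesis
    using True by (simp add: component_def Phi_frame inner_vec_def sum_distrib_left mult_ac)
next
  case False
  then show ?thesis
    by (auto simp: Phi_outside[OF vb] component_def h_outside)
qed

end

section \<open>Poisson structures from generators\<close>

text \<open>Differentials enter only through point derivations: \<open>generates\<close> says that near each point \<open>dF\<close>
  is a combination of differentials of elements of \<open>A\<close>, and \<open>B_tensorial\<close> that \<open>B u v q\<close> depends on
  \<open>u\<close> only through \<open>du\<close> at \<open>q\<close>.\<close>

locale poisson_generators =
  fixes N :: "('n, 'v::real_inner) atlas" and A :: "('n \<Rightarrow> real) set"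
    and B :: "('n \<Rightarrow> real) \<Rightarrow> ('n \<Rightarrow> real) \<Rightarrow> 'n \<Rightarrow> real"
  assumes ok: "atlas_ok N" and A_Cinf: "A \<subseteq> Cinf N" and A_zero: "(\<lambda>_. 0) \<in> A"
    and A_add: "\<And>u v. u \<in> A \<Longrightarrow> v \<in> A \<Longrightarrow> (\<lambda>x. u x + v x) \<in> A"
    and A_scale: "\<And>c u. u \<in> A \<Longrightarrow> (\<lambda>x. c * u x) \<in> A"
    and B_in: "\<And>u v. u \<in> A \<Longrightarrow> v \<in> A \<Longrightarrow> B u v \<in> A"
    and B_add: "\<And>u v w x. u \<in> A \<Longrightarrow> v \<in> A \<Longrightarrow> w \<in> A \<Longrightarrow> B (\<lambda>x. u x + v x) w x = B u w x + B v w x"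
    and B_scale: "\<And>c u v x. u \<in> A \<Longrightarrow> v \<in> A \<Longrightarrow> B (\<lambda>x. c * u x) v x = c * B u v x"
    and B_anti: "\<And>u v x. u \<in> A \<Longrightarrow> v \<in> A \<Longrightarrow> B u v x = - B v u x"
    and B_jacobi: "\<And>u v w x. u \<in> A \<Longrightarrow> v \<in> A \<Longrightarrow> w \<in> A \<Longrightarrow>
      B u (B v w) x + B v (B w u) x + B w (B u v) x = 0"
    and generates: "\<And>F p. F \<in> Cinf N \<Longrightarrow> p \<in> points N \<Longrightarrow>
      \<exists>W n c u. aopen N W \<and> p \<in> W \<and> (\<forall>i<n::nat. c i \<in> Cinf N \<and> u i \<in> A) \<and>
        (\<forall>q\<in>W. \<forall>D. point_derivation N q D \<longrightarrow> D F = (\<Sum>i<n. c i q * D (u i)))"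
    and B_tensorial: "\<And>u v q. u \<in> A \<Longrightarrow> v \<in> A \<Longrightarrow> q \<in> points N \<Longrightarrow>
      (\<And>D. point_derivation N q D \<Longrightarrow> D u = 0) \<Longrightarrow> B u v q = 0"
begin

text \<open>Equality of the differentials of \<open>F\<close> and \<open>u\<close> at
  \<open>q\<close>, the relation through which \<open>B\<close> is extended beyond
  \<open>A\<close>.\<close>

definition agree :: "'n \<Rightarrow> ('n \<Rightarrow> real) \<Rightarrow> ('n \<Rightarrow> real) \<Rightarrow> bool" where
  "agree q F u \<longleftrightarrow> (\<forall>D. point_derivation N q D \<longrightarrow> D F = D u)"

lemma agreeD: "agree q F u \<Longrightarrow> point_derivation N q D \<Longrightarrow> D F = D u"
  by (simp add: agree_def)

lemma A_in_Cinf: "u \<in> A \<Longrightarrow> u \<in> Cinf N"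
  using A_Cinf by blast

lemma A_sum: "(\<And>i. i < n \<Longrightarrow> u i \<in> A) \<Longrightarrow> (\<lambda>x. \<Sum>i<n::nat. c i * u i x) \<in> A"
proof (induction n)
  case (Suc n)
  then show ?case using A_add[OF Suc.IH A_scale[of "u n" "c n"]] by simp
qed (simp add: A_zero)

lemma B_sum:
  assumes "\<And>i. i < n \<Longrightarrow> u i \<in> A" "v \<in> A"
  shows "B (\<lambda>x. \<Sum>i<n::nat. c i * u i x) v x = (\<Sum>i<n. c i * B (u i) v x)"
  using assms
proof (induction n)
  case 0
  show ?case using B_scale[OF A_zero 0(2), of 0] by simp
next
  case (Suc n)
  then show ?case using B_add[OF A_sum[of n u c] A_scale[of "u n" "c n"] Suc.prems(2)]
    by (simp add: B_scale)
qed

lemma B_sum_right: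
  assumes "\<And>i. i < n \<Longrightarrow> u i \<in> A" "v \<in> A"
  shows "B v (\<lambda>x. \<Sum>i<n::nat. c i * u i x) x = (\<Sum>i<n. c i * B v (u i) x)"
proof -
  have "B v (\<lambda>x. \<Sum>i<n. c i * u i x) x = - B (\<lambda>x. \<Sum>i<n. c i * u i x) v x"
    by (rule B_anti[OF assms(2) A_sum[OF assms(1)]])
  also have "\<dots> = - (\<Sum>i<n. c i * B (u i) v x)" by (simp only: B_sum[OF assms])
  also have "\<dots> = (\<Sum>i<n. c i * - B (u i) v x)" by (simp add: sum_negf)
  also have "\<dots> = (\<Sum>i<n. c i * B v (u i) x)"
  proof (rule sum.cong[OF refl])
    fix i assume "i \<in> {..<n}"
    then show "c i * - B (u i) v x = c i * B v (u i) x"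
      using B_anti[OF assms(2) assms(1)[of i], of x] by (metis lessThan_iff)
  qed
  finally show ?thesis .
qed

text \<open>In the left argument this is tensoriality applied to the difference of \<open>u\<close>
  and \<open>u'\<close>; antisymmetry carries it to the right argument.\<close>

lemma B_agree:
  assumes "u \<in> A" "u' \<in> A" "v \<in> A" "v' \<in> A" "q \<in> points N"
    and "agree q F u" "agree q F u'" "agree q G v" "agree q G v'"
  shows "B u v q = B u' v' q"
proof -
  have left: "B u v q = B u' v q"
    if "u \<in> A" "u' \<in> A" "v \<in> A" "agree q F u" "agree q F u'" for u u' v F
  proof -
    have "B (\<lambda>x. u x + (-1) * u' x) v q = 0"
    proof (rule B_tensorial[OF A_add[OF that(1) A_scale[OF that(2)]] that(3) assms(5)])
      fix D assume D: "point_derivation N q D"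
      have "D (\<lambda>x. u x - u' x) = D u - D u'"
        by (rule derivation_diff[OF ok D A_in_Cinf[OF that(1)] A_in_Cinf[OF that(2)]])
      moreover have "D u = D u'" using that(4,5) D unfolding agree_def by metis
      ultimately show "D (\<lambda>x. u x + (-1) * u' x) = 0" by simp
    qed
    then show ?thesis
      using B_add[OF that(1) A_scale[OF that(2)] that(3), of "-1"] B_scale[OF that(2,3), of "-1"] by simp
  qed
  show ?thesis
    using left[OF assms(1-3,6,7)] left[OF assms(3,4,2,8,9)] B_anti[of u' v] B_anti[of u' v'] assms by simp
qed

lemma agree_sum:
  assumes u: "\<And>i. i < n \<Longrightarrow> u i \<in> A"
    and F: "\<And>D. point_derivation N q D \<Longrightarrow> D F = (\<Sum>i<n::nat. c i * D (u i))"
  shows "agree q F (\<lambda>x. \<Sum>i<n. c i * u i x)"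
  unfolding agree_def
proof (intro allI impI)
  fix D assume D: "point_derivation N q D"
  show "D F = D (\<lambda>x. \<Sum>i<n. c i * u i x)"
    using u A_in_Cinf F[OF D]
    by (subst derivation_sum[OF ok D]) (auto simp: derivation_scale[OF ok D] Cinf_scale[OF ok])
qed

lemma ex_agree:
  assumes "F \<in> Cinf N" "q \<in> points N"
  obtains u where "u \<in> A" "agree q F u"
proof -
  obtain W n c u where W: "q \<in> W" "\<forall>i<n::nat. c i \<in> Cinf N \<and> u i \<in> A"
    "\<forall>q\<in>W. \<forall>D. point_derivation N q D \<longrightarrow> D F = (\<Sum>i<n. c i q * D (u i))"
    using generates[OF assms] by blast
  \<comment> \<open>Freezing the coefficient functions at \<open>q\<close> gives a combination with
    real coefficients, under which \<open>A\<close> is closed. It still has the differential of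
    \<open>F\<close> at this one point.\<close>
  then have "agree q F (\<lambda>x. \<Sum>i<n. c i q * u i x)" by (intro agree_sum) auto
  then show ?thesis by (rule that[rotated]) (use W(2) in \<open>auto intro: A_sum\<close>)
qed

text \<open>The description is unique by \<open>B_agree\<close>, and a suitable \<open>u\<close> and
  \<open>v\<close> exist by \<open>ex_agree\<close>. The value 0 off the manifold follows the
  convention of \<open>Cinf\<close>.\<close>

definition bracket :: "('n \<Rightarrow> real) \<Rightarrow> ('n \<Rightarrow> real) \<Rightarrow> 'n \<Rightarrow> real" where
  "bracket F G q = (if q \<in> points N
     then THE s. \<exists>u\<in>A. \<exists>v\<in>A. agree q F u \<and> agree q G v \<and> s = B u v q else 0)"

lemma bracket_eq:
  assumes "q \<in> points N" "u \<in> A" "v \<in> A" "agree q F u" "agree q G v"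
  shows "bracket F G q = B u v q"
proof -
  have "(THE s. \<exists>u\<in>A. \<exists>v\<in>A. agree q F u \<and> agree q G v \<and> s = B u v q) = B u v q"
    using assms B_agree[of _ u _ v q F G] by (intro the_equality) blast+
  then show ?thesis using assms(1) by (simp add: bracket_def)
qed

lemma agree_refl: "agree q F F"
  by (simp add: agree_def)

lemma bracket_A: "u \<in> A \<Longrightarrow> v \<in> A \<Longrightarrow> bracket u v = B u v"
proof
  fix q assume uv: "u \<in> A" "v \<in> A"
  show "bracket u v q = B u v q"
  proof (cases "q \<in> points N")
    case False
    then show ?thesis using Cinf_outside[OF ok A_in_Cinf[OF B_in[OF uv]]] by (simp add: bracket_def)
  qed (use uv bracket_eq agree_refl in blast)
qed

lemma bracket_anti:
  assumes "F \<in> Cinf N" "G \<in> Cinf N"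
  shows "bracket F G q = - bracket G F q"
proof (cases "q \<in> points N")
  case True
  obtain u where u: "u \<in> A" "agree q F u" using ex_agree[OF assms(1) True] .
  obtain v where v: "v \<in> A" "agree q G v" using ex_agree[OF assms(2) True] .
  show ?thesis
    using bracket_eq[OF True u(1) v(1) u(2) v(2)] bracket_eq[OF True v(1) u(1) v(2) u(2)] B_anti[OF u(1) v(1)]
    by simp
qed (simp add: bracket_def)

lemma bracket_Cinf:
  assumes F: "F \<in> Cinf N" and G: "G \<in> Cinf N"
  shows "bracket F G \<in> Cinf N"
proof (rule Cinf_localI[OF ok])
  fix p assume p: "p \<in> points N"
  obtain W n c u where W: "aopen N W" "p \<in> W" "\<forall>i<n::nat. c i \<in> Cinf N \<and> u i \<in> A"
    "\<forall>q\<in>W. \<forall>D. point_derivation N q D \<longrightarrow> D F = (\<Sum>i<n. c i q * D (u i))"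
    using generates[OF F p] by blast
  obtain T m d v where T: "aopen N T" "p \<in> T" "\<forall>i<m::nat. d i \<in> Cinf N \<and> v i \<in> A"
    "\<forall>q\<in>T. \<forall>D. point_derivation N q D \<longrightarrow> D G = (\<Sum>i<m. d i q * D (v i))"
    using generates[OF G p] by blast
  let ?g = "\<lambda>q. \<Sum>i<n. \<Sum>j<m. c i q * d j q * B (u i) (v j) q"
  have "?g \<in> Cinf N"
    using W(3) T(3) A_in_Cinf B_in by (intro Cinf_sum[OF ok] Cinf_mult[OF ok]) auto
  moreover have "bracket F G q = ?g q" if q: "q \<in> W \<inter> T" for q
  proof -
    have qN: "q \<in> points N" using q aopen_subset[OF W(1)] by auto
    let ?u = "\<lambda>x. \<Sum>i<n. c i q * u i x" and ?v = "\<lambda>x. \<Sum>i<m. d i q * v i x"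
    have u: "?u \<in> A" and v: "?v \<in> A" using W(3) T(3) by (auto intro: A_sum)
    have "agree q F ?u" "agree q G ?v" using W(3,4) T(3,4) q by (auto intro!: agree_sum)
    then have "bracket F G q = B ?u ?v q" by (rule bracket_eq[OF qN u v])
    also have "\<dots> = (\<Sum>i<n. c i q * B (u i) ?v q)" using W(3) v by (intro B_sum) auto
    also have "\<dots> = (\<Sum>i<n. c i q * (\<Sum>j<m. d j q * B (u i) (v j) q))"
      using W(3) T(3) by (intro sum.cong refl arg_cong2[of _ _ _ _ "(*)"] B_sum_right) auto
    also have "\<dots> = ?g q" by (simp add: sum_distrib_left mult.assoc)
    finally show ?thesis .
  qed
  ultimately show "\<exists>W g. aopen N W \<and> p \<in> W \<and> csmooth N W g \<and> (\<forall>y\<in>W. bracket F G y = g y)"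
    using W T aopen_Int[OF ok W(1) T(1)] Cinf_imp_csmooth[OF ok, of ?g "W \<inter> T"] aopen_subset[OF W(1)] le_infI1[of W "points N" T]
    by (intro exI[of _ "W \<inter> T"] exI[of _ ?g]) auto
qed (simp add: bracket_def)

lemma agree_add:
  assumes "F \<in> Cinf N" "G \<in> Cinf N" "u \<in> A" "v \<in> A" "agree q F u" "agree q G v"
  shows "agree q (\<lambda>x. F x + G x) (\<lambda>x. u x + v x)"
  unfolding agree_def
proof (intro allI impI)
  fix D assume D: "point_derivation N q D"
  then have "D F = D u" "D G = D v" using assms(5,6) by (auto simp: agree_def)
  then show "D (\<lambda>x. F x + G x) = D (\<lambda>x. u x + v x)"
    using assms A_in_Cinf by (simp add: derivation_add[OF ok D])
qed

lemma agree_scale: "F \<in> Cinf N \<Longrightarrow> u \<in> A \<Longrightarrow> agree q F u \<Longrightarrow> agree q (\<lambda>x. c * F x) (\<lambda>x. c * u x)"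
  using A_in_Cinf unfolding agree_def by (simp add: derivation_scale[OF ok])

text \<open>The product rule for differentials, with the values of \<open>F\<close> and
  \<open>G\<close> frozen at \<open>q\<close> so that the right side stays in
  \<open>A\<close>.\<close>

lemma agree_mult:
  assumes "F \<in> Cinf N" "G \<in> Cinf N" "u \<in> A" "v \<in> A" "agree q F u" "agree q G v"
  shows "agree q (\<lambda>x. F x * G x) (\<lambda>x. G q * u x + F q * v x)"
  unfolding agree_def
proof (intro allI impI)
  fix D assume D: "point_derivation N q D"
  then have "D F = D u" "D G = D v" using assms(5,6) by (auto simp: agree_def)
  then show "D (\<lambda>x. F x * G x) = D (\<lambda>x. G q * u x + F q * v x)"
    using assms A_in_Cinf
    by (simp add: derivation_mult[OF ok D] derivation_add[OF ok D] derivation_scale[OF ok D] Cinf_scale[OF ok])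
qed

lemma bracket_derivation_left:
  assumes q: "q \<in> points N" and G: "G \<in> Cinf N"
  shows "point_derivation N q (\<lambda>F. bracket F G q)"
  unfolding point_derivation_def
proof (intro conjI ballI allI)
  obtain v where v: "v \<in> A" "agree q G v" using ex_agree[OF G q] .
  note eq = bracket_eq[OF q _ v(1) _ v(2)]
  fix F assume F: "F \<in> Cinf N"
  obtain u where u: "u \<in> A" "agree q F u" using ex_agree[OF F q] .
  show "bracket (\<lambda>x. c * F x) G q = c * bracket F G q" for c
    using eq[OF A_scale agree_scale] eq u F B_scale v by simp
  fix H assume H: "H \<in> Cinf N"
  obtain w where w: "w \<in> A" "agree q H w" using ex_agree[OF H q] .
  show "bracket (\<lambda>x. F x + H x) G q = bracket F G q + bracket H G q"
    using eq[OF A_add agree_add] eq u w F H B_add v by simp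
  have "bracket (\<lambda>x. F x * H x) G q = B (\<lambda>x. H q * u x + F q * w x) v q"
    by (intro eq A_add A_scale agree_mult u w F H)
  then show "bracket (\<lambda>x. F x * H x) G q = bracket F G q * H q + F q * bracket H G q"
    using eq u w B_add[OF A_scale A_scale] B_scale v by simp
qed

lemma bracket_derivation:
  assumes q: "q \<in> points N" and F: "F \<in> Cinf N"
  shows "point_derivation N q (\<lambda>G. bracket F G q)"
proof -
  note l = bracket_derivation_left[OF q F]
  show "point_derivation N q (\<lambda>G. bracket F G q)"
    unfolding point_derivation_def
    using derivation_add[OF ok l] derivation_scale[OF ok l] derivation_mult[OF ok l]
      bracket_anti[OF F] F Cinf_add[OF ok] Cinf_mult[OF ok] Cinf_scale[OF ok]
    by (simp add: algebra_simps)
qed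

lemma bracket_leibniz:
  assumes "F \<in> Cinf N" "G \<in> Cinf N" "H \<in> Cinf N"
  shows "bracket F (\<lambda>x. G x * H x) = (\<lambda>x. bracket F G x * H x + G x * bracket F H x)"
proof
  fix q
  show "bracket F (\<lambda>x. G x * H x) q = bracket F G q * H q + G q * bracket F H q"
    using derivation_mult[OF ok bracket_derivation[OF _ assms(1)] assms(2,3)]
    by (cases "q \<in> points N") (simp_all add: bracket_def)
qed

lemma bracket_add:
  assumes "F \<in> Cinf N" "G \<in> Cinf N" "H \<in> Cinf N"
  shows "bracket F (\<lambda>x. G x + H x) = (\<lambda>x. bracket F G x + bracket F H x)"
    and "bracket (\<lambda>x. G x + H x) F = (\<lambda>x. bracket G F x + bracket H F x)"
proof -
  show "bracket F (\<lambda>x. G x + H x) = (\<lambda>x. bracket F G x + bracket F H x)"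
  proof
    fix q
    show "bracket F (\<lambda>x. G x + H x) q = bracket F G q + bracket F H q"
      using derivation_add[OF ok bracket_derivation[OF _ assms(1)] assms(2,3)]
      by (cases "q \<in> points N") (simp_all add: bracket_def)
  qed
  then show "bracket (\<lambda>x. G x + H x) F = (\<lambda>x. bracket G F x + bracket H F x)"
    using bracket_anti[OF Cinf_add[OF ok assms(2,3)] assms(1)] bracket_anti[OF assms(2,1)]
      bracket_anti[OF assms(3,1)] by (auto simp: fun_eq_iff)
qed

lemma bracket_scale:
  assumes "F \<in> Cinf N" "G \<in> Cinf N"
  shows "bracket F (\<lambda>x. c * G x) = (\<lambda>x. c * bracket F G x)"
    and "bracket (\<lambda>x. c * G x) F = (\<lambda>x. c * bracket G F x)"
proof -
  show "bracket F (\<lambda>x. c * G x) = (\<lambda>x. c * bracket F G x)"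
  proof
    fix q
    show "bracket F (\<lambda>x. c * G x) q = c * bracket F G q"
      using derivation_scale[OF ok bracket_derivation[OF _ assms(1)] assms(2)]
      by (cases "q \<in> points N") (simp_all add: bracket_def)
  qed
  then show "bracket (\<lambda>x. c * G x) F = (\<lambda>x. c * bracket G F x)"
    using bracket_anti[OF Cinf_scale[OF ok assms(2)] assms(1)] bracket_anti[OF assms(2,1)]
    by (auto simp: fun_eq_iff)
qed

section \<open>The Jacobi identity for the extended bracket\<close>

definition jacobiator :: "('n \<Rightarrow> real) \<Rightarrow> ('n \<Rightarrow> real) \<Rightarrow> ('n \<Rightarrow> real) \<Rightarrow> 'n \<Rightarrow> real" where
  "jacobiator F G H q = bracket F (bracket G H) q + bracket G (bracket H F) q + bracket H (bracket F G) q"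

lemma jacobiator_cyclic: "jacobiator F G H q = jacobiator G H F q"
  by (simp add: jacobiator_def)

text \<open>The second order terms of the Jacobiator cancel, so it is a derivation in its last argument.\<close>

lemma jacobiator_derivation:
  assumes q: "q \<in> points N" and F: "F \<in> Cinf N" and G: "G \<in> Cinf N"
  shows "point_derivation N q (\<lambda>H. jacobiator F G H q)"
  unfolding point_derivation_def
proof (intro conjI ballI allI)
  note b = bracket_Cinf and m = Cinf_mult[OF ok]
  fix H assume H: "H \<in> Cinf N"
  show "jacobiator F G (\<lambda>x. c * H x) q = c * jacobiator F G H q" for c
    using F G H by (simp add: jacobiator_def bracket_scale b algebra_simps)
  fix K assume K: "K \<in> Cinf N"
  show "jacobiator F G (\<lambda>x. H x + K x) q = jacobiator F G H q + jacobiator F G K q"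
    using F G H K by (simp add: jacobiator_def bracket_add b)
  have left: "bracket (\<lambda>x. H x * K x) L = (\<lambda>x. bracket H L x * K x + H x * bracket K L x)"
    if L: "L \<in> Cinf N" for L
    using bracket_anti[OF m[OF H K] L] bracket_anti[OF H L] bracket_anti[OF K L] bracket_leibniz[OF L H K]
    by (auto simp: fun_eq_iff)
  have 1: "bracket F (bracket G (\<lambda>x. H x * K x)) q =
      bracket F (bracket G H) q * K q + bracket G H q * bracket F K q + bracket F H q * bracket G K q
      + H q * bracket F (bracket G K) q"
    using F G H K by (simp add: bracket_leibniz bracket_add b m)
  have 2: "bracket G (bracket (\<lambda>x. H x * K x) F) q =
      bracket G (bracket H F) q * K q + bracket H F q * bracket G K q + bracket G H q * bracket K F q
      + H q * bracket G (bracket K F) q"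
    using F G H K by (simp add: left bracket_leibniz bracket_add b m)
  have 3: "bracket (\<lambda>x. H x * K x) (bracket F G) q = bracket H (bracket F G) q * K q + H q * bracket K (bracket F G) q"
    using left[OF b[OF F G]] by simp
  have "bracket H F q = - bracket F H q" "bracket K F q = - bracket F K q"
    by (intro bracket_anti F H K)+
  then show "jacobiator F G (\<lambda>x. H x * K x) q = jacobiator F G H q * K q + H q * jacobiator F G K q"
    unfolding jacobiator_def 1 2 3 by (simp add: algebra_simps)
qed

text \<open>Being a derivation in its last entry, the Jacobiator allows that entry to be exchanged
  for a member of \<open>A\<close> with the same differential. Cyclic rotation brings each entry to
  the last place in turn, until \<open>B_jacobi\<close> applies.\<close>

lemma jacobiator_zero:
  assumes "F \<in> Cinf N" "G \<in> Cinf N" "H \<in> Cinf N"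
  shows "jacobiator F G H q = 0"
proof (cases "q \<in> points N")
  case True
  obtain u where u: "u \<in> A" "agree q F u" using ex_agree[OF assms(1) True] .
  obtain v where v: "v \<in> A" "agree q G v" using ex_agree[OF assms(2) True] .
  obtain w where w: "w \<in> A" "agree q H w" using ex_agree[OF assms(3) True] .
  have "jacobiator F G H q = jacobiator F G w q"
    using agreeD[OF w(2) jacobiator_derivation[OF True assms(1,2)]] by simp
  also have "\<dots> = jacobiator w F G q" by (metis jacobiator_cyclic)
  also have "\<dots> = jacobiator w F v q"
    using agreeD[OF v(2) jacobiator_derivation[OF True A_in_Cinf[OF w(1)] assms(1)]] by simp
  also have "\<dots> = jacobiator v w F q" by (metis jacobiator_cyclic)
  also have "\<dots> = jacobiator v w u q"
    using agreeD[OF u(2) jacobiator_derivation[OF True A_in_Cinf[OF v(1)] A_in_Cinf[OF w(1)]]] by simp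
  also have "\<dots> = 0"
    using B_jacobi[OF v(1) w(1) u(1)] u v w by (simp add: jacobiator_def bracket_A B_in)
  finally show ?thesis .
qed (simp add: jacobiator_def bracket_def)

lemma poisson_bracket:
  "poisson_structure N (\<lambda>F\<in>Cinf N. \<lambda>G\<in>Cinf N. bracket F G)"
proof -
  have self: "bracket F F = (\<lambda>_. 0)" if "F \<in> Cinf N" for F
  proof
    show "bracket F F q = 0" for q using bracket_anti[OF that that, of q] by simp
  qed
  have "(\<lambda>x. bracket F (bracket G H) x + (bracket G (bracket H F) x + bracket H (bracket F G) x)) = (\<lambda>_. 0)"
    if "F \<in> Cinf N" "G \<in> Cinf N" "H \<in> Cinf N" for F G H
    using jacobiator_zero[OF that] by (simp add: jacobiator_def fun_eq_iff add.assoc)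
  then show ?thesis
    unfolding poisson_structure_def lie_algebra_bracket_def function_lie_data_def
    by (simp add: bracket_Cinf bracket_add bracket_scale bracket_leibniz self
        Cinf_add[OF ok] Cinf_scale[OF ok] Cinf_mult[OF ok])
qed

section \<open>Uniqueness of the extension\<close>

context
  fixes P
  assumes P: "poisson_structure N P"
begin

lemma poisson_PiE: "P \<in> Cinf N \<rightarrow>\<^sub>E (Cinf N \<rightarrow>\<^sub>E Cinf N)"
  using P by (simp add: poisson_structure_def)

lemma poisson_Cinf: "F \<in> Cinf N \<Longrightarrow> G \<in> Cinf N \<Longrightarrow> P F G \<in> Cinf N"
  by (rule PiE_mem[OF PiE_mem[OF poisson_PiE]])

lemma poisson_add:
  assumes "F \<in> Cinf N" "G \<in> Cinf N" "H \<in> Cinf N"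
  shows "P F (\<lambda>x. G x + H x) = (\<lambda>x. P F G x + P F H x)" "P (\<lambda>x. G x + H x) F = (\<lambda>x. P G F x + P H F x)"
  using P assms by (auto simp: poisson_structure_def lie_algebra_bracket_def function_lie_data_def)

lemma poisson_scale:
  assumes "F \<in> Cinf N" "G \<in> Cinf N"
  shows "P F (\<lambda>x. c * G x) = (\<lambda>x. c * P F G x)"
  using P assms by (auto simp: poisson_structure_def lie_algebra_bracket_def function_lie_data_def)

lemma poisson_leibniz:
  assumes "F \<in> Cinf N" "G \<in> Cinf N" "H \<in> Cinf N"
  shows "P F (\<lambda>x. G x * H x) = (\<lambda>x. P F G x * H x + G x * P F H x)"
  using P assms by (auto simp: poisson_structure_def)

lemma poisson_self: "F \<in> Cinf N \<Longrightarrow> P F F = (\<lambda>_. 0)"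
  using P by (auto simp: poisson_structure_def lie_algebra_bracket_def function_lie_data_def)

lemma poisson_anti:
  assumes "F \<in> Cinf N" "G \<in> Cinf N"
  shows "P F G q = - P G F q"
proof -
  note FG = Cinf_add[OF ok assms]
  have "P (\<lambda>x. F x + G x) (\<lambda>x. F x + G x) q = P F F q + P F G q + (P G F q + P G G q)"
    using poisson_add[OF FG assms] poisson_add[OF assms(1) assms] poisson_add[OF assms(2) assms] by simp
  then show ?thesis using poisson_self[OF FG] poisson_self[OF assms(1)] poisson_self[OF assms(2)] by simp
qed

lemma poisson_derivation:
  "F \<in> Cinf N \<Longrightarrow> point_derivation N q (\<lambda>G. P F G q)"
  by (simp add: point_derivation_def poisson_add poisson_scale poisson_leibniz)

text \<open>By the Leibniz formula and antisymmetry \<open>P\<close> depends in each argument only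
  on the differential, so both entries can be exchanged for members of \<open>A\<close>.\<close>

lemma poisson_unique:
  assumes PA: "\<And>u v. u \<in> A \<Longrightarrow> v \<in> A \<Longrightarrow> P u v = B u v"
  shows "P = (\<lambda>F\<in>Cinf N. \<lambda>G\<in>Cinf N. bracket F G)"
proof -
  have eq: "P F G = bracket F G" if F: "F \<in> Cinf N" and G: "G \<in> Cinf N" for F G
  proof
    fix q
    show "P F G q = bracket F G q"
    proof (cases "q \<in> points N")
      case True
      obtain u where u: "u \<in> A" "agree q F u" using ex_agree[OF F True] .
      obtain v where v: "v \<in> A" "agree q G v" using ex_agree[OF G True] .
      have "P F G q = P F v q"
        using agreeD[OF v(2) poisson_derivation[OF F]] by simp
      also have "\<dots> = - P v F q" by (rule poisson_anti[OF F A_in_Cinf[OF v(1)]])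
      also have "P v F q = P v u q"
        using agreeD[OF u(2) poisson_derivation[OF A_in_Cinf[OF v(1)]]] by simp
      also have "- P v u q = B u v q"
        using PA[OF v(1) u(1)] B_anti[OF u(1) v(1)] by simp
      finally show ?thesis using bracket_eq[OF True u(1) v(1) u(2) v(2)] by simp
    next
      case False
      then show ?thesis using Cinf_outside[OF ok poisson_Cinf[OF F G]] by (simp add: bracket_def)
    qed
  qed
  \<comment> \<open>Off \<open>Cinf N\<close> the extensional function space prescribes the values,
    which makes \<open>P\<close> unique as a function of the logic.\<close>
  have ext: "P F G = undefined" if "F \<in> Cinf N" "G \<notin> Cinf N" for F G
    by (rule PiE_arb[OF PiE_mem[OF poisson_PiE that(1)] that(2)])
  have "P F = undefined" if "F \<notin> Cinf N" for F
    by (rule PiE_arb[OF poisson_PiE that])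
  then show ?thesis using eq ext by (auto simp: fun_eq_iff restrict_def)
qed

end

lemma ex1_poisson:
  "\<exists>!P. poisson_structure N P \<and> (\<forall>u\<in>A. \<forall>v\<in>A. P u v = B u v)"
proof (rule ex1I)
  show "poisson_structure N (\<lambda>F\<in>Cinf N. \<lambda>G\<in>Cinf N. bracket F G) \<and>
    (\<forall>u\<in>A. \<forall>v\<in>A. (\<lambda>F\<in>Cinf N. \<lambda>G\<in>Cinf N. bracket F G) u v = B u v)"
    using poisson_bracket by (auto simp: bracket_A A_in_Cinf)
qed (use poisson_unique in blast)

end

section \<open>The bracket of fibrewise affine functions\<close>

context
  fixes M :: "('m, 'v::real_inner) atlas" and E :: "('e, 'm, 'v \<times> (real^'k::finite)) bundle_data"
    and \<rho> :: "'e \<Rightarrow> 'm \<times> (('m \<Rightarrow> real) \<Rightarrow> real)" and br :: "('m \<Rightarrow> 'e) \<Rightarrow> ('m \<Rightarrow> 'e) \<Rightarrow> ('m \<Rightarrow> 'e)"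
  assumes la: "lie_algebroid M E \<rho> br"
begin

lemma algebroid_bundle: "vector_bundle M E"
  using la by (simp add: lie_algebroid_def)

lemmas vbE = algebroid_bundle
lemmas okB = base_ok[OF algebroid_bundle] and okD = dual_ok[OF algebroid_bundle]

section \<open>The algebroid bracket and the anchor seen through functions\<close>

definition zsec :: "'m \<Rightarrow> 'e" where
  "zsec = (\<lambda>x\<in>points M. fzero E x)"

lemma zero_section: "zsec \<in> sections M E"
  unfolding zsec_def
proof (rule sectionI[OF vbE])
  fix x assume x: "x \<in> points M"
  then show "(\<lambda>x\<in>points M. fzero E x) x \<in> fibre E x" using fibre_fzero[OF vbE] by simp
  obtain U \<psi> where U: "x \<in> U" and t: "local_trivialization M E U \<psi>" using ex_trivialization[OF vbE x] .
  have "csmooth M U (\<lambda>x. snd (\<psi> ((\<lambda>x\<in>points M. fzero E x) x)))"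
    by (rule csmooth_cong[OF okB triv_aopen[OF vbE t] _ csmooth_const[OF okB, of _ 0]])
      (simp add: triv_in_points[OF vbE t] triv_fzero[OF vbE t])
  then show "\<exists>U \<psi> W. local_trivialization M E U \<psi> \<and> aopen M W \<and> x \<in> W \<and> W \<subseteq> U \<and>
      csmooth M W (\<lambda>x. snd (\<psi> ((\<lambda>x\<in>points M. fzero E x) x)))"
    using t triv_aopen[OF vbE t] U by blast
qed simp

lemma br_sections: "X \<in> sections M E \<Longrightarrow> Y \<in> sections M E \<Longrightarrow> br X Y \<in> sections M E"
  using la by (simp add: lie_algebroid_def lie_algebra_bracket_def section_lie_data_def zsec_def)

lemma br_add:
  assumes "X \<in> sections M E" "Y \<in> sections M E" "Z \<in> sections M E"
  shows "br (section_add M E X Y) Z = section_add M E (br X Z) (br Y Z)"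
    and "br Z (section_add M E X Y) = section_add M E (br Z X) (br Z Y)"
  using la assms by (auto simp: lie_algebroid_def lie_algebra_bracket_def section_lie_data_def)

lemma br_scale:
  assumes "X \<in> sections M E" "Y \<in> sections M E"
  shows "br (section_mult M E (\<lambda>_. c) X) Y = section_mult M E (\<lambda>_. c) (br X Y)"
    and "br X (section_mult M E (\<lambda>_. c) Y) = section_mult M E (\<lambda>_. c) (br X Y)"
  using la assms by (auto simp: lie_algebroid_def lie_algebra_bracket_def section_lie_data_def)

lemma br_self: "X \<in> sections M E \<Longrightarrow> br X X = zsec"
  using la by (simp add: lie_algebroid_def lie_algebra_bracket_def section_lie_data_def zsec_def)

lemma br_jacobi:
  assumes "X \<in> sections M E" "Y \<in> sections M E" "Z \<in> sections M E"
  shows "section_add M E (br X (br Y Z)) (section_add M E (br Y (br Z X)) (br Z (br X Y))) =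
    zsec"
  using la assms by (simp add: lie_algebroid_def lie_algebra_bracket_def section_lie_data_def zsec_def)

lemma mult_sections: "f \<in> Cinf M \<Longrightarrow> X \<in> sections M E \<Longrightarrow> section_mult M E f X \<in> sections M E"
  by (intro section_mult_in_sections[OF vbE] Cinf_imp_csmooth[OF okB]) auto

lemma scale_sections: "X \<in> sections M E \<Longrightarrow> section_mult M E (\<lambda>_. c) X \<in> sections M E"
  by (intro section_mult_in_sections[OF vbE] csmooth_const[OF okB])

lemmas add_sections = section_add_in_sections[OF algebroid_bundle]
  and Phi_add = Phi_section_add[OF algebroid_bundle] and Phi_mult = Phi_section_mult[OF algebroid_bundle]
  and PhiC = Phi_Cinf[OF algebroid_bundle] and pullC = pull_Cinf[OF algebroid_bundle]
  and Phi_inj = Phi_inject[OF algebroid_bundle] and pull_eq = pull_def[OF algebroid_bundle]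
  and points_dual = dual_points[OF algebroid_bundle]

lemma fscale_0: "x \<in> points M \<Longrightarrow> a \<in> fibre E x \<Longrightarrow> fscale E 0 a = fzero E x"
  by (metis ex_trivialization[OF vbE] triv_inj[OF vbE] fibre_fscale[OF vbE] fibre_fzero[OF vbE]
      triv_fscale[OF vbE] triv_fzero[OF vbE] scaleR_zero_left)

lemma Phi_zero: "Phi M E zsec q = 0"
proof (cases "q \<in> points (dual_total M E)")
  case True
  then obtain x \<xi> where q: "q = (x, \<xi>)" "x \<in> points M" "\<xi> \<in> dual_space E x" by (auto simp: points_dual)
  have "\<xi> (fzero E x) = \<xi> (fscale E 0 (fzero E x))"
    using fscale_0[OF q(2) fibre_fzero[OF vbE q(2)]] by simp
  also have "\<dots> = 0" using dual_spaceD(3)[OF vbE q(3) fibre_fzero[OF vbE q(2)]] by simp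
  finally show ?thesis using True q by (simp add: Phi_eq[OF vbE] zsec_def)
qed (simp add: Phi_outside[OF vbE])

lemma Phi_br_anti:
  assumes X: "X \<in> sections M E" and Y: "Y \<in> sections M E"
  shows "Phi M E (br X Y) q = - Phi M E (br Y X) q"
proof -
  note XY = add_sections[OF X Y]
  have "Phi M E (br (section_add M E X Y) (section_add M E X Y)) q = 0"
    by (simp add: br_self[OF XY] Phi_zero)
  then show ?thesis
    using X Y XY by (simp add: br_add br_self[OF X] br_self[OF Y] Phi_add br_sections add_sections Phi_zero zero_section)
qed

lemma Phi_br_jacobi:
  assumes "X \<in> sections M E" "Y \<in> sections M E" "Z \<in> sections M E"
  shows "Phi M E (br X (br Y Z)) q + Phi M E (br Y (br Z X)) q + Phi M E (br Z (br X Y)) q = 0"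
  using arg_cong[OF br_jacobi[OF assms], of "\<lambda>S. Phi M E S q"] assms
  by (simp add: Phi_add br_sections add_sections Phi_zero zero_section)

definition act :: "('m \<Rightarrow> 'e) \<Rightarrow> ('m \<Rightarrow> real) \<Rightarrow> 'm \<Rightarrow> real" where
  "act X f = differential_pairing M f (compose (points M) \<rho> X)"

lemma act_eq: "act X f x = (if x \<in> points M then snd (\<rho> (X x)) f else 0)"
  by (simp add: act_def differential_pairing_def compose_def)

lemma act_add:
  "X \<in> sections M E \<Longrightarrow> Y \<in> sections M E \<Longrightarrow> act (section_add M E X Y) f x = act X f x + act Y f x"
  using la section_in_fibre[OF vbE]
  by (auto simp: act_eq section_add_def lie_algebroid_def vector_bundle_map_def tangent_bundle_def split_beta)

lemma act_mult: "X \<in> sections M E \<Longrightarrow> act (section_mult M E g X) f x = g x * act X f x"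
  using la section_in_fibre[OF vbE]
  by (auto simp: act_eq section_mult_def lie_algebroid_def vector_bundle_map_def tangent_bundle_def split_beta)

lemma act_br:
  assumes "X \<in> sections M E" "Y \<in> sections M E"
  shows "act (br X Y) f x = act X (act Y f) x - act Y (act X f) x"
proof (cases "x \<in> points M")
  case True
  have "compose (points M) \<rho> (br X Y) =
    vector_field_bracket M (compose (points M) \<rho> X) (compose (points M) \<rho> Y)"
    using la assms by (auto simp: lie_algebroid_def lie_algebra_hom_def section_lie_data_def)
  then have "snd (compose (points M) \<rho> (br X Y) x) f =
    snd (vector_field_bracket M (compose (points M) \<rho> X) (compose (points M) \<rho> Y) x) f" by simp
  moreover have "compose (points M) \<rho> Z x = \<rho> (Z x)" for Z using True by (simp add: compose_def)
  ultimately show ?thesis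
    using True by (simp add: act_eq[of _ _ x] vector_field_bracket_def act_def[symmetric])
qed (simp add: act_eq)

text \<open>The Leibniz rule of the algebroid evaluated on covectors. The derivation property and
  the smoothness of \<open>act\<close> are read off from it.\<close>

lemma Phi_br_leibniz:
  assumes X: "X \<in> sections M E" and Y: "Y \<in> sections M E" and f: "f \<in> Cinf M"
  shows "Phi M E (br X (section_mult M E f Y)) q =
    f (fst q) * Phi M E (br X Y) q + act X f (fst q) * Phi M E Y q"
proof (cases "q \<in> points (dual_total M E)")
  case True
  then obtain x \<xi> where q: "q = (x, \<xi>)" "x \<in> points M" "\<xi> \<in> dual_space E x" by (auto simp: points_dual)
  have "br X (section_mult M E f Y) =
    section_add M E (section_mult M E f (br X Y)) (section_mult M E (act X f) Y)"
    using la X Y f by (simp add: lie_algebroid_def act_def)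
  then have "Phi M E (br X (section_mult M E f Y)) q = \<xi> (fadd E (fscale E (f x) (br X Y x)) (fscale E (act X f x) (Y x)))"
    using True q by (simp add: Phi_eq[OF vbE] section_add_def section_mult_def)
  then show ?thesis
    using True q section_in_fibre[OF vbE Y q(2)] section_in_fibre[OF vbE br_sections[OF X Y] q(2)]
    by (simp add: Phi_eq[OF vbE] dual_spaceD[OF vbE q(3)] fibre_fscale[OF vbE q(2)])
qed (simp add: Phi_outside[OF vbE])

lemma ex_frame_at:
  assumes "x \<in> points M"
  obtains U \<psi> V \<phi> a r e y h where "adapted_frame M E U \<psi> V \<phi> a r e y h" "x \<in> adapted_frame.core V \<phi> a r"
proof -
  obtain U \<psi> V \<phi> r e y h where f: "adapted_frame M E U \<psi> V \<phi> (\<phi> x) r e y h" "x \<in> V"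
    using ex_adapted_frame[OF vbE assms] by blast
  then have "x \<in> adapted_frame.core V \<phi> (\<phi> x) r"
    using adapted_frame.core_def[OF f(1)] adapted_frame.r[OF f(1)] by simp
  then show ?thesis using that f(1) by blast
qed

lemma ex_unit_covector:
  assumes x: "x \<in> points M"
  obtains Y q where "Y \<in> sections M E" "q \<in> points (dual_total M E)" "fst q = x" "Phi M E Y q = 1"
proof -
  obtain U \<psi> V \<phi> a r e y h where f: "adapted_frame M E U \<psi> V \<phi> a r e y h" "x \<in> adapted_frame.core V \<phi> a r"
    using ex_frame_at[OF x] .
  interpret adapted_frame M E U \<psi> V \<phi> a r e y h by (rule f(1))
  have pl: "x \<in> plateau" using f(2) core_subset by auto
  \<comment> \<open>An index exists because \<open>'k\<close> is inhabited: this is where positive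
    rank enters.\<close>
  fix i :: 'k
  let ?q = "(x, covec E \<psi> x (axis i 1))"
  note q = coords_covec[OF pl, of "axis i 1"]
  have "Phi M E (e i) ?q = 1" using Phi_frame[of ?q i] q pl by simp
  then show ?thesis using that[OF e_sec q(1)] by simp
qed

text \<open>Where \<open>Phi M E Y q = 1\<close>, the Leibniz rule can be solved for
  \<open>act X f x\<close>. Linearity of \<open>br\<close> then gives linearity in \<open>f\<close>,
  and multiplying \<open>Y\<close> by \<open>g\<close> and then by \<open>f\<close> gives the
  product rule.\<close>

lemma act_point_derivation:
  assumes X: "X \<in> sections M E" and x: "x \<in> points M"
  shows "point_derivation M x (\<lambda>f. act X f x)"
proof -
  obtain Y q where Y: "Y \<in> sections M E" and q: "fst q = x" "Phi M E Y q = 1"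
    using ex_unit_covector[OF x] by metis
  have eq: "act X f x = Phi M E (br X (section_mult M E f Y)) q - f x * Phi M E (br X Y) q"
    if "f \<in> Cinf M" for f using Phi_br_leibniz[OF X Y that, of q] q by simp
  have "act X (\<lambda>x. f x + g x) x = act X f x + act X g x" if f: "f \<in> Cinf M" and g: "g \<in> Cinf M" for f g
  proof -
    have "section_mult M E (\<lambda>x. f x + g x) Y = section_add M E (section_mult M E f Y) (section_mult M E g Y)"
      by (rule Phi_inj) (simp_all add: Phi_add Phi_mult mult_sections add_sections Cinf_add[OF okB] f g Y algebra_simps)
    then show ?thesis
      using f g X Y by (simp add: eq Cinf_add[OF okB] br_add mult_sections Phi_add br_sections algebra_simps)
  qed
  moreover have "act X (\<lambda>x. c * f x) x = c * act X f x" if f: "f \<in> Cinf M" for f c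
  proof -
    have "section_mult M E (\<lambda>x. c * f x) Y = section_mult M E (\<lambda>_. c) (section_mult M E f Y)"
      by (rule Phi_inj) (simp_all add: Phi_mult mult_sections scale_sections Cinf_scale[OF okB] f Y algebra_simps)
    then show ?thesis
      using f X Y by (simp add: eq Cinf_scale[OF okB] br_scale mult_sections Phi_mult br_sections algebra_simps)
  qed
  moreover have "act X (\<lambda>x. f x * g x) x = act X f x * g x + f x * act X g x"
    if f: "f \<in> Cinf M" and g: "g \<in> Cinf M" for f g
  proof -
    have "section_mult M E (\<lambda>x. f x * g x) Y = section_mult M E f (section_mult M E g Y)"
      by (rule Phi_inj) (simp_all add: Phi_mult mult_sections Cinf_mult[OF okB] f g Y algebra_simps)
    then show ?thesis
      using Phi_br_leibniz[OF X mult_sections[OF g Y] f, of q] Phi_br_leibniz[OF X Y g, of q] q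
      by (simp add: eq[OF Cinf_mult[OF okB f g]] Phi_mult Y algebra_simps)
  qed
  ultimately show ?thesis by (simp add: point_derivation_def)
qed

text \<open>The same solved Leibniz rule, now with the frame section \<open>e i\<close> and its dual
  covectors for varying base point; \<open>along\<close> turns the ingredients into smooth functions
  on the base.\<close>

lemma act_Cinf:
  assumes X: "X \<in> sections M E" and f: "f \<in> Cinf M"
  shows "act X f \<in> Cinf M"
proof (rule Cinf_localI[OF okB])
  fix x assume x: "x \<in> points M"
  obtain U \<psi> V \<phi> a r e y h where fr: "adapted_frame M E U \<psi> V \<phi> a r e y h" "x \<in> adapted_frame.core V \<phi> a r"
    using ex_frame_at[OF x] .
  interpret adapted_frame M E U \<psi> V \<phi> a r e y h by (rule fr(1))
  fix i :: 'k
  let ?w = "axis i 1 :: real^'k"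
  let ?g = "\<lambda>x. along ?w (Phi M E (br X (section_mult M E f (e i)))) x - f x * along ?w (Phi M E (br X (e i))) x"
  have "?g \<in> Cinf M"
    by (intro Cinf_diff[OF okB] Cinf_mult[OF okB] along_Cinf PhiC br_sections X mult_sections f e_sec)
  moreover have "act X f z = ?g z" if z: "z \<in> core" for z
  proof -
    have pl: "z \<in> plateau" using z core_subset by auto
    let ?q = "(z, covec E \<psi> z ?w)"
    note q = coords_covec[OF pl, of ?w]
    have "Phi M E (e i) ?q = 1" using Phi_frame[of ?q i] q pl by simp
    then show ?thesis
      using Phi_br_leibniz[OF X e_sec f, of i ?q] pl h_core[OF z] by (simp add: along_def)
  qed
  ultimately show "\<exists>W g. aopen M W \<and> x \<in> W \<and> csmooth M W g \<and> (\<forall>z\<in>W. act X f z = g z)"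
    using fr(2) aopen_core Cinf_imp_csmooth[OF okB, of ?g core] aopen_subset[OF aopen_core]
    by (intro exI[of _ core] exI[of _ ?g]) auto
qed (simp add: act_eq)

lemma Phi_br_zero: "Y \<in> sections M E \<Longrightarrow> Phi M E (br Y zsec) q = 0"
proof -
  assume Y: "Y \<in> sections M E"
  have "zsec = section_mult M E (\<lambda>_. 0) zsec"
    using fscale_0 fibre_fzero[OF vbE] by (auto simp: section_mult_def zsec_def)
  then have "br Y zsec = section_mult M E (\<lambda>_. 0) (br Y zsec)"
    using br_scale(2)[OF Y zero_section] by metis
  then have "Phi M E (br Y zsec) q =
      Phi M E (section_mult M E (\<lambda>_. 0) (br Y zsec)) q" by simp
  then show ?thesis by (simp only: Phi_mult[OF br_sections[OF Y zero_section]] mult_zero_left)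
qed

text \<open>Serves as the sum operator for sections: a finite sum is described by its function
  \<open>Phi\<close> and by the functions of its brackets, the two things used in the frame
  expansion.\<close>

lemma ex_section_sum:
  assumes "finite I" "\<And>i. i \<in> I \<Longrightarrow> X i \<in> sections M E"
  shows "\<exists>S\<in>sections M E. (\<forall>q. Phi M E S q = (\<Sum>i\<in>I. Phi M E (X i) q)) \<and>
    (\<forall>Y\<in>sections M E. \<forall>q. Phi M E (br Y S) q = (\<Sum>i\<in>I. Phi M E (br Y (X i)) q))"
  using assms
proof (induction I rule: finite_induct)
  case empty
  show ?case by (intro bexI[OF _ zero_section]) (simp add: Phi_zero Phi_br_zero)
next
  case (insert i I)
  then obtain S where S: "S \<in> sections M E" "\<forall>q. Phi M E S q = (\<Sum>i\<in>I. Phi M E (X i) q)"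
    "\<forall>Y\<in>sections M E. \<forall>q. Phi M E (br Y S) q = (\<Sum>i\<in>I. Phi M E (br Y (X i)) q)" by auto
  show ?case
    using S insert by (intro bexI[of _ "section_add M E (X i) S"])
      (auto simp: Phi_add br_add br_sections add_sections)
qed

section \<open>Brackets of fibrewise affine functions\<close>

definition affine :: "('m \<Rightarrow> 'e) \<Rightarrow> ('m \<Rightarrow> real) \<Rightarrow> 'm \<times> ('e \<Rightarrow> real) \<Rightarrow> real" where
  "affine X f = (\<lambda>q. Phi M E X q + pull M E f q)"

text \<open>Defined on representing pairs first; that it depends on the functions alone is shown in
  \<open>affine_bracket_cong\<close>.\<close>

definition affine_bracket ::
  "('m \<Rightarrow> 'e) \<Rightarrow> ('m \<Rightarrow> real) \<Rightarrow> ('m \<Rightarrow> 'e) \<Rightarrow> ('m \<Rightarrow> real) \<Rightarrow> 'm \<times> ('e \<Rightarrow> real) \<Rightarrow> real" where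
  "affine_bracket X f Y g = affine (br X Y) (\<lambda>x. act X g x - act Y f x)"

lemma affine_Cinf: "X \<in> sections M E \<Longrightarrow> f \<in> Cinf M \<Longrightarrow> affine X f \<in> Cinf (dual_total M E)"
  unfolding affine_def by (intro Cinf_add[OF okD] PhiC pullC)

text \<open>Where the differential of \<open>affine X f\<close> vanishes, \<open>X\<close> vanishes, and writing \<open>X\<close> in a frame the
  Leibniz rule expresses \<open>br X Y\<close> through derivatives of the components of \<open>X\<close>. These derivatives
  are compensated by that of \<open>f\<close>.\<close>

lemma affine_bracket_tensorial:
  assumes X: "X \<in> sections M E" and f: "f \<in> Cinf M" and Y: "Y \<in> sections M E" and g: "g \<in> Cinf M"
    and q: "q \<in> points (dual_total M E)"
    and D: "\<And>D. point_derivation (dual_total M E) q D \<Longrightarrow> D (affine X f) = 0"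
  shows "affine_bracket X f Y g q = 0"
proof -
  define x where "x = fst q"
  have xM: "x \<in> points M" using q by (auto simp: points_dual x_def)
  obtain U \<psi> V \<phi> a r e y h where fr: "adapted_frame M E U \<psi> V \<phi> a r e y h" "x \<in> adapted_frame.core V \<phi> a r"
    using ex_frame_at[OF xM] .
  interpret adapted_frame M E U \<psi> V \<phi> a r e y h by (rule fr(1))
  have x: "x \<in> core" by (rule fr(2))
  have pl: "x \<in> plateau" using x core_subset by auto
  have xU: "x \<in> U" using pl plateau_subset by auto
  note qp = q pl[unfolded x_def]
  define w where "w = snd (coords q)"
  have qw: "q = (x, covec E \<psi> x w)" using covec_coords(1)[OF qp] by (simp add: x_def w_def)
  define d where "d = (\<lambda>f. act Y f x)"
  have d: "point_derivation M x d" unfolding d_def by (rule act_point_derivation[OF Y xM])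
  \<comment> \<open>Vertical derivatives see only the section part of an affine function, so the
    hypothesis \<open>D\<close> forces the components of \<open>X\<close> at \<open>x\<close> to
    vanish.\<close>
  have comp: "snd (\<psi> (X x)) $ i = 0" for i
    using D[OF vertical_derivation[OF qp, of i]] vertical_Phi[OF qp X, of i] vertical_pull[OF qp f, of i]
      derivation_add[OF okN vertical_derivation[OF qp, of i] PhiC[OF X] pullC[OF f]]
    by (simp add: affine_def x_def)
  then have comp0: "component X i x = 0" for i by (simp add: component_def)
  have "X x = fzero E x"
    by (rule triv_inj[OF vb t xU section_in_fibre[OF vb X xM] fibre_fzero[OF vb xM]])
      (simp add: vec_eq_iff comp triv_fzero[OF vb t xU])
  then have Xx: "section_mult M E (\<lambda>_. 0) X x = X x"
    using fscale_0[OF xM section_in_fibre[OF vb X xM]] xM by (simp add: section_mult_def)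
  then have "act (section_mult M E (\<lambda>_. 0) X) g x = act X g x" by (simp only: act_eq)
  then have act0: "act X g x = 0" using act_mult[OF X, of "\<lambda>_. 0" g x] by simp
  have PhiX: "Phi M E X q = 0"
    using Xx Phi_mult[OF X, of "\<lambda>_. 0"] Phi_eq[OF vb q, of X] Phi_eq[OF vb q, of "section_mult M E (\<lambda>_. 0) X"]
    by (simp add: x_def)
  \<comment> \<open>Testing the hypothesis with the lift of \<open>d\<close>, the derivation given
    by the anchor along \<open>Y\<close>, yields the first-order relation between the components of
    \<open>X\<close> and the function \<open>f\<close>.\<close>
  have der: "(\<Sum>i\<in>UNIV. w $ i * d (component X i)) + d f = 0"
  proof -
    have "d (along w (Phi M E X)) = (\<Sum>i\<in>UNIV. d (\<lambda>x. w $ i * component X i x))"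
      unfolding along_Phi[OF X]
      by (rule derivation_sum[OF okM d]) (auto intro: Cinf_scale[OF okM] component_Cinf[OF X])
    then have "lift d x w (Phi M E X) = (\<Sum>i\<in>UNIV. w $ i * d (component X i))"
      using PhiX by (simp add: lift_def qw[symmetric] derivation_scale[OF okM d component_Cinf[OF X]])
    moreover have "lift d x w (affine X f) = lift d x w (Phi M E X) + lift d x w (pull M E f)"
      unfolding affine_def by (rule derivation_add[OF okN lift_derivation[OF x d] PhiC[OF X] pullC[OF f]])
    ultimately show ?thesis
      using D[of "lift d x w"] lift_derivation[OF x d, of w] lift_pull[OF x d f, of w] by (simp add: qw)
  qed
  have sec: "section_mult M E (component X i) (e i) \<in> sections M E" for i
    by (rule mult_sections[OF component_Cinf[OF X] e_sec])
  obtain S where S: "S \<in> sections M E"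
    "\<And>q. Phi M E S q = (\<Sum>i\<in>UNIV. Phi M E (section_mult M E (component X i) (e i)) q)"
    "\<And>q. Phi M E (br Y S) q = (\<Sum>i\<in>UNIV. Phi M E (br Y (section_mult M E (component X i) (e i))) q)"
    using ex_section_sum[of UNIV "\<lambda>i. section_mult M E (component X i) (e i)"] sec Y by fastforce
  have hX: "section_mult M E h X = S"
    by (rule Phi_inj[OF mult_sections[OF h_Cinf X] S(1)])
      (auto simp: fun_eq_iff S(2) Phi_mult X e_sec frame_decomposition[of X "(_, _)", simplified])
  \<comment> \<open>Replacing \<open>X\<close> by its multiple with \<open>h\<close> changes nothing
    at \<open>q\<close>: \<open>h\<close> is 1 there, and the derivative of \<open>h\<close> is
    multiplied by \<open>Phi M E X q\<close>, which is 0. The frame expansion then applies.\<close>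
  have "Phi M E (br Y X) q = Phi M E (br Y (section_mult M E h X)) q"
    using Phi_br_leibniz[OF Y X h_Cinf, of q] PhiX h_core[OF x] by (simp add: x_def)
  also have "\<dots> = (\<Sum>i\<in>UNIV. w $ i * d (component X i))"
    unfolding hX S(3)
    by (intro sum.cong refl)
      (use Phi_frame[OF qp] in \<open>simp add: Phi_br_leibniz[OF Y e_sec component_Cinf[OF X]] comp0
         x_def[symmetric] d_def w_def\<close>)
  finally have "Phi M E (br Y X) q = - d f" using der by simp
  then show ?thesis
    using Phi_br_anti[OF X Y, of q] act0 q
    by (simp add: affine_bracket_def affine_def pull_eq x_def[symmetric] d_def)
qed

lemma affine_add:
  "X \<in> sections M E \<Longrightarrow> Y \<in> sections M E \<Longrightarrow>
    affine (section_add M E X Y) (\<lambda>x. f x + g x) = (\<lambda>q. affine X f q + affine Y g q)"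
  by (auto simp: affine_def Phi_add pull_eq)

lemma affine_scale:
  "X \<in> sections M E \<Longrightarrow> affine (section_mult M E (\<lambda>_. c) X) (\<lambda>x. c * f x) = (\<lambda>q. c * affine X f q)"
  by (auto simp: affine_def Phi_mult pull_eq algebra_simps)

lemma act_fun:
  assumes "X \<in> sections M E" "f \<in> Cinf M" "g \<in> Cinf M"
  shows "act X (\<lambda>x. f x + g x) x = act X f x + act X g x" "act X (\<lambda>x. f x - g x) x = act X f x - act X g x"
    "act X (\<lambda>x. c * f x) x = c * act X f x"
proof -
  note d = act_point_derivation[OF assms(1)]
  show "act X (\<lambda>x. f x + g x) x = act X f x + act X g x"
    using derivation_add[OF okB d assms(2,3)] by (cases "x \<in> points M") (auto simp: act_eq)
  show "act X (\<lambda>x. f x - g x) x = act X f x - act X g x"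
    using derivation_diff[OF okB d assms(2,3)] by (cases "x \<in> points M") (auto simp: act_eq)
  show "act X (\<lambda>x. c * f x) x = c * act X f x"
    using derivation_scale[OF okB d assms(2)] by (cases "x \<in> points M") (auto simp: act_eq)
qed

lemma affine_bracket_add:
  assumes "X \<in> sections M E" "f \<in> Cinf M" "X' \<in> sections M E" "f' \<in> Cinf M" "Y \<in> sections M E" "g \<in> Cinf M"
  shows "affine_bracket (section_add M E X X') (\<lambda>x. f x + f' x) Y g q =
    affine_bracket X f Y g q + affine_bracket X' f' Y g q"
  using assms by (simp add: affine_bracket_def affine_def br_add Phi_add br_sections act_add act_fun pull_eq)

lemma affine_bracket_scale:
  assumes "X \<in> sections M E" "f \<in> Cinf M" "Y \<in> sections M E" "g \<in> Cinf M"
  shows "affine_bracket (section_mult M E (\<lambda>_. c) X) (\<lambda>x. c * f x) Y g q = c * affine_bracket X f Y g q"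
  using assms
  by (simp add: affine_bracket_def affine_def br_scale Phi_mult br_sections act_mult act_fun pull_eq algebra_simps)

lemma affine_bracket_anti:
  assumes "X \<in> sections M E" "Y \<in> sections M E"
  shows "affine_bracket X f Y g q = - affine_bracket Y g X f q"
  using Phi_br_anti[OF assms, of q] by (simp add: affine_bracket_def affine_def pull_eq)

text \<open>The difference of two representations represents the zero function, on which all
  derivations vanish, so tensoriality makes its bracket zero.\<close>

lemma affine_bracket_cong:
  assumes X: "X \<in> sections M E" "f \<in> Cinf M" and X': "X' \<in> sections M E" "f' \<in> Cinf M"
    and Y: "Y \<in> sections M E" "g \<in> Cinf M" and eq: "affine X f = affine X' f'"
  shows "affine_bracket X f Y g = affine_bracket X' f' Y g"
proof
  fix q
  show "affine_bracket X f Y g q = affine_bracket X' f' Y g q"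
  proof (cases "q \<in> points (dual_total M E)")
    case True
    let ?m = "section_mult M E (\<lambda>_. -1) X'" and ?f = "\<lambda>x. -1 * f' x"
    have m: "?m \<in> sections M E" "?f \<in> Cinf M" by (intro scale_sections X' Cinf_scale[OF okB])+
    have "affine_bracket (section_add M E X ?m) (\<lambda>x. f x + ?f x) Y g q = 0"
    proof (rule affine_bracket_tensorial[OF add_sections[OF X(1) m(1)] Cinf_add[OF okB X(2) m(2)] Y True])
      fix D assume D: "point_derivation (dual_total M E) q D"
      have "affine (section_add M E X ?m) (\<lambda>x. f x + ?f x) = (\<lambda>_. 0)"
        unfolding affine_add[OF X(1) m(1)] affine_scale[OF X'(1)] eq by simp
      then show "D (affine (section_add M E X ?m) (\<lambda>x. f x + ?f x)) = 0"
        using derivation_zero[OF okD D] by simp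
    qed
    then show ?thesis
      using affine_bracket_add[OF X m Y, of q] affine_bracket_scale[OF X' Y, of "-1" q] by simp
  next
    case False
    then show ?thesis by (simp add: affine_bracket_def affine_def Phi_outside[OF vbE] pull_eq)
  qed
qed

definition affine_functions :: "('m \<times> ('e \<Rightarrow> real) \<Rightarrow> real) set" where
  "affine_functions = {affine X f | X f. X \<in> sections M E \<and> f \<in> Cinf M}"

lemma affine_mem: "X \<in> sections M E \<Longrightarrow> f \<in> Cinf M \<Longrightarrow> affine X f \<in> affine_functions"
  by (auto simp: affine_functions_def)

lemma affine_functionsE:
  assumes "u \<in> affine_functions"
  obtains X f where "u = affine X f" "X \<in> sections M E" "f \<in> Cinf M"
  using assms by (auto simp: affine_functions_def)

text \<open>An arbitrary choice of a representing pair; \<open>fun_bracket_affine\<close> frees the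
  bracket of functions from the choice.\<close>

definition lin_part :: "('m \<times> ('e \<Rightarrow> real) \<Rightarrow> real) \<Rightarrow> ('m \<Rightarrow> 'e) \<times> ('m \<Rightarrow> real)" where
  "lin_part u = (SOME p. fst p \<in> sections M E \<and> snd p \<in> Cinf M \<and> u = affine (fst p) (snd p))"

definition fun_bracket ::
  "('m \<times> ('e \<Rightarrow> real) \<Rightarrow> real) \<Rightarrow> ('m \<times> ('e \<Rightarrow> real) \<Rightarrow> real) \<Rightarrow> 'm \<times> ('e \<Rightarrow> real) \<Rightarrow> real" where
  "fun_bracket u v = affine_bracket (fst (lin_part u)) (snd (lin_part u)) (fst (lin_part v)) (snd (lin_part v))"

lemma lin_part:
  assumes "X \<in> sections M E" "f \<in> Cinf M"
  shows "fst (lin_part (affine X f)) \<in> sections M E" "snd (lin_part (affine X f)) \<in> Cinf M"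
    "affine (fst (lin_part (affine X f))) (snd (lin_part (affine X f))) = affine X f"
proof -
  have "\<exists>p. fst p \<in> sections M E \<and> snd p \<in> Cinf M \<and> affine X f = affine (fst p) (snd p)"
    using assms by (intro exI[of _ "(X, f)"]) simp
  from someI_ex[OF this] show "fst (lin_part (affine X f)) \<in> sections M E" "snd (lin_part (affine X f)) \<in> Cinf M"
    "affine (fst (lin_part (affine X f))) (snd (lin_part (affine X f))) = affine X f"
    unfolding lin_part_def by simp_all
qed

lemma fun_bracket_affine:
  assumes X: "X \<in> sections M E" "f \<in> Cinf M" and Y: "Y \<in> sections M E" "g \<in> Cinf M"
  shows "fun_bracket (affine X f) (affine Y g) = affine_bracket X f Y g"
proof -
  note x = lin_part[OF X] and y = lin_part[OF Y]
  have "fun_bracket (affine X f) (affine Y g) =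
      affine_bracket X f (fst (lin_part (affine Y g))) (snd (lin_part (affine Y g)))"
    unfolding fun_bracket_def by (rule affine_bracket_cong[OF x(1,2) X y(1,2) x(3)])
  also have "\<dots> = affine_bracket X f Y g"
    using affine_bracket_cong[OF y(1,2) Y X y(3)] affine_bracket_anti[OF X(1) Y(1), of f g]
      affine_bracket_anti[OF X(1) y(1), of f "snd (lin_part (affine Y g))"]
    by (simp add: fun_eq_iff)
  finally show ?thesis .
qed

text \<open>The section parts cancel by the Jacobi identity of \<open>br\<close>. For the function
  parts, \<open>act_br\<close> expands the anchor of a bracket into a commutator, after which the
  iterated derivatives cancel in the cyclic sum.\<close>

lemma fun_bracket_jacobi:
  assumes X: "X \<in> sections M E" "f \<in> Cinf M" and Y: "Y \<in> sections M E" "g \<in> Cinf M"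
    and Z: "Z \<in> sections M E" "k \<in> Cinf M"
  shows "fun_bracket (affine X f) (fun_bracket (affine Y g) (affine Z k)) q +
    fun_bracket (affine Y g) (fun_bracket (affine Z k) (affine X f)) q +
    fun_bracket (affine Z k) (fun_bracket (affine X f) (affine Y g)) q = 0"
proof -
  have nest: "fun_bracket (affine X f) (fun_bracket (affine Y g) (affine Z k)) q =
      Phi M E (br X (br Y Z)) q + (if q \<in> points (dual_total M E) then
        act X (act Y k) (fst q) - act X (act Z g) (fst q) - act Y (act Z f) (fst q) + act Z (act Y f) (fst q) else 0)"
    if X: "X \<in> sections M E" "f \<in> Cinf M" and Y: "Y \<in> sections M E" "g \<in> Cinf M"
      and Z: "Z \<in> sections M E" "k \<in> Cinf M" for X Y Z f g k
  proof -
    note YZ = br_sections[OF Y(1) Z(1)]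
    have d: "(\<lambda>x. act Y k x - act Z g x) \<in> Cinf M" by (intro Cinf_diff[OF okB] act_Cinf Y Z)
    have "fun_bracket (affine X f) (fun_bracket (affine Y g) (affine Z k)) =
        affine_bracket X f (br Y Z) (\<lambda>x. act Y k x - act Z g x)"
      unfolding fun_bracket_affine[OF Y Z] affine_bracket_def[of Y] by (rule fun_bracket_affine[OF X YZ d])
    then show ?thesis
      using X Y Z by (simp add: affine_bracket_def affine_def pull_eq act_fun act_Cinf act_br)
  qed
  show ?thesis
    unfolding nest[OF X Y Z] nest[OF Y Z X] nest[OF Z X Y]
    using Phi_br_jacobi[OF X(1) Y(1) Z(1), of q] by simp
qed

text \<open>The orthonormal basis for \<open>derivation_expand\<close> is chosen along the splitting
  into base and fibre: base vectors give functions pulled back from \<open>M\<close>, fibre vectors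
  give the functions of the frame sections.\<close>

lemma affine_generates:
  assumes F: "F \<in> Cinf (dual_total M E)" and p: "p \<in> points (dual_total M E)"
  shows "\<exists>W n c u. aopen (dual_total M E) W \<and> p \<in> W \<and>
    (\<forall>i<n::nat. c i \<in> Cinf (dual_total M E) \<and> u i \<in> affine_functions) \<and>
    (\<forall>q\<in>W. \<forall>D. point_derivation (dual_total M E) q D \<longrightarrow> D F = (\<Sum>i<n. c i q * D (u i)))"
proof -
  have "fst p \<in> points M" using p by (auto simp: points_dual)
  then obtain U \<psi> V \<phi> a r e y h where
    fr: "adapted_frame M E U \<psi> V \<phi> a r e y h" "fst p \<in> adapted_frame.core V \<phi> a r"
    using ex_frame_at by blast
  interpret adapted_frame M E U \<psi> V \<phi> a r e y h by (rule fr(1))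
  obtain B :: "'v set" where B: "orthobasis B" using smooth_manifold_orthobasis[OF base_manifold[OF vb]] by blast
  define C where "C = (\<lambda>b. (b, 0)) ` B \<union> (\<lambda>c. (0, c)) ` (Basis :: (real^'k) set)"
  have C: "orthobasis C" unfolding C_def by (rule orthobasis_Times[OF B orthobasis_Basis])
  obtain s where s: "bij_betw s {..<card C} C"
    using ex_bij_betw_nat_finite[OF orthobasis_finite[OF C]] by (auto simp: atLeast0LessThan)
  let ?W = "{q \<in> points N. fst q \<in> core}"
  let ?c = "\<lambda>i. ext (\<lambda>p. frechet_derivative (rep F) (at p) (s i))"
  have gen: "gen c \<in> affine_functions" if c: "c \<in> C" for c
  proof -
    consider b where "c = (b, 0)" | i where "c = (0, axis i 1)"
      using c by (auto simp: C_def Basis_vec_def)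
    then show ?thesis
    proof cases
      case 1
      have "gen c = affine zsec (\<lambda>x. if x \<in> points M then y x \<bullet> b else 0)"
        by (simp add: 1 gen_base affine_def Phi_zero)
      then show ?thesis using affine_mem[OF zero_section y_inner_Cinf] by simp
    next
      case 2
      have "gen c = affine (e i) (\<lambda>_. 0)"
        by (simp add: 2 gen_fibre affine_def pull_eq)
      then show ?thesis using affine_mem[OF e_sec Cinf_zero[OF okM]] by simp
    qed
  qed
  have "D F = (\<Sum>i<card C. ?c i q * D (gen (s i)))" if "q \<in> ?W" "point_derivation N q D" for q D
    using derivation_expand[OF C F _ _ that(2)] that(1)
      sum.reindex_bij_betw[OF s, of "\<lambda>c. ext (\<lambda>p. frechet_derivative (rep F) (at p) c) q * D (gen c)"]
    by simp
  moreover have "?c i \<in> Cinf N" for i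
    by (rule ext_Cinf[OF smooth_on_frechet[OF local_rep_smooth_tube[OF F]]])
  moreover have "gen (s i) \<in> affine_functions" if "i < card C" for i
    by (rule gen) (use s that in \<open>auto simp: bij_betw_def\<close>)
  moreover have "aopen N ?W" by (rule dual_aopen_fst[OF vb aopen_core])
  ultimately show ?thesis
    using p fr(2)
    by (intro exI[of _ ?W] exI[of _ "card C"] exI[of _ ?c] exI[of _ "\<lambda>i. gen (s i)"]) auto
qed

lemma affine_generators: "poisson_generators (dual_total M E) affine_functions fun_bracket"
proof
  show "atlas_ok (dual_total M E)" by (rule okD)
  show "affine_functions \<subseteq> Cinf (dual_total M E)" using affine_Cinf by (auto simp: affine_functions_def)
  have "affine zsec (\<lambda>_. 0) = (\<lambda>_. 0)" by (simp add: affine_def Phi_zero pull_eq)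
  then show "(\<lambda>_. 0) \<in> affine_functions" using affine_mem[OF zero_section Cinf_zero[OF okB]] by simp
next
  fix u v assume "u \<in> affine_functions" "v \<in> affine_functions"
  then obtain X f Y g where u: "u = affine X f" "X \<in> sections M E" "f \<in> Cinf M"
    and v: "v = affine Y g" "Y \<in> sections M E" "g \<in> Cinf M" by (metis affine_functionsE)
  note add = affine_add[OF u(2) v(2), of f g] and scale = affine_scale[OF u(2), of _ f]
  show "(\<lambda>x. u x + v x) \<in> affine_functions"
    using affine_mem[OF add_sections[OF u(2) v(2)] Cinf_add[OF okB u(3) v(3)]] add u v by simp
  show "fun_bracket u v \<in> affine_functions"
    unfolding u(1) v(1) fun_bracket_affine[OF u(2,3) v(2,3)] affine_bracket_def
    by (intro affine_mem br_sections u v Cinf_diff[OF okB] act_Cinf)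
  show "fun_bracket u v x = - fun_bracket v u x" for x
    unfolding u(1) v(1) fun_bracket_affine[OF u(2,3) v(2,3)] fun_bracket_affine[OF v(2,3) u(2,3)]
    by (rule affine_bracket_anti[OF u(2) v(2)])
  show "fun_bracket (\<lambda>x. c * u x) v x = c * fun_bracket u v x" for c x
    using fun_bracket_affine[OF scale_sections[OF u(2), of c] Cinf_scale[OF okB u(3), of c] v(2,3)]
      affine_bracket_scale[OF u(2,3) v(2,3), of c x] fun_bracket_affine[OF u(2,3) v(2,3)] scale[of c]
    by (simp add: u(1) v(1))
  show "fun_bracket u v q = 0" if "q \<in> points (dual_total M E)"
    "\<And>D. point_derivation (dual_total M E) q D \<Longrightarrow> D u = 0" for q
    unfolding u(1) v(1) fun_bracket_affine[OF u(2,3) v(2,3)]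
    by (rule affine_bracket_tensorial[OF u(2,3) v(2,3) that(1)]) (use that(2) u(1) in auto)
  fix w assume "w \<in> affine_functions"
  then obtain Z k where w: "w = affine Z k" "Z \<in> sections M E" "k \<in> Cinf M" by (metis affine_functionsE)
  show "fun_bracket (\<lambda>x. u x + v x) w x = fun_bracket u w x + fun_bracket v w x" for x
    using fun_bracket_affine[OF add_sections[OF u(2) v(2)] Cinf_add[OF okB u(3) v(3)] w(2,3)]
      affine_bracket_add[OF u(2,3) v(2,3) w(2,3)] fun_bracket_affine[OF u(2,3) w(2,3)]
      fun_bracket_affine[OF v(2,3) w(2,3)] add
    by (simp add: u(1) v(1) w(1))
  show "fun_bracket u (fun_bracket v w) x + fun_bracket v (fun_bracket w u) x + fun_bracket w (fun_bracket u v) x = 0" for x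
    unfolding u(1) v(1) w(1) by (rule fun_bracket_jacobi[OF u(2,3) v(2,3) w(2,3)])
next
  fix c u assume "u \<in> affine_functions"
  then obtain X f where u: "u = affine X f" "X \<in> sections M E" "f \<in> Cinf M" by (metis affine_functionsE)
  show "(\<lambda>x. c * u x) \<in> affine_functions"
    using affine_mem[OF scale_sections[OF u(2), of c] Cinf_scale[OF okB u(3), of c]] affine_scale[OF u(2), of c f] u(1) by simp
next
  fix F p assume "F \<in> Cinf (dual_total M E)" "p \<in> points (dual_total M E)"
  then show "\<exists>W n c u. aopen (dual_total M E) W \<and> p \<in> W \<and>
    (\<forall>i<n::nat. c i \<in> Cinf (dual_total M E) \<and> u i \<in> affine_functions) \<and>
    (\<forall>q\<in>W. \<forall>D. point_derivation (dual_total M E) q D \<longrightarrow> D F = (\<Sum>i<n. c i q * D (u i)))"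
    by (rule affine_generates)
qed

text \<open>At the zero section all \<open>\<Phi>\<^sub>Y\<close> vanish; there a vertical derivative of the hypothesis gives the claim.\<close>

lemma Phi_cancel:
  assumes F: "F \<in> Cinf (dual_total M E)" and zero: "\<And>Y q. Y \<in> sections M E \<Longrightarrow> F q * Phi M E Y q = 0"
  shows "F q = 0"
proof (cases "q \<in> points (dual_total M E)")
  case True
  then have "fst q \<in> points M" by (auto simp: points_dual)
  then obtain U \<psi> V \<phi> a r e y h where
    fr: "adapted_frame M E U \<psi> V \<phi> a r e y h" "fst q \<in> adapted_frame.core V \<phi> a r"
    using ex_frame_at by blast
  interpret adapted_frame M E U \<psi> V \<phi> a r e y h by (rule fr(1))
  have pl: "fst q \<in> plateau" using fr(2) core_subset by auto
  then have xU: "fst q \<in> U" and in_ball: "fst q \<in> V" "\<phi> (fst q) \<in> ball a r"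
    using plateau_subset by (auto simp: plateau_def)
  fix i :: 'k
  note D = vertical_derivation[OF True pl, of i]
  have "vertical i q (Phi M E (e i)) = 1"
    using vertical_Phi[OF True pl e_sec] e_eq[OF in_ball] triv_inv[OF vb t xU] by simp
  moreover have "(\<lambda>q. F q * Phi M E (e i) q) = (\<lambda>_. 0)" by (rule ext) (rule zero[OF e_sec])
  then have "vertical i q F * Phi M E (e i) q + F q * vertical i q (Phi M E (e i)) = 0"
    using derivation_mult[OF okN D F PhiC[OF e_sec[of i]]] derivation_zero[OF okN D] by simp
  ultimately show ?thesis using zero[OF e_sec, of q i] by auto
qed (simp add: Cinf_outside[OF okD F])

section \<open>Uniqueness on affine functions\<close>

lemma poisson_determined:
  assumes P: "poisson_structure (dual_total M E) P"
    and PhiP: "\<And>X Y. X \<in> sections M E \<Longrightarrow> Y \<in> sections M E \<Longrightarrow> P (Phi M E X) (Phi M E Y) = Phi M E (br X Y)"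
    and u: "u \<in> affine_functions" and v: "v \<in> affine_functions"
  shows "P u v = fun_bracket u v"
proof -
  interpret poisson_generators "dual_total M E" affine_functions fun_bracket by (rule affine_generators)
  note add = poisson_add[OF P] and leib = poisson_leibniz[OF P] and anti = poisson_anti[OF P]
    and PC = poisson_Cinf[OF P]
  have Phi_pull: "Phi M E (section_mult M E f X) = (\<lambda>q. pull M E f q * Phi M E X q)"
    if "X \<in> sections M E" for f X
    using Phi_mult[OF that] Phi_outside[OF vbE] by (auto simp: fun_eq_iff pull_eq)
  \<comment> \<open>The bracket of \<open>Phi M E X\<close> with the function of
    \<open>section_mult M E g Y\<close> is expanded in two ways, by the Leibniz formula of
    \<open>P\<close> and by that of the algebroid. The results differ by the claimed difference
    times \<open>Phi M E Y\<close>, for every \<open>Y\<close>, and \<open>Phi_cancel\<close>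
    applies.\<close>
  have mixed: "P (Phi M E X) (pull M E g) q = pull M E (act X g) q"
    if X: "X \<in> sections M E" and g: "g \<in> Cinf M" for X g q
  proof -
    have "P (Phi M E X) (pull M E g) q - pull M E (act X g) q = 0"
    proof (rule Phi_cancel[of "\<lambda>q. P (Phi M E X) (pull M E g) q - pull M E (act X g) q"])
      show "(\<lambda>q. P (Phi M E X) (pull M E g) q - pull M E (act X g) q) \<in> Cinf (dual_total M E)"
        by (intro Cinf_diff[OF okD] PC PhiC pullC act_Cinf X g)
      fix Y q assume Y: "Y \<in> sections M E"
      have "P (Phi M E X) (\<lambda>q. pull M E g q * Phi M E Y q) q = Phi M E (br X (section_mult M E g Y)) q"
        using PhiP[OF X mult_sections[OF g Y]] by (simp add: Phi_pull Y)
      then have "P (Phi M E X) (pull M E g) q * Phi M E Y q + pull M E g q * Phi M E (br X Y) q =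
          g (fst q) * Phi M E (br X Y) q + act X g (fst q) * Phi M E Y q"
        using leib[OF PhiC[OF X] pullC[OF g] PhiC[OF Y]] PhiP[OF X Y] Phi_br_leibniz[OF X Y g, of q] by simp
      then show "(P (Phi M E X) (pull M E g) q - pull M E (act X g) q) * Phi M E Y q = 0"
        by (cases "q \<in> points (dual_total M E)") (simp_all add: pull_eq Phi_outside[OF vbE] left_diff_distrib)
    qed
    then show ?thesis by simp
  qed
  \<comment> \<open>The same comparison with a pulled-back function in the first argument. The
    anchor terms cancel because \<open>act\<close> is linear over functions in its section
    (\<open>act_mult\<close>), which leaves the bracket times \<open>Phi M E X\<close> equal to
    0.\<close>
  have base: "P (pull M E g) (pull M E f) q = 0" if f: "f \<in> Cinf M" and g: "g \<in> Cinf M" for f g q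
  proof (rule Phi_cancel)
    show "P (pull M E g) (pull M E f) \<in> Cinf (dual_total M E)" by (intro PC pullC f g)
    fix X q assume X: "X \<in> sections M E"
    have "P (pull M E g) (\<lambda>q. pull M E f q * Phi M E X q) q = - pull M E (act (section_mult M E f X) g) q"
      using anti[OF pullC[OF g] PhiC[OF mult_sections[OF f X]], of q] mixed[OF mult_sections[OF f X] g, of q]
      by (simp add: Phi_pull X)
    moreover have "P (pull M E g) (\<lambda>q. pull M E f q * Phi M E X q) q =
        P (pull M E g) (pull M E f) q * Phi M E X q - pull M E f q * pull M E (act X g) q"
      using leib[OF pullC[OF g] pullC[OF f] PhiC[OF X]] anti[OF pullC[OF g] PhiC[OF X], of q] mixed[OF X g, of q]
      by simp
    ultimately show "P (pull M E g) (pull M E f) q * Phi M E X q = 0"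
      by (simp add: pull_eq act_mult X split: if_splits)
  qed
  obtain X f where u: "u = affine X f" "X \<in> sections M E" "f \<in> Cinf M" using u by (rule affine_functionsE)
  obtain Y g where v: "v = affine Y g" "Y \<in> sections M E" "g \<in> Cinf M" using v by (rule affine_functionsE)
  note X = PhiC[OF u(2)] pullC[OF u(3)] and Y = PhiC[OF v(2)] pullC[OF v(3)]
  show ?thesis
  proof
    fix q
    have "P u v q = P (Phi M E X) (Phi M E Y) q + P (pull M E f) (Phi M E Y) q +
        (P (Phi M E X) (pull M E g) q + P (pull M E f) (pull M E g) q)"
      unfolding u(1) v(1) affine_def
      by (simp add: add(1)[OF Cinf_add[OF okD X] Y] add(2)[OF Y(1) X] add(2)[OF Y(2) X])
    also have "\<dots> = Phi M E (br X Y) q - pull M E (act Y f) q + pull M E (act X g) q"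
      using anti[OF X(2) Y(1), of q] by (simp add: mixed u v base PhiP)
    also have "\<dots> = fun_bracket u v q"
      unfolding u(1) v(1) fun_bracket_affine[OF u(2,3) v(2,3)]
      by (simp add: affine_bracket_def affine_def pull_eq)
    finally show "P u v q = fun_bracket u v q" .
  qed
qed

lemma Phi_affine: "Phi M E X = affine X (\<lambda>_. 0)"
  by (simp add: affine_def pull_eq)

lemma fun_bracket_Phi:
  assumes "X \<in> sections M E" "Y \<in> sections M E"
  shows "fun_bracket (Phi M E X) (Phi M E Y) = Phi M E (br X Y)"
proof -
  have "act X (\<lambda>_. 0) x = 0" if "X \<in> sections M E" for X x
    using act_fun(3)[OF that Cinf_zero[OF okB] Cinf_zero[OF okB], of 0 x] by simp
  then show ?thesis
    using assms unfolding Phi_affine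
    by (simp add: fun_bracket_affine Cinf_zero[OF okB] affine_bracket_def)
qed

text \<open>For a Poisson structure, the condition on the functions \<open>Phi\<close> is equivalent
  to agreement with \<open>fun_bracket\<close> on all affine functions, by
  \<open>poisson_determined\<close>; existence and uniqueness then carry over from
  \<open>ex1_poisson\<close>.\<close>

lemma ex1_poisson_dual:
  "\<exists>!P. poisson_structure (dual_total M E) P \<and>
    (\<forall>X\<in>sections M E. \<forall>Y\<in>sections M E. P (Phi M E X) (Phi M E Y) = Phi M E (br X Y))"
proof -
  interpret poisson_generators "dual_total M E" affine_functions fun_bracket by (rule affine_generators)
  have Phi: "Phi M E X \<in> affine_functions" if "X \<in> sections M E" for X
    unfolding Phi_affine by (rule affine_mem[OF that Cinf_zero[OF okB]])
  have "(poisson_structure (dual_total M E) P \<and>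
      (\<forall>X\<in>sections M E. \<forall>Y\<in>sections M E. P (Phi M E X) (Phi M E Y) = Phi M E (br X Y))) \<longleftrightarrow>
    (poisson_structure (dual_total M E) P \<and> (\<forall>u\<in>affine_functions. \<forall>v\<in>affine_functions. P u v = fun_bracket u v))" for P
    using poisson_determined[of P] Phi fun_bracket_Phi by auto
  then show ?thesis using ex1_poisson by simp
qed

end

theorem theorem5p3p2:
  fixes M :: "('m, 'v::real_inner) atlas"
    and E :: "('e, 'm, 'v \<times> (real^'k::finite)) bundle_data"
    and \<rho> :: "'e \<Rightarrow> 'm \<times> (('m \<Rightarrow> real) \<Rightarrow> real)"
    and br :: "('m \<Rightarrow> 'e) \<Rightarrow> ('m \<Rightarrow> 'e) \<Rightarrow> ('m \<Rightarrow> 'e)"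
  assumes "lie_algebroid M E \<rho> br"
  shows "(\<forall>X\<in>sections M E. Phi M E X \<in> Cinf (total_atlas (dual_bundle M E))) \<and>
         (\<exists>!P. poisson_structure (total_atlas (dual_bundle M E)) P \<and>
           (\<forall>X\<in>sections M E. \<forall>Y\<in>sections M E.
              P (Phi M E X) (Phi M E Y) = Phi M E (br X Y)))"
  using Phi_Cinf[OF algebroid_bundle[OF assms]] ex1_poisson_dual[OF assms] by blast

end
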